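(* Let $E$ be a Courant algebroid. (1) If $(I,J,K)$ is a hypercomplex structure on $E$, then the section $\Omega$ of $\wedge^2L_J$ defined by $\Omega^\sharp=\frac{I+\sqrt{-1}K}{2}$ is a holomorphic symplectic structure on $E$ relative to the complex structure $J$. (2) Let $J$ be a complex structure on $E$, and let $\Omega\in\Gamma(\wedge^2L_J)$ be a holomorphic symplectic structure on $E$ relative to $J$. Then the triple $\big(I=\Omega^\sharp+\overline{\Omega}^\sharp,\ J,\ K=-\sqrt{-1}(\Omega^\sharp-\overline{\Omega}^\sharp)\big)$ is a hypercomplex structure on $E$.
   Context: A Courant algebroid $(E,\rho,\langle\cdot,\cdot\rangle,\circ)$ over a smooth manifold $M$ is a real vector bundle $E\to M$ with a nondegenerate symmetric pairing $\langle\cdot,\cdot\rangle$ on the fibres, a bundle map $\rho:E\to TM$ (anchor) and an $\mathbb{R}$-bilinear operation $\circ$ on $\Gamma(E)$ (Dorfman bracket) such that for all $f\in C^\infty(M)$, $x,y,z\in\Gamma(E)$: $x\circ(y\circ z)=(x\circ y)\circ z+y\circ(x\circ z)$; $\rho(x\circ y)=[\rho(x),\rho(y)]$; $x\circ fy=(\rho(x)f)y+f(x\circ y)$; $x\circ y+y\circ x=2\mathcal{D}\langle x,y\rangle$; $\mathcal{D}f\circ x=0$; $\rho(x)\langle y,z\rangle=\langle x\circ y,z\rangle+\langle y,x\circ z\rangle$; where $\langle\mathcal{D}f,x\rangle=\frac12\rho(x)f$. All structures are extended $\mathbb{C}$-linearly to $E_{\mathbb{C}}=E\otimes\mathbb{C}$.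 For endomorphisms $F,G$ of the vector bundle $E$, $\mathcal{N}(F,G)(U,V)=FU\circ GV-F(U\circ GV)-G(FU\circ V)+FG(U\circ V)+GU\circ FV-G(U\circ FV)-F(GU\circ V)+GF(U\circ V)$. An almost complex structure on $E$ is a vector bundle endomorphism $J$ of $E$ orthogonal for $\langle\cdot,\cdot\rangle$ with $J^2=-1$; it is a complex structure if $\mathcal{N}(J,J)=0$. A hypercomplex structure on $E$ is a triple $(I,J,K)$ of almost complex structures with $I^2=J^2=K^2=IJK=-1$ such that $\mathcal{N}(I,I),\mathcal{N}(I,J),\mathcal{N}(I,K),\mathcal{N}(J,J),\mathcal{N}(J,K),\mathcal{N}(K,K)$ all vanish. For a complex structure $J$, $L_J$ and $\overline{L_J}$ are the $+\sqrt{-1}$ and $-\sqrt{-1}$ eigenbundles of $J$ in $E_{\mathbb{C}}$; they are maximal isotropic, $E_{\mathbb{C}}=L_J\oplus\overline{L_J}$, and $\overline{L_J}$ is identified with $L_J^*$ via $\langle\cdot,\cdot\rangle$. With the restrictions of $\rho$ and $\circ$, $L_J$ and $L_J^*$ are (complex) Lie algebroids; $d_{L_J^*}:\Gamma(\wedge^kL_J)\to\Gamma(\wedge^{k+1}L_J)$ is the Lie algebroid differential of $L_J^*$ (with $L_J\cong(L_J^* )^*$ via $\langle\cdot,\cdot\rangle$). Elements of $\wedge^kE_{\mathbb{C}}$ are viewed in $\wedge^kE_{\mathbb{C}}^*$ via $e\mapsto\langle e,\cdot\rangle$. For $\Omega\in\Gamma(\wedge^2E_{\mathbb{C}}^* )$,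 the endomorphism $\Omega^\sharp$ of $E_{\mathbb{C}}$ is defined by $\Omega(U,V)=\langle\Omega^\sharp U,V\rangle$; skew-symmetric endomorphisms of $E_{\mathbb{C}}$ correspond bijectively to such $\Omega$. A holomorphic symplectic structure on $E$ relative to (with respect to) $J$ is a section $\Omega$ of $\wedge^2L_J$ with $d_{L_J^*}\Omega=0$ and $\Omega^\sharp\overline{\Omega}^\sharp+\overline{\Omega}^\sharp\Omega^\sharp=-\mathrm{id}_{E_{\mathbb{C}}}$. *)

theory Defs
  imports "HOL-Analysis.Analysis"
begin

section \<open>Smooth maps between finite-dimensional vector spaces\<close>

text \<open>
  Model spaces are finite-dimensional real inner product spaces; the class euclidean-space is
  avoided because it excludes dimension 0 (a Courant algebroid over a point is a quadratic Lie
  algebra, and the zero bundle is a vector bundle).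
\<close>

definition fin_dim :: "'a::real_vector itself \<Rightarrow> bool" where
  "fin_dim _ \<longleftrightarrow> (\<exists>B::'a set. finite B \<and> span B = UNIV)"

text \<open>Meant for an open set S of a finite-dimensional space.\<close>

primrec C_k :: "nat \<Rightarrow> 'a::real_normed_vector set \<Rightarrow> ('a \<Rightarrow> 'b::real_normed_vector) \<Rightarrow> bool" where
  "C_k 0 S f \<longleftrightarrow> continuous_on S f"
| "C_k (Suc k) S f \<longleftrightarrow>
     (\<exists>f'. (\<forall>x\<in>S. (f has_derivative f' x) (at x)) \<and> (\<forall>v. C_k k S (\<lambda>x. f' x v)))"

definition smooth_on :: "'a::real_normed_vector set \<Rightarrow> ('a \<Rightarrow> 'b::real_normed_vector) \<Rightarrow> bool" where
  "smooth_on S f \<longleftrightarrow> (\<forall>k. C_k k S f)"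

definition linear_on :: "'a::real_vector set \<Rightarrow> ('a \<Rightarrow> 'b::real_vector) \<Rightarrow> bool" where
  "linear_on S f \<longleftrightarrow>
     (\<forall>u\<in>S. \<forall>v\<in>S. f (u + v) = f u + f v) \<and> (\<forall>c. \<forall>u\<in>S. f (c *\<^sub>R u) = c *\<^sub>R f u)"

section \<open>Smooth manifolds\<close>

text \<open>
  The underlying space of the manifold is the whole type \<open>'m\<close>.  A smooth structure is given by any
  smooth atlas, consisting of charts \<open>(U, \<phi>)\<close> with values in the model space \<open>'c\<close>; \<open>\<phi>\<close> is
  only relevant on \<open>U\<close>.
\<close>

type_synonym ('m, 'c) chart = "'m set \<times> ('m \<Rightarrow> 'c)"

definition smooth_manifold ::
  "('m::{t2_space,second_countable_topology}, 'c::real_inner) chart set \<Rightarrow> bool" where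
  "smooth_manifold A \<longleftrightarrow>
     fin_dim TYPE('c) \<and>
     (\<forall>p. \<exists>(U, \<phi>)\<in>A. p \<in> U) \<and>
     (\<forall>(U, \<phi>)\<in>A. open U \<and> open (\<phi> ` U) \<and> homeomorphism U (\<phi> ` U) \<phi> (inv_into U \<phi>)) \<and>
     (\<forall>(U, \<phi>)\<in>A. \<forall>(V, \<psi>)\<in>A. smooth_on (\<phi> ` (U \<inter> V)) (\<psi> \<circ> inv_into U \<phi>))"

text \<open>Smoothness of a vector-valued function on an open subset W of the manifold.\<close>

definition smooth_fun_on ::
  "('m, 'c::real_inner) chart set \<Rightarrow> 'm set \<Rightarrow> ('m \<Rightarrow> 'b::real_normed_vector) \<Rightarrow> bool" where
  "smooth_fun_on A W f \<longleftrightarrow> (\<forall>(U, \<phi>)\<in>A. smooth_on (\<phi> ` (U \<inter> W)) (f \<circ> inv_into U \<phi>))"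

definition smooth_functions ::
  "('m, 'c::real_inner) chart set \<Rightarrow> ('m \<Rightarrow> 'b::real_normed_vector) set" where
  "smooth_functions A = {f. smooth_fun_on A UNIV f}"

text \<open>
  Tangent vectors at p are the derivations at p of the algebra of smooth functions (their values on
  non-smooth functions are irrelevant).
\<close>

definition tangent_space ::
  "('m, 'c::real_inner) chart set \<Rightarrow> 'm \<Rightarrow> (('m \<Rightarrow> real) \<Rightarrow> real) set" where
  "tangent_space A p = {D. \<forall>f\<in>smooth_functions A. \<forall>g\<in>smooth_functions A.
     D (\<lambda>q. f q + g q) = D f + D g \<and>
     (\<forall>c. D (\<lambda>q. c * f q) = c * D f) \<and>
     D (\<lambda>q. f q * g q) = D f * g p + f p * D g}"

section \<open>Real vector bundles and Courant algebroids\<close>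

text \<open>
  The fibre over p is a linear subspace \<open>fibre E p\<close> of some real vector space \<open>'v\<close>, which carries no
  topology and may have any dimension (every vector bundle has this form: take for \<open>'v\<close> the direct
  sum of all fibres).  The smooth structure is given by local trivialisations \<open>(U, \<tau>)\<close>,
  where \<open>\<tau> p\<close> is a linear isomorphism from the fibre over \<open>p \<in> U\<close> onto the typical fibre \<open>'f\<close>.
  A section is a function \<open>'m \<Rightarrow> 'v\<close>.
\<close>

record ('m, 'c, 'v, 'f) vbundle =
  atlas :: "('m, 'c) chart set"
  fibre :: "'m \<Rightarrow> 'v set"
  trivs :: "('m set \<times> ('m \<Rightarrow> 'v \<Rightarrow> 'f)) set"

definition vector_bundle ::
  "('m::{t2_space,second_countable_topology}, 'c::real_inner, 'v::real_vector, 'f::real_inner, 'z)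
     vbundle_scheme \<Rightarrow> bool" where
  "vector_bundle E \<longleftrightarrow>
     smooth_manifold (atlas E) \<and> fin_dim TYPE('f) \<and>
     (\<forall>p. subspace (fibre E p)) \<and>
     (\<forall>p. \<exists>(U, \<tau>)\<in>trivs E. p \<in> U) \<and>
     (\<forall>(U, \<tau>)\<in>trivs E. open U \<and>
        (\<forall>p\<in>U. linear_on (fibre E p) (\<tau> p) \<and> bij_betw (\<tau> p) (fibre E p) UNIV)) \<and>
     (\<forall>(U, \<tau>)\<in>trivs E. \<forall>(V, \<sigma>)\<in>trivs E. \<forall>w.
        smooth_fun_on (atlas E) (U \<inter> V) (\<lambda>p. \<sigma> p (inv_into (fibre E p) (\<tau> p) w)))"

definition sections ::
  "('m, 'c::real_inner, 'v, 'f::real_inner, 'z) vbundle_scheme \<Rightarrow> ('m \<Rightarrow> 'v) set" where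
  "sections E = {x. (\<forall>p. x p \<in> fibre E p) \<and>
     (\<forall>(U, \<tau>)\<in>trivs E. smooth_fun_on (atlas E) U (\<lambda>p. \<tau> p (x p)))}"

text \<open>A fibrewise linear map is smooth iff it maps smooth sections to smooth sections.\<close>

definition bundle_endomorphism ::
  "('m, 'c::real_inner, 'v::real_vector, 'f::real_inner, 'z) vbundle_scheme \<Rightarrow> ('m \<Rightarrow> 'v \<Rightarrow> 'v) \<Rightarrow> bool"
where
  "bundle_endomorphism E F \<longleftrightarrow>
     (\<forall>p. linear_on (fibre E p) (F p) \<and> F p ` fibre E p \<subseteq> fibre E p) \<and>
     (\<forall>x\<in>sections E. (\<lambda>p. F p (x p)) \<in> sections E)"

text \<open>\<open>anchor E p v\<close> is the tangent vector \<open>\<rho>(v)\<close> at \<open>p\<close>.\<close>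

record ('m, 'c, 'v, 'f) courant = "('m, 'c, 'v, 'f) vbundle" +
  pairing :: "'m \<Rightarrow> 'v \<Rightarrow> 'v \<Rightarrow> real"
  anchor :: "'m \<Rightarrow> 'v \<Rightarrow> ('m \<Rightarrow> real) \<Rightarrow> real"
  dorfman :: "('m \<Rightarrow> 'v) \<Rightarrow> ('m \<Rightarrow> 'v) \<Rightarrow> ('m \<Rightarrow> 'v)"

definition anchor_fun ::
  "('m, 'c, 'v, 'f, 'z) courant_scheme \<Rightarrow> ('m \<Rightarrow> 'v) \<Rightarrow> ('m \<Rightarrow> real) \<Rightarrow> 'm \<Rightarrow> real" where
  "anchor_fun E x f = (\<lambda>p. anchor E p (x p) f)"

definition pairing_fun ::
  "('m, 'c, 'v, 'f, 'z) courant_scheme \<Rightarrow> ('m \<Rightarrow> 'v) \<Rightarrow> ('m \<Rightarrow> 'v) \<Rightarrow> 'm \<Rightarrow> real" where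
  "pairing_fun E x y = (\<lambda>p. pairing E p (x p) (y p))"

definition bundle_pairing ::
  "('m, 'c::real_inner, 'v::real_vector, 'f::real_inner, 'z) courant_scheme \<Rightarrow> bool" where
  "bundle_pairing E \<longleftrightarrow>
     (\<forall>p. \<forall>u\<in>fibre E p. linear_on (fibre E p) (pairing E p u)) \<and>
     (\<forall>p. \<forall>u\<in>fibre E p. \<forall>v\<in>fibre E p. pairing E p u v = pairing E p v u) \<and>
     (\<forall>p. \<forall>u\<in>fibre E p. (\<forall>v\<in>fibre E p. pairing E p u v = 0) \<longrightarrow> u = 0) \<and>
     (\<forall>x\<in>sections E. \<forall>y\<in>sections E. pairing_fun E x y \<in> smooth_functions (atlas E))"

definition bundle_anchor ::
  "('m, 'c::real_inner, 'v::real_vector, 'f::real_inner, 'z) courant_scheme \<Rightarrow> bool" where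
  "bundle_anchor E \<longleftrightarrow>
     (\<forall>p. \<forall>v\<in>fibre E p. anchor E p v \<in> tangent_space (atlas E) p) \<and>
     (\<forall>p. \<forall>f\<in>smooth_functions (atlas E). linear_on (fibre E p) (\<lambda>v. anchor E p v f)) \<and>
     (\<forall>x\<in>sections E. \<forall>f\<in>smooth_functions (atlas E).
        anchor_fun E x f \<in> smooth_functions (atlas E))"

definition courant_D ::
  "('m, 'c, 'v, 'f, 'z) courant_scheme \<Rightarrow> ('m \<Rightarrow> real) \<Rightarrow> 'm \<Rightarrow> 'v" where
  "courant_D E f = (\<lambda>p. THE e. e \<in> fibre E p \<and>
     (\<forall>v\<in>fibre E p. pairing E p e v = 1 / 2 * anchor E p v f))"

definition courant_algebroid ::
  "('m::{t2_space,second_countable_topology}, 'c::real_inner, 'v::real_vector, 'f::real_inner, 'z)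
     courant_scheme \<Rightarrow> bool" where
  "courant_algebroid E \<longleftrightarrow>
     vector_bundle E \<and> bundle_pairing E \<and> bundle_anchor E \<and>
     (\<forall>x\<in>sections E. \<forall>y\<in>sections E. dorfman E x y \<in> sections E) \<and>
     (\<forall>x\<in>sections E. \<forall>y\<in>sections E. \<forall>z\<in>sections E. \<forall>a b.
        dorfman E x (\<lambda>p. a *\<^sub>R y p + b *\<^sub>R z p) = (\<lambda>p. a *\<^sub>R dorfman E x y p + b *\<^sub>R dorfman E x z p) \<and>
        dorfman E (\<lambda>p. a *\<^sub>R y p + b *\<^sub>R z p) x = (\<lambda>p. a *\<^sub>R dorfman E y x p + b *\<^sub>R dorfman E z x p)) \<and>
     (\<forall>x\<in>sections E. \<forall>y\<in>sections E. \<forall>z\<in>sections E.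
        dorfman E x (dorfman E y z) =
          (\<lambda>p. dorfman E (dorfman E x y) z p + dorfman E y (dorfman E x z) p)) \<and>
     (\<forall>x\<in>sections E. \<forall>y\<in>sections E. \<forall>f\<in>smooth_functions (atlas E).
        anchor_fun E (dorfman E x y) f =
          (\<lambda>p. anchor_fun E x (anchor_fun E y f) p - anchor_fun E y (anchor_fun E x f) p)) \<and>
     (\<forall>x\<in>sections E. \<forall>y\<in>sections E. \<forall>f\<in>smooth_functions (atlas E).
        dorfman E x (\<lambda>p. f p *\<^sub>R y p) =
          (\<lambda>p. anchor_fun E x f p *\<^sub>R y p + f p *\<^sub>R dorfman E x y p)) \<and>
     (\<forall>x\<in>sections E. \<forall>y\<in>sections E.
        (\<lambda>p. dorfman E x y p + dorfman E y x p) =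
          (\<lambda>p. 2 *\<^sub>R courant_D E (pairing_fun E x y) p)) \<and>
     (\<forall>f\<in>smooth_functions (atlas E). \<forall>x\<in>sections E.
        dorfman E (courant_D E f) x = (\<lambda>p. 0)) \<and>
     (\<forall>x\<in>sections E. \<forall>y\<in>sections E. \<forall>z\<in>sections E.
        anchor_fun E x (pairing_fun E y z) =
          (\<lambda>p. pairing_fun E (dorfman E x y) z p + pairing_fun E y (dorfman E x z) p))"

section \<open>Complex and hypercomplex structures\<close>

definition act :: "('m \<Rightarrow> 'v \<Rightarrow> 'v) \<Rightarrow> ('m \<Rightarrow> 'v) \<Rightarrow> ('m \<Rightarrow> 'v)" where
  "act F x = (\<lambda>p. F p (x p))"

definition nijenhuis ::
  "('m, 'c, 'v::real_vector, 'f, 'z) courant_scheme \<Rightarrow> ('m \<Rightarrow> 'v \<Rightarrow> 'v) \<Rightarrow> ('m \<Rightarrow> 'v \<Rightarrow> 'v) \<Rightarrow>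
     ('m \<Rightarrow> 'v) \<Rightarrow> ('m \<Rightarrow> 'v) \<Rightarrow> 'm \<Rightarrow> 'v" where
  "nijenhuis E F G U V = (\<lambda>p.
     dorfman E (act F U) (act G V) p
     - act F (dorfman E U (act G V)) p
     - act G (dorfman E (act F U) V) p
     + act F (act G (dorfman E U V)) p
     + dorfman E (act G U) (act F V) p
     - act G (dorfman E U (act F V)) p
     - act F (dorfman E (act G U) V) p
     + act G (act F (dorfman E U V)) p)"

definition nijenhuis_vanishes ::
  "('m, 'c::real_inner, 'v::real_vector, 'f::real_inner, 'z) courant_scheme \<Rightarrow>
     ('m \<Rightarrow> 'v \<Rightarrow> 'v) \<Rightarrow> ('m \<Rightarrow> 'v \<Rightarrow> 'v) \<Rightarrow> bool" where
  "nijenhuis_vanishes E F G \<longleftrightarrow>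
     (\<forall>U\<in>sections E. \<forall>V\<in>sections E. nijenhuis E F G U V = (\<lambda>p. 0))"

definition almost_complex_structure ::
  "('m, 'c::real_inner, 'v::real_vector, 'f::real_inner, 'z) courant_scheme \<Rightarrow>
     ('m \<Rightarrow> 'v \<Rightarrow> 'v) \<Rightarrow> bool" where
  "almost_complex_structure E J \<longleftrightarrow>
     bundle_endomorphism E J \<and>
     (\<forall>p. \<forall>u\<in>fibre E p. \<forall>v\<in>fibre E p. pairing E p (J p u) (J p v) = pairing E p u v) \<and>
     (\<forall>p. \<forall>u\<in>fibre E p. J p (J p u) = - u)"

definition complex_structure ::
  "('m, 'c::real_inner, 'v::real_vector, 'f::real_inner, 'z) courant_scheme \<Rightarrow>
     ('m \<Rightarrow> 'v \<Rightarrow> 'v) \<Rightarrow> bool" where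
  "complex_structure E J \<longleftrightarrow> almost_complex_structure E J \<and> nijenhuis_vanishes E J J"

text \<open>The conditions \<open>I\<^sup>2 = J\<^sup>2 = K\<^sup>2 = -1\<close> are part of being almost complex structures.\<close>

definition hypercomplex_structure ::
  "('m, 'c::real_inner, 'v::real_vector, 'f::real_inner, 'z) courant_scheme \<Rightarrow>
     ('m \<Rightarrow> 'v \<Rightarrow> 'v) \<Rightarrow> ('m \<Rightarrow> 'v \<Rightarrow> 'v) \<Rightarrow> ('m \<Rightarrow> 'v \<Rightarrow> 'v) \<Rightarrow> bool" where
  "hypercomplex_structure E I J K \<longleftrightarrow>
     almost_complex_structure E I \<and> almost_complex_structure E J \<and> almost_complex_structure E K \<and>
     (\<forall>p. \<forall>u\<in>fibre E p. I p (J p (K p u)) = - u) \<and>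
     nijenhuis_vanishes E I I \<and> nijenhuis_vanishes E I J \<and> nijenhuis_vanishes E I K \<and>
     nijenhuis_vanishes E J J \<and> nijenhuis_vanishes E J K \<and> nijenhuis_vanishes E K K"

section \<open>Complexification\<close>

text \<open>
  The element \<open>u + \<i>v\<close> of the complexified fibre is the pair \<open>(u, v)\<close>; addition of pairs is the one of
  the product type.
\<close>

definition cscale :: "complex \<Rightarrow> 'v::real_vector \<times> 'v \<Rightarrow> 'v \<times> 'v" where
  "cscale z U = (Re z *\<^sub>R fst U - Im z *\<^sub>R snd U, Re z *\<^sub>R snd U + Im z *\<^sub>R fst U)"

definition cconj :: "'v::real_vector \<times> 'v \<Rightarrow> 'v \<times> 'v" where
  "cconj U = (fst U, - snd U)"

definition cext :: "('v \<Rightarrow> 'v) \<Rightarrow> 'v \<times> 'v \<Rightarrow> 'v \<times> 'v" where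
  "cext F U = (F (fst U), F (snd U))"

definition cfibre :: "('m, 'c, 'v, 'f, 'z) vbundle_scheme \<Rightarrow> 'm \<Rightarrow> ('v \<times> 'v) set" where
  "cfibre E p = fibre E p \<times> fibre E p"

definition csections ::
  "('m, 'c::real_inner, 'v, 'f::real_inner, 'z) vbundle_scheme \<Rightarrow> ('m \<Rightarrow> 'v \<times> 'v) set" where
  "csections E = {U. (\<lambda>p. fst (U p)) \<in> sections E \<and> (\<lambda>p. snd (U p)) \<in> sections E}"

definition cpairing ::
  "('m, 'c, 'v, 'f, 'z) courant_scheme \<Rightarrow> 'm \<Rightarrow> 'v \<times> 'v \<Rightarrow> 'v \<times> 'v \<Rightarrow> complex" where
  "cpairing E p U V = Complex
     (pairing E p (fst U) (fst V) - pairing E p (snd U) (snd V))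
     (pairing E p (fst U) (snd V) + pairing E p (snd U) (fst V))"

definition canchor_fun ::
  "('m, 'c, 'v, 'f, 'z) courant_scheme \<Rightarrow> ('m \<Rightarrow> 'v \<times> 'v) \<Rightarrow> ('m \<Rightarrow> complex) \<Rightarrow> 'm \<Rightarrow> complex" where
  "canchor_fun E U f = (\<lambda>p. Complex
     (anchor E p (fst (U p)) (\<lambda>q. Re (f q)) - anchor E p (snd (U p)) (\<lambda>q. Im (f q)))
     (anchor E p (fst (U p)) (\<lambda>q. Im (f q)) + anchor E p (snd (U p)) (\<lambda>q. Re (f q))))"

definition cdorfman ::
  "('m, 'c, 'v::real_vector, 'f, 'z) courant_scheme \<Rightarrow>
     ('m \<Rightarrow> 'v \<times> 'v) \<Rightarrow> ('m \<Rightarrow> 'v \<times> 'v) \<Rightarrow> 'm \<Rightarrow> 'v \<times> 'v" where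
  "cdorfman E U V = (\<lambda>p.
     (dorfman E (\<lambda>q. fst (U q)) (\<lambda>q. fst (V q)) p - dorfman E (\<lambda>q. snd (U q)) (\<lambda>q. snd (V q)) p,
      dorfman E (\<lambda>q. fst (U q)) (\<lambda>q. snd (V q)) p + dorfman E (\<lambda>q. snd (U q)) (\<lambda>q. fst (V q)) p))"

definition L_bundle ::
  "('m, 'c, 'v::real_vector, 'f, 'z) vbundle_scheme \<Rightarrow> ('m \<Rightarrow> 'v \<Rightarrow> 'v) \<Rightarrow> 'm \<Rightarrow> ('v \<times> 'v) set" where
  "L_bundle E J p = {U \<in> cfibre E p. cext (J p) U = cscale \<i> U}"

definition Lbar_bundle ::
  "('m, 'c, 'v::real_vector, 'f, 'z) vbundle_scheme \<Rightarrow> ('m \<Rightarrow> 'v \<Rightarrow> 'v) \<Rightarrow> 'm \<Rightarrow> ('v \<times> 'v) set" where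
  "Lbar_bundle E J p = {U \<in> cfibre E p. cext (J p) U = cscale (- \<i>) U}"

definition Lbar_sections ::
  "('m, 'c::real_inner, 'v::real_vector, 'f::real_inner, 'z) vbundle_scheme \<Rightarrow>
     ('m \<Rightarrow> 'v \<Rightarrow> 'v) \<Rightarrow> ('m \<Rightarrow> 'v \<times> 'v) set" where
  "Lbar_sections E J = {U \<in> csections E. \<forall>p. U p \<in> Lbar_bundle E J p}"

section \<open>Two-forms and holomorphic symplectic structures\<close>

text \<open>Sections of the second exterior power of the dual of the complexified bundle.\<close>

definition two_form ::
  "('m, 'c::real_inner, 'v::real_vector, 'f::real_inner, 'z) vbundle_scheme \<Rightarrow>
     ('m \<Rightarrow> 'v \<times> 'v \<Rightarrow> 'v \<times> 'v \<Rightarrow> complex) \<Rightarrow> bool" where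
  "two_form E \<Omega> \<longleftrightarrow>
     (\<forall>p. \<forall>U\<in>cfibre E p. \<forall>V\<in>cfibre E p. \<forall>W\<in>cfibre E p. \<forall>z.
        \<Omega> p (U + V) W = \<Omega> p U W + \<Omega> p V W \<and>
        \<Omega> p (cscale z U) W = z * \<Omega> p U W \<and>
        \<Omega> p U V = - \<Omega> p V U) \<and>
     (\<forall>U\<in>csections E. \<forall>V\<in>csections E. (\<lambda>p. \<Omega> p (U p) (V p)) \<in> smooth_functions (atlas E))"

text \<open>The bivector \<open>A \<and> B\<close>, viewed as a two-form by means of the pairing.\<close>

definition wedge_form ::
  "('m, 'c, 'v, 'f, 'z) courant_scheme \<Rightarrow> 'm \<Rightarrow> 'v \<times> 'v \<Rightarrow> 'v \<times> 'v \<Rightarrow>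
     'v \<times> 'v \<Rightarrow> 'v \<times> 'v \<Rightarrow> complex" where
  "wedge_form E p A B U V =
     cpairing E p A U * cpairing E p B V - cpairing E p A V * cpairing E p B U"

text \<open>
  Smooth sections of \<open>\<And>\<^sup>2 L\<^sub>J\<close>: two-forms which at every point are sums of elements \<open>A \<and> B\<close> with
  \<open>A\<close> and \<open>B\<close> in \<open>L\<^sub>J\<close> (complex coefficients can be absorbed into \<open>A\<close>).
\<close>

definition section_wedge2_L ::
  "('m, 'c::real_inner, 'v::real_vector, 'f::real_inner, 'z) courant_scheme \<Rightarrow>
     ('m \<Rightarrow> 'v \<Rightarrow> 'v) \<Rightarrow> ('m \<Rightarrow> 'v \<times> 'v \<Rightarrow> 'v \<times> 'v \<Rightarrow> complex) \<Rightarrow> bool" where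
  "section_wedge2_L E J \<Omega> \<longleftrightarrow>
     two_form E \<Omega> \<and>
     (\<forall>p. \<exists>(n::nat) A B. (\<forall>i<n. A i \<in> L_bundle E J p \<and> B i \<in> L_bundle E J p) \<and>
        (\<forall>U\<in>cfibre E p. \<forall>V\<in>cfibre E p. \<Omega> p U V = (\<Sum>i<n. wedge_form E p (A i) (B i) U V)))"

definition conj_form ::
  "('m \<Rightarrow> 'v::real_vector \<times> 'v \<Rightarrow> 'v \<times> 'v \<Rightarrow> complex) \<Rightarrow> 'm \<Rightarrow> 'v \<times> 'v \<Rightarrow> 'v \<times> 'v \<Rightarrow> complex" where
  "conj_form \<Omega> p U V = cnj (\<Omega> p (cconj U) (cconj V))"

definition sharp ::
  "('m, 'c, 'v, 'f, 'z) courant_scheme \<Rightarrow> ('m \<Rightarrow> 'v \<times> 'v \<Rightarrow> 'v \<times> 'v \<Rightarrow> complex) \<Rightarrow>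
     'm \<Rightarrow> 'v \<times> 'v \<Rightarrow> 'v \<times> 'v" where
  "sharp E \<Omega> p U = (THE W. W \<in> cfibre E p \<and> (\<forall>V\<in>cfibre E p. \<Omega> p U V = cpairing E p W V))"

text \<open>
  The differential of a complex Lie algebroid with given anchor (acting on functions) and bracket, in
  degree k.  A k-form is given by its values on lists of k sections; \<open>nths as (- S)\<close> omits the
  entries of the list at the positions in S.
\<close>

definition lie_algebroid_d ::
  "('s \<Rightarrow> ('m \<Rightarrow> complex) \<Rightarrow> 'm \<Rightarrow> complex) \<Rightarrow> ('s \<Rightarrow> 's \<Rightarrow> 's) \<Rightarrow> nat \<Rightarrow>
     ('s list \<Rightarrow> 'm \<Rightarrow> complex) \<Rightarrow> 's list \<Rightarrow> 'm \<Rightarrow> complex" where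
  "lie_algebroid_d \<rho> br k \<omega> as = (\<lambda>p.
     (\<Sum>i\<le>k. (-1) ^ i * \<rho> (as ! i) (\<omega> (nths as (- {i}))) p) +
     (\<Sum>j\<le>k. \<Sum>i<j. (-1) ^ (i + j) * \<omega> (br (as ! i) (as ! j) # nths as (- {i, j})) p))"

definition form_on_sections ::
  "('m \<Rightarrow> 'e \<Rightarrow> 'e \<Rightarrow> complex) \<Rightarrow> ('m \<Rightarrow> 'e) list \<Rightarrow> 'm \<Rightarrow> complex" where
  "form_on_sections \<Omega> as = (\<lambda>p. \<Omega> p ((as ! 0) p) ((as ! 1) p))"

text \<open>
  The dual of \<open>L\<^sub>J\<close> is the conjugate bundle, through the pairing; under this identification a
  section of \<open>\<And>\<^sup>2 L\<^sub>J\<close> is evaluated on sections of the conjugate bundle.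
\<close>

definition d_Lstar_closed ::
  "('m, 'c::real_inner, 'v::real_vector, 'f::real_inner, 'z) courant_scheme \<Rightarrow>
     ('m \<Rightarrow> 'v \<Rightarrow> 'v) \<Rightarrow> ('m \<Rightarrow> 'v \<times> 'v \<Rightarrow> 'v \<times> 'v \<Rightarrow> complex) \<Rightarrow> bool" where
  "d_Lstar_closed E J \<Omega> \<longleftrightarrow>
     (\<forall>a\<in>Lbar_sections E J. \<forall>b\<in>Lbar_sections E J. \<forall>c\<in>Lbar_sections E J.
        lie_algebroid_d (canchor_fun E) (cdorfman E) 2 (form_on_sections \<Omega>) [a, b, c] = (\<lambda>p. 0))"

definition holomorphic_symplectic ::
  "('m, 'c::real_inner, 'v::real_vector, 'f::real_inner, 'z) courant_scheme \<Rightarrow>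
     ('m \<Rightarrow> 'v \<Rightarrow> 'v) \<Rightarrow> ('m \<Rightarrow> 'v \<times> 'v \<Rightarrow> 'v \<times> 'v \<Rightarrow> complex) \<Rightarrow> bool" where
  "holomorphic_symplectic E J \<Omega> \<longleftrightarrow>
     section_wedge2_L E J \<Omega> \<and> d_Lstar_closed E J \<Omega> \<and>
     (\<forall>p. \<forall>U\<in>cfibre E p.
        sharp E \<Omega> p (sharp E (conj_form \<Omega>) p U) + sharp E (conj_form \<Omega>) p (sharp E \<Omega> p U) = - U)"

end

theory Submission
  imports Defs
begin

text \<open>
  The conjugate bundle of \<open>L\<^sub>J\<close> is the image of the real bundle under \<open>x \<mapsto> x + \<i> J x\<close>, so conditions on a
  form over it can be read on real sections.  Write \<open>\<omega> = (I + \<i> K) / 2\<close> for the endomorphism belonging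
  to \<open>\<Omega>\<close>.

  The pointwise part is linear algebra: a two-form \<open>\<Omega>\<close> is a section of \<open>\<And>\<^sup>2 L\<^sub>J\<close> with
  \<open>\<omega> \<omega>' + \<omega>' \<omega> = -1\<close> (where \<open>\<omega>'\<close> is the conjugate of \<open>\<omega>\<close>) exactly when \<open>I, J, K\<close> are skew and satisfy the quaternion
  relations (\<open>section_wedge2_L_if_quaternionic\<close>, \<open>IJK_quaternionic\<close>).

  For the differential part, the invariance of the pairing and the formula for the symmetric part of the
  bracket collapse the six terms of \<open>d\<Omega>(a, b, c)\<close> to the pairing of
  \<open>a \<circ> \<omega>b + \<omega>a \<circ> b - \<omega>(a \<circ> b)\<close> with \<open>c\<close> (\<open>lie_algebroid_d_of_skew_endomorphism\<close>).  For
  \<open>a = x + \<i> J x\<close> and \<open>b = y + \<i> J y\<close> this section lies in the conjugate bundle, which is its own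
  orthogonal complement, iff the Nijenhuis concomitant \<open>N(J, I)(x, y)\<close> vanishes, provided that \<open>N(J, J) = 0\<close>.  Hence \<open>\<Omega>\<close> is closed iff
  \<open>N(J, I) = 0\<close> (\<open>closed_iff_nijenhuis_JI\<close>).

  Finally \<open>N(J, J) = 0\<close> and \<open>N(J, I) = 0\<close> force all the other concomitants of a quaternionic triple to vanish
  (\<open>nijenhuis_vanishes_all\<close>).  This follows from two identities that hold for every bilinear bracket and
  are verified by expanding both sides with the quaternion relations.

  One analytic point remains.  An endomorphism obtained from a form is only known through smooth pairings
  with global sections, and it must be shown to preserve smooth sections.  Bump functions extend local
  frames to global sections, and solving the linear system given by the Gram matrix of such a frame shows
  that a fibrewise family with smooth pairings is a smooth section (\<open>section_if_pairings_smooth\<close>).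
\<close>

section \<open>Dual bases\<close>

text \<open>
  The map \<open>G u = \<Sum>x\<in>B. b u x *\<^sub>R x\<close> is an injective endomorphism of the finite-dimensional space \<open>V\<close>, by
  nondegeneracy, hence onto; the dual vector \<open>e x\<close> is a preimage of \<open>x\<close>.  The lemma serves for the indefinite
  pairing on the fibres, and for the inner products of the model spaces, where it replaces an orthonormal basis.
\<close>

lemma dual_basis:
  fixes V :: "'a::real_vector set" and b :: "'a \<Rightarrow> 'a \<Rightarrow> real"
  assumes V: "subspace V" and fin: "finite B0" "V \<subseteq> span B0"
    and lin: "\<And>u. u \<in> V \<Longrightarrow> linear_on V (b u)"
    and sym: "\<And>u v. u \<in> V \<Longrightarrow> v \<in> V \<Longrightarrow> b u v = b v u"
    and nondeg: "\<And>u. u \<in> V \<Longrightarrow> (\<forall>v\<in>V. b u v = 0) \<Longrightarrow> u = 0"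
  obtains B e where "finite B" "B \<subseteq> V" "e ` B \<subseteq> V"
    "\<forall>x\<in>B. \<forall>y\<in>B. b (e x) y = (if x = y then 1 else 0)"
    "\<forall>y\<in>V. y = (\<Sum>x\<in>B. b (e x) y *\<^sub>R x)"
proof -
  obtain B where B: "B \<subseteq> V" "independent B" "V \<subseteq> span B"
    using maximal_independent_subset[of V] by blast
  have finB: "finite B"
    using independent_span_bound[OF fin(1) B(2)] B(1) fin(2) by blast
  have spB: "span B = V"
    using B V by (metis span_eq_iff span_mono subset_antisym)
  have add: "b u (v + w) = b u v + b u w" and scale: "b u (c *\<^sub>R v) = c * b u v"
    if "u \<in> V" "v \<in> V" "w \<in> V" for u v w c
    using lin[OF that(1)] that by (auto simp: linear_on_def)
  have sum: "b u (\<Sum>x\<in>T. f x) = (\<Sum>x\<in>T. b u (f x))"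
    if "u \<in> V" "finite T" "\<And>x. x \<in> T \<Longrightarrow> f x \<in> V" for u T and f :: "'a \<Rightarrow> 'a"
    using that(2,3)
  proof (induction T rule: finite_induct)
    case empty
    show ?case using scale[OF that(1) subspace_0[OF V] subspace_0[OF V], of 0] by simp
  next
    case (insert x T)
    then show ?case using add[OF that(1), of "f x" "sum f T"] subspace_sum[OF V, of T f] by simp
  qed
  define G where "G u = (\<Sum>x\<in>B. b u x *\<^sub>R x)" for u
  have GV: "G u \<in> V" for u
    unfolding G_def using B(1) V by (intro subspace_sum) (auto intro: subspace_scale)
  obtain h where h: "linear h" "\<And>x. x \<in> B \<Longrightarrow> h x = G x"
    using linear_independent_extend[OF B(2), of G] by auto
  have hG: "h u = G u" if "u \<in> V" for u
  proof -
    have "u \<in> span B" using that spB by simp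
    then have "u \<in> V \<and> h u = G u"
    proof (induction rule: span_induct_alt)
      case base
      have "b 0 x = 0" if "x \<in> V" for x
        using sym[OF subspace_0[OF V] that] scale[OF that that that, of 0] by simp
      then show ?case using B(1) subspace_0[OF V] by (auto simp: G_def linear_0[OF h(1)] intro!: sum.neutral)
    next
      case (step c x y)
      have x: "x \<in> V" using step B(1) by auto
      have "b (c *\<^sub>R x + y) z = c * b x z + b y z" if z: "z \<in> B" for z
      proof -
        have zV: "z \<in> V" using z B(1) by auto
        have cx: "c *\<^sub>R x \<in> V" using x V by (auto intro: subspace_scale)
        have cy: "c *\<^sub>R x + y \<in> V" using cx step V by (auto intro: subspace_add)
        show ?thesis using step sym[OF cy zV] add[OF zV cx, of y] scale[OF zV x x, of c] sym[OF zV x] sym[of z y] zV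
          by simp
      qed
      then have "G (c *\<^sub>R x + y) = c *\<^sub>R G x + G y"
        by (simp add: G_def scaleR_add_left sum.distrib scaleR_sum_right)
      then show ?case using step x V h by (simp add: linear_add linear_scale subspace_add subspace_scale)
    qed
    then show ?thesis by simp
  qed
  have inj: "inj_on h (span B)"
  proof -
    have "u = 0" if "u \<in> span B" "h u = 0" for u
    proof -
      have u: "u \<in> V" using that spB by simp
      have "(\<Sum>x\<in>B. b u x *\<^sub>R x) = 0" using hG[OF u] that(2) by (simp add: G_def)
      then have z: "b u x = 0" if "x \<in> B" for x
        using independentD[OF B(2) finB subset_refl] that by blast
      have "b u v = 0" if "v \<in> V" for v
      proof -
        have "v \<in> span B" using that spB by simp
        then have "v \<in> V \<and> b u v = 0"
        proof (induction rule: span_induct_alt)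
          case base
          show ?case using scale[OF u u u, of 0] subspace_0[OF V] by simp
        next
          case (step c x y)
          then show ?case using z B(1) add[OF u, of "c *\<^sub>R x" y] scale[OF u, of x x c] V
            by (auto simp: subspace_add subspace_scale subset_iff)
        qed
        then show ?thesis by simp
      qed
      then show ?thesis using nondeg u by blast
    qed
    then show ?thesis using linear_injective_on_subspace_0[OF h(1) subspace_span] by blast
  qed
  have indep: "independent (h ` B)"
    using linear_independent_injective_image[OF h(1) B(2) inj] .
  have card: "card (h ` B) = card B"
    using inj span_superset by (intro card_image) (blast intro: inj_on_subset)
  have sub: "h ` B \<subseteq> span B"
    using h(2) GV spB by auto
  \<comment> \<open>A basis vector outside the span of the image would give too large an independent set.\<close>
  have "B \<subseteq> span (h ` B)"
  proof
    fix x assume x: "x \<in> B"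
    show "x \<in> span (h ` B)"
    proof (rule ccontr)
      assume n: "x \<notin> span (h ` B)"
      then have "independent (insert x (h ` B))" "x \<notin> h ` B"
        using independent_insert[of x "h ` B"] indep span_base[of x "h ` B"] by auto
      moreover have "insert x (h ` B) \<subseteq> span B" using sub x span_base by auto
      ultimately have "card (insert x (h ` B)) \<le> card B" "x \<notin> h ` B"
        using independent_span_bound[OF finB] by auto
      then show False using card finB by simp
    qed
  qed
  then have "\<exists>u\<in>V. G u = x" if "x \<in> B" for x
    using that linear_span_image[OF h(1), of B] spB hG by force
  then obtain e where e: "\<And>x. x \<in> B \<Longrightarrow> e x \<in> V \<and> G (e x) = x" by metis
  have delta: "b (e x) y = (if x = y then 1 else 0)" if "x \<in> B" "y \<in> B" for x y
  proof -
    have "(\<Sum>z\<in>B. b (e x) z *\<^sub>R z) = (\<Sum>z\<in>B. (if x = z then 1 else 0) *\<^sub>R z)"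
      using e[OF that(1)] finB that(1)
      by (simp add: G_def if_distrib[of "\<lambda>c. c *\<^sub>R _"] cong: if_cong)
    then have "(\<Sum>z\<in>B. (b (e x) z - (if x = z then 1 else 0)) *\<^sub>R z) = 0"
      by (simp add: scaleR_diff_left sum_subtractf)
    then show ?thesis using independentD[OF B(2) finB subset_refl _ that(2)] by fastforce
  qed
  have expand: "y = (\<Sum>x\<in>B. b (e x) y *\<^sub>R x)" if y: "y \<in> V" for y
  proof -
    have "y \<in> span B" using y spB by simp
    then obtain c where c: "y = (\<Sum>x\<in>B. c x *\<^sub>R x)"
      using span_finite[OF finB] by auto
    have "b (e x) y = c x" if x: "x \<in> B" for x
    proof -
      have "b (e x) y = (\<Sum>z\<in>B. b (e x) (c z *\<^sub>R z))"
        unfolding c using e x finB B(1) V by (intro sum) (auto intro: subspace_scale)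
      also have "\<dots> = (\<Sum>z\<in>B. c z * (if x = z then 1 else 0))"
      proof (rule sum.cong[OF refl])
        fix z assume z: "z \<in> B"
        have ex: "e x \<in> V" and zV: "z \<in> V" using e[OF x] z B(1) by auto
        show "b (e x) (c z *\<^sub>R z) = c z * (if x = z then 1 else 0)"
          using scale[OF ex zV zV, of "c z"] delta[OF x z] by simp
      qed
      also have "\<dots> = c x" using x finB by (simp add: if_distrib cong: if_cong)
      finally show ?thesis .
    qed
    then have "(\<Sum>x\<in>B. c x *\<^sub>R x) = (\<Sum>x\<in>B. b (e x) y *\<^sub>R x)"
      by (intro sum.cong) simp_all
    with c show ?thesis by (rule trans)
  qed
  show thesis
  proof (rule that[OF finB B(1)])
    show "e ` B \<subseteq> V" using e by blast
    show "\<forall>x\<in>B. \<forall>y\<in>B. b (e x) y = (if x = y then 1 else 0)" using delta by blast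
    show "\<forall>y\<in>V. y = (\<Sum>x\<in>B. b (e x) y *\<^sub>R x)" using expand by (rule ballI)
  qed
qed

lemma inner_dual_basis:
  assumes "fin_dim TYPE('a)"
  obtains B and e :: "'a::real_inner \<Rightarrow> 'a" where "finite B"
    "\<forall>y. y = (\<Sum>x\<in>B. (e x \<bullet> y) *\<^sub>R x)"
    "\<forall>x\<in>B. \<forall>y\<in>B. e x \<bullet> y = (if x = y then 1 else 0)"
proof -
  obtain B0 :: "'a set" where B0: "finite B0" "span B0 = UNIV" using assms by (auto simp: fin_dim_def)
  have B0': "UNIV \<subseteq> span B0" using B0(2) by simp
  have lin: "linear_on UNIV ((\<bullet>) u)" for u :: 'a by (simp add: linear_on_def inner_add_right)
  have nondeg: "u = 0" if "\<forall>v\<in>UNIV. u \<bullet> v = 0" for u :: 'a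
    using that inner_eq_zero_iff[of u] by blast
  show thesis
    by (rule dual_basis[where V = UNIV and b = "(\<bullet>)", OF subspace_UNIV B0(1) B0' lin inner_commute nondeg])
      (assumption, rule that, assumption, simp only: ball_UNIV, assumption)
qed

text \<open>
  Needed for supports of bump functions to be closed in the manifold.  The coordinates of a point of the
  ball are bounded, so the ball is a closed subset of a compact box spanned by a basis.
\<close>

lemma compact_cball_fin_dim:
  fixes a :: "'a::real_inner"
  assumes "fin_dim TYPE('a)"
  shows "compact (cball a r)"
proof -
  obtain B and e :: "'a \<Rightarrow> 'a" where B: "finite B"
    and dual: "\<forall>y. y = (\<Sum>x\<in>B. (e x \<bullet> y) *\<^sub>R x)"
    by (rule inner_dual_basis[OF assms])
  have box: "compact {\<Sum>x\<in>T. c x *\<^sub>R x | c. \<forall>x\<in>T. \<bar>c x\<bar> \<le> R}" (is "compact (?K R T)")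
    if "finite T" for T :: "'a set" and R :: real
    using that
  proof (induction T rule: finite_induct)
    case empty
    show ?case by simp
  next
    case (insert t T)
    have "?K R (insert t T) = (\<lambda>(s, u). s *\<^sub>R t + u) ` ({-R..R} \<times> ?K R T)" (is "?L = ?M")
    proof
      show "?L \<subseteq> ?M"
      proof
        fix y assume "y \<in> ?L"
        then obtain c where c: "y = (\<Sum>x\<in>insert t T. c x *\<^sub>R x)" "\<forall>x\<in>insert t T. \<bar>c x\<bar> \<le> R"
          by blast
        have "(\<Sum>x\<in>T. c x *\<^sub>R x) \<in> ?K R T" using c(2) by blast
        moreover have "c t \<in> {-R..R}" using c(2) by (simp add: abs_le_iff minus_le_iff)
        ultimately show "y \<in> ?M"
          using c(1) insert.hyps by (intro image_eqI[where x = "(c t, \<Sum>x\<in>T. c x *\<^sub>R x)"]) simp_all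
      qed
      show "?M \<subseteq> ?L"
      proof
        fix y assume "y \<in> ?M"
        then obtain s u where su: "y = s *\<^sub>R t + u" "s \<in> {-R..R}" "u \<in> ?K R T"
          by (elim imageE SigmaE) simp
        then obtain c where c: "u = (\<Sum>x\<in>T. c x *\<^sub>R x)" "\<forall>x\<in>T. \<bar>c x\<bar> \<le> R" by blast
        have "(\<Sum>x\<in>T. (c(t := s)) x *\<^sub>R x) = (\<Sum>x\<in>T. c x *\<^sub>R x)"
          using insert.hyps by (intro sum.cong) auto
        then have "y = (\<Sum>x\<in>insert t T. (c(t := s)) x *\<^sub>R x)" using su(1) c(1) insert.hyps by simp
        moreover have "\<forall>x\<in>insert t T. \<bar>(c(t := s)) x\<bar> \<le> R"
          using c(2) su(2) by (simp add: abs_le_iff minus_le_iff)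
        ultimately show "y \<in> ?L" by blast
      qed
    qed
    moreover have "compact ((\<lambda>(s, u). s *\<^sub>R t + u) ` ({-R..R} \<times> ?K R T))"
      unfolding split_beta
      by (intro compact_continuous_image compact_Times compact_Icc insert.IH continuous_intros)
    ultimately show ?case by simp
  qed
  define M where "M = (\<Sum>x\<in>B. norm (e x))"
  define R where "R = M * (norm a + \<bar>r\<bar>)"
  have "cball a r \<subseteq> ?K R B"
  proof
    fix y assume y: "y \<in> cball a r"
    have "norm y \<le> norm a + \<bar>r\<bar>"
      using y norm_triangle_ineq2[of y a] abs_ge_self[of r]
      unfolding mem_cball dist_norm norm_minus_commute[of a y] by linarith
    moreover have "0 \<le> M" unfolding M_def by (intro sum_nonneg norm_ge_zero)
    moreover have "norm (e x) \<le> M" if "x \<in> B" for x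
      unfolding M_def using that B by (intro member_le_sum) auto
    ultimately have "norm (e x) * norm y \<le> R" if "x \<in> B" for x
      unfolding R_def using that by (intro mult_mono norm_ge_zero) blast+
    then have "\<bar>e x \<bullet> y\<bar> \<le> R" if "x \<in> B" for x
      using Cauchy_Schwarz_ineq2[of "e x" y] that order_trans by blast
    then show "y \<in> ?K R B" using dual[rule_format, of y]
      by (intro CollectI exI[of _ "\<lambda>x. e x \<bullet> y"] conjI) blast+
  qed
  then have "cball a r \<inter> ?K R B = cball a r" by (rule Int_absorb2)
  moreover have "compact (cball a r \<inter> ?K R B)" by (intro closed_Int_compact closed_cball box B)
  ultimately show ?thesis by (simp only:)
qed

section \<open>Calculus of continuously differentiable maps\<close>

lemma C_k_SucI:
  assumes "\<And>x. x \<in> S \<Longrightarrow> (f has_derivative f' x) (at x)" "\<And>v. C_k k S (\<lambda>x. f' x v)"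
  shows "C_k (Suc k) S f"
  using assms by auto

lemma C_k_SucE:
  assumes "C_k (Suc k) S f"
  obtains f' where "\<And>x. x \<in> S \<Longrightarrow> (f has_derivative f' x) (at x)"
    "\<And>v. C_k k S (\<lambda>x. f' x v)"
  using assms by auto

lemma C_k_mono: "C_k k S f \<Longrightarrow> T \<subseteq> S \<Longrightarrow> C_k k T f"
proof (induction k arbitrary: f)
  case 0
  then show ?case using continuous_on_subset by auto
next
  case (Suc k)
  then obtain f' where "\<And>x. x \<in> S \<Longrightarrow> (f has_derivative f' x) (at x)"
    "\<And>v. C_k k S (\<lambda>x. f' x v)"
    by auto
  then show ?case using Suc.IH Suc.prems(2) by (auto intro!: exI[of _ f'])
qed

lemma C_k_cong:
  assumes "C_k k S f" "open S" "\<And>x. x \<in> S \<Longrightarrow> f x = g x"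
  shows "C_k k S g"
proof (cases k)
  case 0
  then show ?thesis using assms continuous_on_eq[of S f g] by simp
next
  case (Suc n)
  then obtain f' where f': "\<And>x. x \<in> S \<Longrightarrow> (f has_derivative f' x) (at x)"
    "\<And>v. C_k n S (\<lambda>x. f' x v)"
    using assms(1) by auto
  have "(g has_derivative f' x) (at x)" if "x \<in> S" for x
    using has_derivative_transform_within_open[OF f'(1)[OF that] assms(2) that] assms(3) by auto
  then show ?thesis using f'(2) Suc by auto
qed

lemma C_k_SucD: "C_k (Suc k) S f \<Longrightarrow> C_k k S f"
proof (induction k arbitrary: f)
  case 0
  then show ?case
    using has_derivative_continuous by (fastforce intro: continuous_at_imp_continuous_on)
next
  case (Suc k)
  then obtain f' where "\<And>x. x \<in> S \<Longrightarrow> (f has_derivative f' x) (at x)"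
    "\<And>v. C_k (Suc k) S (\<lambda>x. f' x v)"
    unfolding C_k.simps(2)[of "Suc k"] by blast
  then show ?case using Suc.IH unfolding C_k.simps(2)[of k S f] by blast
qed

lemma C_k_local:
  assumes "\<And>x. x \<in> S \<Longrightarrow> \<exists>T. open T \<and> x \<in> T \<and> C_k k T f"
  shows "C_k k S f"
  using assms
proof (induction k arbitrary: f)
  case 0
  have "isCont f x" if x: "x \<in> S" for x
  proof -
    obtain T where "open T" "x \<in> T" "continuous_on T f" using 0[OF x] by auto
    then show ?thesis using continuous_on_eq_continuous_at by blast
  qed
  then show ?case by (simp add: continuous_at_imp_continuous_on)
next
  case (Suc k)
  define f' where "f' x = (SOME D. (f has_derivative D) (at x))" for x
  have f': "(f has_derivative f' x) (at x)" if "(f has_derivative D) (at x)" for x D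
    unfolding f'_def by (rule someI[of "\<lambda>D. (f has_derivative D) (at x)", OF that])
  show ?case
  proof (rule C_k_SucI)
    fix x assume "x \<in> S"
    then obtain T where T: "x \<in> T" "C_k (Suc k) T f" using Suc.prems by blast
    from T(2) obtain g where "\<And>y. y \<in> T \<Longrightarrow> (f has_derivative g y) (at y)"
      by (rule C_k_SucE) blast
    then show "(f has_derivative f' x) (at x)" using f' T(1) by blast
  next
    fix v
    show "C_k k S (\<lambda>x. f' x v)"
    proof (rule Suc.IH)
      fix x assume "x \<in> S"
      then obtain T where T: "open T" "x \<in> T" "C_k (Suc k) T f" using Suc.prems by blast
      from T(3) obtain g where g: "\<And>y. y \<in> T \<Longrightarrow> (f has_derivative g y) (at y)"
        "\<And>v. C_k k T (\<lambda>y. g y v)" by (rule C_k_SucE) blast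
      have "g y = f' y" if "y \<in> T" for y
        using has_derivative_unique[OF g(1)[OF that] f'[OF g(1)[OF that]]] .
      then have "C_k k T (\<lambda>y. f' y v)"
        using C_k_cong[OF g(2)[of v] T(1)] by simp
      then show "\<exists>T. open T \<and> x \<in> T \<and> C_k k T (\<lambda>y. f' y v)" using T by blast
    qed
  qed
qed

lemma C_k_const: "C_k k S (\<lambda>x. c)"
proof (induction k arbitrary: c)
  case (Suc k)
  show ?case by (rule C_k_SucI[where f' = "\<lambda>x v. 0"]) (simp_all add: Suc)
qed simp

lemma C_k_bounded_linear:
  assumes "bounded_linear L"
  shows "C_k k S f \<Longrightarrow> C_k k S (\<lambda>x. L (f x))"
proof (induction k arbitrary: f)
  case 0
  then show ?case using bounded_linear.continuous_on[OF assms] by simp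
next
  case (Suc k)
  from Suc.prems obtain f' where f': "\<And>x. x \<in> S \<Longrightarrow> (f has_derivative f' x) (at x)"
    "\<And>v. C_k k S (\<lambda>x. f' x v)"
    by (rule C_k_SucE) blast
  show ?case
    by (rule C_k_SucI[OF bounded_linear.has_derivative[OF assms f'(1)] Suc.IH[OF f'(2)]])
qed

lemma C_k_add: "C_k k S f \<Longrightarrow> C_k k S g \<Longrightarrow> C_k k S (\<lambda>x. f x + g x)"
proof (induction k arbitrary: f g)
  case 0
  then show ?case by (simp add: continuous_on_add)
next
  case (Suc k)
  from Suc.prems(1) obtain f' where f': "\<And>x. x \<in> S \<Longrightarrow> (f has_derivative f' x) (at x)"
    "\<And>v. C_k k S (\<lambda>x. f' x v)" by (rule C_k_SucE) blast
  from Suc.prems(2) obtain g' where g': "\<And>x. x \<in> S \<Longrightarrow> (g has_derivative g' x) (at x)"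
    "\<And>v. C_k k S (\<lambda>x. g' x v)" by (rule C_k_SucE) blast
  show ?case
    by (rule C_k_SucI[OF has_derivative_add[OF f'(1) g'(1)] Suc.IH[OF f'(2) g'(2)]])
qed

lemma C_k_bilinear:
  assumes "bounded_bilinear b"
  shows "C_k k S f \<Longrightarrow> C_k k S g \<Longrightarrow> C_k k S (\<lambda>x. b (f x) (g x))"
proof (induction k arbitrary: f g)
  case 0
  then show ?case using bounded_bilinear.continuous_on[OF assms] by simp
next
  case (Suc k)
  from Suc.prems(1) obtain f' where f': "\<And>x. x \<in> S \<Longrightarrow> (f has_derivative f' x) (at x)"
    "\<And>v. C_k k S (\<lambda>x. f' x v)" by (rule C_k_SucE) blast
  from Suc.prems(2) obtain g' where g': "\<And>x. x \<in> S \<Longrightarrow> (g has_derivative g' x) (at x)"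
    "\<And>v. C_k k S (\<lambda>x. g' x v)" by (rule C_k_SucE) blast
  show ?case
    by (rule C_k_SucI[OF bounded_bilinear.FDERIV[OF assms f'(1) g'(1)]
          C_k_add[OF Suc.IH[OF C_k_SucD[OF Suc.prems(1)] g'(2)]
            Suc.IH[OF f'(2) C_k_SucD[OF Suc.prems(2)]]]])
qed

text \<open>
  The set \<open>G\<close> stands for a family of one-variable functions that is closed under
  differentiation on \<open>T\<close>, such as the multiples of the negative powers: by the chain rule, the
  derivative of \<open>g (u x)\<close> is again a composition with a member of \<open>G\<close>, times a derivative of \<open>u\<close>.
\<close>

lemma C_k_compose_real:
  assumes G: "\<And>g. g \<in> G \<Longrightarrow> \<exists>g'\<in>G. \<forall>t\<in>T. (g has_real_derivative g' t) (at t)"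
    and u: "u ` S \<subseteq> T"
  shows "C_k k S u \<Longrightarrow> g \<in> G \<Longrightarrow> C_k k S (\<lambda>x. g (u x))"
proof (induction k arbitrary: g)
  case 0
  obtain g' where "\<And>t. t \<in> T \<Longrightarrow> (g has_real_derivative g' t) (at t)" using G[OF 0(2)] by blast
  then have "continuous_on T g"
    by (intro continuous_at_imp_continuous_on ballI DERIV_isCont)
  then show ?case using 0 u continuous_on_compose2[of T g S u] by simp
next
  case (Suc k)
  from Suc.prems(1) obtain u' where u': "\<And>x. x \<in> S \<Longrightarrow> (u has_derivative u' x) (at x)"
    "\<And>v. C_k k S (\<lambda>x. u' x v)" by (rule C_k_SucE) blast
  obtain g' where g': "g' \<in> G" "\<And>t. t \<in> T \<Longrightarrow> (g has_real_derivative g' t) (at t)"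
    using G[OF Suc.prems(2)] by blast
  show ?case
  proof (rule C_k_SucI)
    fix x assume "x \<in> S"
    then have "u x \<in> T" using u by blast
    then show "((\<lambda>x. g (u x)) has_derivative (\<lambda>v. u' x v * g' (u x))) (at x)"
      using DERIV_compose_FDERIV[OF g'(2) u'(1)[OF \<open>x \<in> S\<close>]] by blast
  next
    show "C_k k S (\<lambda>x. u' x v * g' (u x))" for v
      by (rule C_k_bilinear[OF bounded_bilinear_mult u'(2) Suc.IH[OF C_k_SucD[OF Suc.prems(1)] g'(1)]])
  qed
qed

lemma C_k_inverse:
  fixes u :: "'a::real_normed_vector \<Rightarrow> real"
  assumes "C_k k S u" "\<And>x. x \<in> S \<Longrightarrow> u x \<noteq> 0"
  shows "C_k k S (\<lambda>x. inverse (u x))"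
proof -
  define q where "q = (\<lambda>(c, n) t. c * inverse t ^ n :: real)"
  have der: "(q (c, n) has_real_derivative q (- c * real n, Suc n) t) (at t)" if "t \<noteq> 0" for c n t
  proof -
    have "((\<lambda>t. c * inverse t ^ n) has_real_derivative
        c * (real n * (inverse t ^ (n - 1) * - (inverse t * inverse t)))) (at t)"
      using that by (auto intro!: derivative_eq_intros simp: power2_eq_square)
    moreover have "c * (real n * (inverse t ^ (n - 1) * - (inverse t * inverse t))) =
        (- c * real n) * inverse t ^ Suc n"
      by (cases n) (simp_all add: ac_simps)
    ultimately show ?thesis by (simp only: q_def prod.case)
  qed
  have "\<exists>g'\<in>range q. \<forall>t\<in>-{0}. (g has_real_derivative g' t) (at t)" if g: "g \<in> range q" for g
  proof -
    obtain c n where "g = q (c, n)" using g by (metis imageE surj_pair)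
    then show ?thesis using der by (intro bexI[of _ "q (- c * real n, Suc n)"]) auto
  qed
  moreover have "u ` S \<subseteq> -{0}" using assms(2) by auto
  ultimately have "C_k k S (\<lambda>x. q (1, 1) (u x))"
    using C_k_compose_real[of "range q" "-{0}" u S k "q (1, 1)"] assms(1) by blast
  then show ?thesis by (simp add: q_def)
qed

text \<open>
  For \<open>P = 1\<close> this is the classical flat function \<open>exp (- 1 / t)\<close>, extended by \<open>0\<close>.  The polynomial factor makes
  the family closed under differentiation.
\<close>

definition flat_fun :: "real poly \<Rightarrow> real \<Rightarrow> real" where
  "flat_fun P t = (if t > 0 then poly P (inverse t) * exp (- inverse t) else 0)"

lemma poly_times_exp_minus_tendsto_0:
  "((\<lambda>s::real. poly P s * exp (- s)) \<longlongrightarrow> 0) at_top"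
proof (induction P)
  case (pCons a P)
  have "((\<lambda>s::real. s * poly P s * exp (- s)) \<longlongrightarrow> 0) at_top"
  proof -
    have *: "((\<lambda>s::real. coeff P i * (s ^ Suc i / exp s)) \<longlongrightarrow> coeff P i * 0) at_top" for i
      by (intro tendsto_mult_left tendsto_power_div_exp_0)
    have "((\<lambda>s::real. \<Sum>i\<le>degree P. coeff P i * (s ^ Suc i / exp s)) \<longlongrightarrow> (\<Sum>i\<le>degree P. 0)) at_top"
      using * by (intro tendsto_sum) simp
    moreover have "(\<Sum>i\<le>degree P. coeff P i * (s ^ Suc i / exp s)) = s * poly P s * exp (- s)" for s
      by (simp add: poly_altdef exp_minus sum_distrib_left sum_distrib_right field_simps)
    ultimately show ?thesis by simp
  qed
  moreover have "((\<lambda>s::real. a * (s ^ 0 / exp s)) \<longlongrightarrow> a * 0) at_top"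
    by (intro tendsto_mult_left tendsto_power_div_exp_0)
  ultimately have "((\<lambda>s::real. a * (s ^ 0 / exp s) + s * poly P s * exp (- s)) \<longlongrightarrow> 0 + 0) at_top"
    by (intro tendsto_add) auto
  then show ?case by (simp add: exp_minus field_simps)
qed simp

lemma flat_fun_has_derivative:
  "(flat_fun P has_real_derivative flat_fun ([:0, 0, 1:] * (P - pderiv P)) t) (at t)"
proof (cases "t = 0")
  case False
  have der: "((\<lambda>t. poly P (inverse t) * exp (- inverse t)) has_real_derivative
      poly ([:0, 0, 1:] * (P - pderiv P)) (inverse t) * exp (- inverse t)) (at t)" if "t > 0"
    using that by (auto intro!: derivative_eq_intros poly_DERIV[THEN DERIV_chain2]
        simp: algebra_simps power2_eq_square)
  show ?thesis
  proof (cases "t > 0")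
    case True
    then show ?thesis
      using has_field_derivative_transform_within_open[OF der[OF True], of "{0<..}"]
      by (auto simp: flat_fun_def)
  next
    case neg: False
    have "((\<lambda>t. 0) has_real_derivative 0) (at t)" by simp
    then show ?thesis
      using has_field_derivative_transform_within_open[of "\<lambda>t. 0" 0 t "{..<0}" "flat_fun P"] neg False
      by (auto simp: flat_fun_def)
  qed
next
  case True
  have "((\<lambda>h. flat_fun P h / h) \<longlongrightarrow> 0) (at_right 0)"
  proof -
    \<comment> \<open>The difference quotient at \<open>0\<close> is again of this form, with the polynomial multiplied by \<open>1 / h\<close>.\<close>
    have "((\<lambda>h::real. poly ([:0, 1:] * P) (inverse h) * exp (- inverse h)) \<longlongrightarrow> 0) (at_right 0)"
      using filterlim_compose[OF poly_times_exp_minus_tendsto_0 filterlim_inverse_at_top_right] .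
    then show ?thesis
      by (rule Lim_transform_eventually)
        (auto simp: eventually_at_filter flat_fun_def field_simps)
  qed
  moreover have "((\<lambda>h. flat_fun P h / h) \<longlongrightarrow> 0) (at_left 0)"
    by (rule Lim_transform_eventually[OF tendsto_const])
      (auto simp: eventually_at_filter flat_fun_def)
  ultimately have "((\<lambda>h. flat_fun P h / h) \<longlongrightarrow> 0) (at 0)"
    by (simp add: filterlim_split_at)
  then show ?thesis using True by (simp add: has_field_derivative_iff flat_fun_def)
qed

lemma C_k_flat_fun: "C_k k S u \<Longrightarrow> C_k k S (\<lambda>x. flat_fun P (u x))"
  using C_k_compose_real[of "range flat_fun" UNIV u S k "flat_fun P"] flat_fun_has_derivative by blast

section \<open>Smooth functions on a manifold\<close>

lemma smooth_fun_onI: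
  assumes "\<And>U \<phi> k. (U, \<phi>) \<in> A \<Longrightarrow> C_k k (\<phi> ` (U \<inter> W)) (\<lambda>x. f (inv_into U \<phi> x))"
  shows "smooth_fun_on A W f"
  using assms by (auto simp: smooth_fun_on_def smooth_on_def o_def)

lemma smooth_fun_onD:
  assumes "smooth_fun_on A W f" "(U, \<phi>) \<in> A"
  shows "C_k k (\<phi> ` (U \<inter> W)) (\<lambda>x. f (inv_into U \<phi> x))"
  using assms by (auto simp: smooth_fun_on_def smooth_on_def o_def)

lemma smooth_fun_on_mono: "smooth_fun_on A W f \<Longrightarrow> W' \<subseteq> W \<Longrightarrow> smooth_fun_on A W' f"
  by (rule smooth_fun_onI) (erule (1) C_k_mono[OF smooth_fun_onD], blast)

lemma smooth_fun_on_const: "smooth_fun_on A W (\<lambda>q. c)"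
  by (rule smooth_fun_onI) (rule C_k_const)

lemma smooth_fun_on_add:
  "smooth_fun_on A W f \<Longrightarrow> smooth_fun_on A W g \<Longrightarrow> smooth_fun_on A W (\<lambda>q. f q + g q)"
  by (rule smooth_fun_onI) (rule C_k_add; erule (1) smooth_fun_onD)

lemma smooth_fun_on_bounded_linear:
  "bounded_linear L \<Longrightarrow> smooth_fun_on A W f \<Longrightarrow> smooth_fun_on A W (\<lambda>q. L (f q))"
  by (rule smooth_fun_onI) (erule C_k_bounded_linear, erule (1) smooth_fun_onD)

lemma smooth_fun_on_bilinear:
  "bounded_bilinear b \<Longrightarrow> smooth_fun_on A W f \<Longrightarrow> smooth_fun_on A W g \<Longrightarrow>
    smooth_fun_on A W (\<lambda>q. b (f q) (g q))"
  by (rule smooth_fun_onI) (rule C_k_bilinear[of b], assumption; erule (1) smooth_fun_onD)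

lemmas smooth_fun_on_mult = smooth_fun_on_bilinear[OF bounded_bilinear_mult]
lemmas smooth_fun_on_scaleR = smooth_fun_on_bilinear[OF bounded_bilinear_scaleR]
lemmas smooth_fun_on_inner = smooth_fun_on_bilinear[OF bounded_bilinear_inner]

lemma smooth_fun_on_minus: "smooth_fun_on A W f \<Longrightarrow> smooth_fun_on A W (\<lambda>q. - f q)"
  by (rule smooth_fun_on_bounded_linear[OF bounded_linear_minus[OF bounded_linear_ident]])

lemma smooth_fun_on_diff:
  "smooth_fun_on A W f \<Longrightarrow> smooth_fun_on A W g \<Longrightarrow> smooth_fun_on A W (\<lambda>q. f q - g q)"
  using smooth_fun_on_add[of A W f "\<lambda>q. - g q"] smooth_fun_on_minus[of A W g] by simp

lemma smooth_fun_on_inverse: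
  fixes f :: "'m \<Rightarrow> real"
  assumes "smooth_fun_on A W f" "\<And>q. q \<in> W \<Longrightarrow> f q \<noteq> 0"
    and inj: "\<And>U \<phi>. (U, \<phi>) \<in> A \<Longrightarrow> inj_on \<phi> U"
  shows "smooth_fun_on A W (\<lambda>q. inverse (f q))"
proof (rule smooth_fun_onI, rule C_k_inverse)
  fix U \<phi> k assume U: "(U, \<phi>) \<in> A"
  show "C_k k (\<phi> ` (U \<inter> W)) (\<lambda>x. f (inv_into U \<phi> x))" using smooth_fun_onD[OF assms(1) U] .
  fix x assume "x \<in> \<phi> ` (U \<inter> W)"
  then obtain q where "x = \<phi> q" "q \<in> U" "q \<in> W" by blast
  then show "f (inv_into U \<phi> x) \<noteq> 0"
    using assms(2) inv_into_f_f[OF inj[OF U] \<open>q \<in> U\<close>] by simp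
qed

context
  fixes A :: "('m::{t2_space,second_countable_topology}, 'c::real_inner) chart set"
  assumes M: "smooth_manifold A"
begin

lemma chart_properties:
  assumes "(U, \<phi>) \<in> A"
  shows "open U" "open (\<phi> ` U)" "homeomorphism U (\<phi> ` U) \<phi> (inv_into U \<phi>)" "inj_on \<phi> U"
    "q \<in> U \<Longrightarrow> inv_into U \<phi> (\<phi> q) = q"
proof -
  show "open U" "open (\<phi> ` U)" "homeomorphism U (\<phi> ` U) \<phi> (inv_into U \<phi>)"
    using M assms unfolding smooth_manifold_def by blast+
  then have inv: "inv_into U \<phi> (\<phi> q) = q" if "q \<in> U" for q
    using that homeomorphism_apply1 by blast
  then show "q \<in> U \<Longrightarrow> inv_into U \<phi> (\<phi> q) = q" .
  show "inj_on \<phi> U" by (rule inj_on_inverseI[where g = "inv_into U \<phi>"]) (rule inv)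
qed

lemma chart_image_open:
  assumes U: "(U, \<phi>) \<in> A" and W: "open W"
  shows "open (\<phi> ` (U \<inter> W))"
proof -
  have "\<phi> ` (U \<inter> W) = \<phi> ` U \<inter> inv_into U \<phi> -` W"
    using chart_properties(5)[OF U] by auto
  moreover have "open (\<phi> ` U \<inter> inv_into U \<phi> -` W)"
    using continuous_open_preimage[OF homeomorphism_cont2[OF chart_properties(3)[OF U]]
        chart_properties(2)[OF U] W] .
  ultimately show ?thesis by simp
qed

lemma smooth_fun_on_cong:
  assumes f: "smooth_fun_on A W f" and W: "open W" and eq: "\<And>q. q \<in> W \<Longrightarrow> f q = g q"
  shows "smooth_fun_on A W g"
proof (rule smooth_fun_onI)
  fix U \<phi> k assume U: "(U, \<phi>) \<in> A"
  show "C_k k (\<phi> ` (U \<inter> W)) (\<lambda>x. g (inv_into U \<phi> x))"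
  proof (rule C_k_cong[OF smooth_fun_onD[OF f U] chart_image_open[OF U W]])
    fix x assume "x \<in> \<phi> ` (U \<inter> W)"
    then obtain q where q: "x = \<phi> q" "q \<in> U" "q \<in> W" by blast
    then show "f (inv_into U \<phi> x) = g (inv_into U \<phi> x)"
      using eq chart_properties(5)[OF U q(2)] by simp
  qed
qed

lemma smooth_fun_on_local:
  assumes "\<And>q. q \<in> W \<Longrightarrow> \<exists>W'. open W' \<and> q \<in> W' \<and> smooth_fun_on A W' f"
  shows "smooth_fun_on A W f"
proof (rule smooth_fun_onI, rule C_k_local)
  fix U \<phi> k x assume U: "(U, \<phi>) \<in> A" and "x \<in> \<phi> ` (U \<inter> W)"
  then obtain q where q: "x = \<phi> q" "q \<in> U" "q \<in> W" by blast
  obtain W' where W': "open W'" "q \<in> W'" "smooth_fun_on A W' f" using assms[OF q(3)] by blast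
  show "\<exists>T. open T \<and> x \<in> T \<and> C_k k T (\<lambda>x. f (inv_into U \<phi> x))"
    using chart_image_open[OF U W'(1)] smooth_fun_onD[OF W'(3) U] q W'(2) by blast
qed

lemma smooth_fun_on_chart: "(U, \<phi>) \<in> A \<Longrightarrow> smooth_fun_on A U \<phi>"
  using M unfolding smooth_manifold_def smooth_fun_on_def by blast

lemma smooth_fun_on_continuous:
  assumes f: "smooth_fun_on A W f" and W: "open W"
  shows "continuous_on W f"
proof (rule continuous_at_imp_continuous_on, rule ballI)
  fix p assume p: "p \<in> W"
  obtain U \<phi> where U: "(U, \<phi>) \<in> A" "p \<in> U" using M unfolding smooth_manifold_def by blast
  have "continuous_on (\<phi> ` (U \<inter> W)) (\<lambda>x. f (inv_into U \<phi> x))"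
    using smooth_fun_onD[OF f U(1), of 0] by simp
  moreover have "continuous_on (U \<inter> W) \<phi>"
    using homeomorphism_cont1[OF chart_properties(3)[OF U(1)]] continuous_on_subset by blast
  ultimately have "continuous_on (U \<inter> W) (\<lambda>q. f (inv_into U \<phi> (\<phi> q)))"
    by (rule continuous_on_compose2) simp
  then have "continuous_on (U \<inter> W) f"
    using chart_properties(5)[OF U(1)] continuous_on_cong[of "U \<inter> W" "U \<inter> W" "\<lambda>q. f (inv_into U \<phi> (\<phi> q))" f]
    by simp
  then show "isCont f p"
    using U(2) p W chart_properties(1)[OF U(1)] continuous_on_eq_continuous_at[of "U \<inter> W" f]
    by blast
qed

lemma smooth_fun_on_flat_fun:
  "smooth_fun_on A W f \<Longrightarrow> smooth_fun_on A W (\<lambda>q. flat_fun P (f q))"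
  by (rule smooth_fun_onI) (rule C_k_flat_fun, erule (1) smooth_fun_onD)

text \<open>
  In a chart around \<open>p\<close> the bump is the flat function of \<open>r\<^sup>2 - |x - x\<^sub>0|\<^sup>2\<close>.  It serves to
  cut off local frames, and a frame multiplied by a function that is nonzero at \<open>p\<close> is still a frame near \<open>p\<close>.
\<close>

lemma smooth_bump:
  assumes p: "p \<in> W" and W: "open W"
  obtains \<beta> :: "'m \<Rightarrow> real" and C where "\<beta> \<in> smooth_functions A" "\<beta> p \<noteq> 0" "closed C" "C \<subseteq> W"
    "\<forall>q. q \<notin> C \<longrightarrow> \<beta> q = 0"
proof -
  obtain U \<phi> where U: "(U, \<phi>) \<in> A" "p \<in> U" using M unfolding smooth_manifold_def by blast
  note chart = chart_properties[OF U(1)]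
  have "\<phi> p \<in> \<phi> ` (U \<inter> W)" using U(2) p by blast
  then obtain r where r: "r > 0" "cball (\<phi> p) r \<subseteq> \<phi> ` (U \<inter> W)"
    using chart_image_open[OF U(1) W] open_contains_cball by blast
  define C where "C = inv_into U \<phi> ` cball (\<phi> p) r"
  define u where "u q = r\<^sup>2 - (\<phi> q - \<phi> p) \<bullet> (\<phi> q - \<phi> p)" for q
  define \<beta> where "\<beta> q = (if q \<in> U then flat_fun 1 (u q) else 0)" for q
  have ball: "cball (\<phi> p) r \<subseteq> \<phi> ` U" using r(2) by blast
  have "fin_dim TYPE('c)" using M by (simp add: smooth_manifold_def)
  then have "compact C"
    unfolding C_def using compact_cball_fin_dim homeomorphism_cont2[OF chart(3)] ball
    by (blast intro: compact_continuous_image continuous_on_subset)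
  \<comment> \<open>Here the manifold has to be Hausdorff.\<close>
  then have clC: "closed C" by (rule compact_imp_closed)
  have CW: "C \<subseteq> U \<inter> W"
  proof
    fix q assume "q \<in> C"
    then obtain x where x: "x \<in> cball (\<phi> p) r" "q = inv_into U \<phi> x" unfolding C_def by blast
    then obtain q' where "q' \<in> U \<inter> W" "x = \<phi> q'" using r(2) by blast
    then show "q \<in> U \<inter> W" using x(2) chart(5) by simp
  qed
  have outside: "\<beta> q = 0" if "q \<notin> C" for q
  proof (cases "q \<in> U")
    case True
    have "\<phi> q \<notin> cball (\<phi> p) r"
    proof
      assume "\<phi> q \<in> cball (\<phi> p) r"
      then have "inv_into U \<phi> (\<phi> q) \<in> C" unfolding C_def by blast
      then show False using chart(5)[OF True] that by simp
    qed
    then have "r < norm (\<phi> q - \<phi> p)" by (simp add: dist_norm norm_minus_commute)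
    then have "r\<^sup>2 < (norm (\<phi> q - \<phi> p))\<^sup>2" using r(1) by (intro power_strict_mono) simp_all
    then have "u q < 0" by (simp add: u_def power2_norm_eq_inner)
    then show ?thesis by (simp add: \<beta>_def flat_fun_def)
  qed (simp add: \<beta>_def)
  have "smooth_fun_on A U u"
    unfolding u_def
    by (rule smooth_fun_on_diff[OF smooth_fun_on_const smooth_fun_on_inner])
      (rule smooth_fun_on_diff[OF smooth_fun_on_chart[OF U(1)] smooth_fun_on_const])+
  then have inU: "smooth_fun_on A U \<beta>"
    by (rule smooth_fun_on_cong[OF smooth_fun_on_flat_fun[of _ _ 1] chart(1)]) (simp add: \<beta>_def)
  have "smooth_fun_on A (- C) \<beta>"
    by (rule smooth_fun_on_cong[OF smooth_fun_on_const[of A "- C" 0] open_Compl[OF clC]])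
      (use outside in simp)
  then have "\<exists>W'. open W' \<and> q \<in> W' \<and> smooth_fun_on A W' \<beta>" for q
    using inU CW chart(1) open_Compl[OF clC] by (cases "q \<in> U") blast+
  then have "smooth_fun_on A UNIV \<beta>" by (rule smooth_fun_on_local)
  moreover have "\<beta> p \<noteq> 0" using U(2) r(1) by (simp add: \<beta>_def u_def flat_fun_def)
  ultimately show thesis
    using that[of \<beta> C] clC CW outside unfolding smooth_functions_def by blast
qed

definition smooth_near :: "'m \<Rightarrow> ('m \<Rightarrow> 'b::real_normed_vector) \<Rightarrow> bool" where
  "smooth_near p f \<longleftrightarrow> (\<exists>W. open W \<and> p \<in> W \<and> smooth_fun_on A W f)"

lemma smooth_near_if_smooth: "f \<in> smooth_functions A \<Longrightarrow> smooth_near p f"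
  unfolding smooth_near_def smooth_functions_def by blast

lemma smooth_near_const: "smooth_near p (\<lambda>q. c)"
  unfolding smooth_near_def using smooth_fun_on_const by blast

lemma smooth_near_binary:
  assumes op: "\<And>W. smooth_fun_on A W f \<Longrightarrow> smooth_fun_on A W g \<Longrightarrow> smooth_fun_on A W h"
    and f: "smooth_near p f" and g: "smooth_near p g"
  shows "smooth_near p h"
proof -
  obtain W1 W2 where "open W1" "p \<in> W1" "smooth_fun_on A W1 f"
    "open W2" "p \<in> W2" "smooth_fun_on A W2 g"
    using f g unfolding smooth_near_def by blast
  then have "open (W1 \<inter> W2)" "p \<in> W1 \<inter> W2" "smooth_fun_on A (W1 \<inter> W2) h"
    using op[of "W1 \<inter> W2"] smooth_fun_on_mono[of A W1 f "W1 \<inter> W2"]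
      smooth_fun_on_mono[of A W2 g "W1 \<inter> W2"] by auto
  then show ?thesis unfolding smooth_near_def by blast
qed

lemma smooth_near_add: "smooth_near p f \<Longrightarrow> smooth_near p g \<Longrightarrow> smooth_near p (\<lambda>q. f q + g q)"
  by (rule smooth_near_binary[OF smooth_fun_on_add])

lemma smooth_near_diff: "smooth_near p f \<Longrightarrow> smooth_near p g \<Longrightarrow> smooth_near p (\<lambda>q. f q - g q)"
  by (rule smooth_near_binary[OF smooth_fun_on_diff])

lemma smooth_near_scaleR:
  "smooth_near p f \<Longrightarrow> smooth_near p g \<Longrightarrow> smooth_near p (\<lambda>q. f q *\<^sub>R g q)"
  by (rule smooth_near_binary[OF smooth_fun_on_scaleR])

lemma smooth_near_mult:
  fixes f g :: "'m \<Rightarrow> real"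
  shows "smooth_near p f \<Longrightarrow> smooth_near p g \<Longrightarrow> smooth_near p (\<lambda>q. f q * g q)"
  using smooth_near_scaleR[of p f g] by simp

lemma smooth_near_sum:
  assumes "\<And>i. i \<in> I \<Longrightarrow> smooth_near p (f i)"
  shows "smooth_near p (\<lambda>q. \<Sum>i\<in>I. f i q)"
  using assms
proof (induction I rule: infinite_finite_induct)
  case (insert i I)
  have "smooth_near p (\<lambda>q. f i q + (\<Sum>i\<in>I. f i q))"
    by (rule smooth_near_add[OF insert.prems[OF insertI1] insert.IH[OF insert.prems[OF insertI2]]])
  then show ?case using insert.hyps by simp
qed (simp_all add: smooth_near_const)

lemma smooth_near_cong:
  assumes "smooth_near p f" "open W" "p \<in> W" "\<And>q. q \<in> W \<Longrightarrow> f q = g q"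
  shows "smooth_near p g"
proof -
  obtain W' where W': "open W'" "p \<in> W'" "smooth_fun_on A W' f"
    using assms(1) unfolding smooth_near_def by blast
  have "smooth_fun_on A (W' \<inter> W) g"
    by (rule smooth_fun_on_cong[OF smooth_fun_on_mono[OF W'(3) Int_lower1] open_Int[OF W'(1) assms(2)]])
      (use assms(4) in blast)
  then show ?thesis unfolding smooth_near_def using W' assms(2,3) by blast
qed

lemma smooth_near_nonzero:
  fixes f :: "'m \<Rightarrow> real"
  assumes "smooth_near p f" "f p \<noteq> 0"
  obtains W where "open W" "p \<in> W" "smooth_fun_on A W f" "\<forall>q\<in>W. f q \<noteq> 0"
proof -
  obtain W where W: "open W" "p \<in> W" "smooth_fun_on A W f"
    using assms(1) unfolding smooth_near_def by blast
  have "open (W \<inter> f -` (- {0}))"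
    using continuous_open_preimage[OF smooth_fun_on_continuous[OF W(3,1)] W(1)] by blast
  then show thesis
    using that[of "W \<inter> f -` (- {0})"] W assms(2) smooth_fun_on_mono[OF W(3)] by auto
qed

lemma smooth_near_inverse:
  fixes f :: "'m \<Rightarrow> real"
  assumes "smooth_near p f" "f p \<noteq> 0"
  shows "smooth_near p (\<lambda>q. inverse (f q))"
proof -
  obtain W where W: "open W" "p \<in> W" "smooth_fun_on A W f" "\<forall>q\<in>W. f q \<noteq> 0"
    by (rule smooth_near_nonzero[OF assms])
  have "smooth_fun_on A W (\<lambda>q. inverse (f q))"
    using smooth_fun_on_inverse[OF W(3)] W(4) chart_properties(4) by blast
  then show ?thesis unfolding smooth_near_def using W by blast
qed

text \<open>
  Smoothness of the solution of a linear system with smooth coefficients, by Gaussian elimination on germs: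
  injectivity at \<open>p\<close> provides a pivot that does not vanish near \<open>p\<close>, and the eliminated system is again
  injective at \<open>p\<close>.  The system may be overdetermined, so that the induction on the unknowns can keep all
  equations, the one of the pivot becoming trivial.
\<close>

lemma smooth_near_linear_system:
  fixes g :: "'i \<Rightarrow> 'j \<Rightarrow> 'm \<Rightarrow> real" and c :: "'j \<Rightarrow> 'm \<Rightarrow> real"
  assumes "finite J"
    and "\<And>i j. i \<in> I \<Longrightarrow> j \<in> J \<Longrightarrow> smooth_near p (g i j)"
    and "\<And>i. i \<in> I \<Longrightarrow> smooth_near p (\<lambda>q. \<Sum>j\<in>J. g i j q * c j q)"
    and "\<And>v. (\<And>i. i \<in> I \<Longrightarrow> (\<Sum>j\<in>J. g i j p * v j) = 0) \<Longrightarrow> (\<And>j. j \<in> J \<Longrightarrow> v j = 0)"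
  shows "\<forall>j\<in>J. smooth_near p (c j)"
  using assms
proof (induction J arbitrary: g rule: finite_induct)
  case (insert k J)
  have "\<exists>i\<in>I. g i k p \<noteq> 0"
  proof (rule ccontr)
    assume "\<not> (\<exists>i\<in>I. g i k p \<noteq> 0)"
    then have "(\<Sum>j\<in>insert k J. g i j p * (if j = k then 1 else 0)) = 0" if "i \<in> I" for i
      using that by (intro sum.neutral) simp
    then show False using insert.prems(3)[of "\<lambda>j. if j = k then 1 else 0" k] by simp
  qed
  then obtain l where l: "l \<in> I" "g l k p \<noteq> 0" by blast
  have glk: "smooth_near p (g l k)" using insert.prems(1) l(1) by blast
  define a where "a i q = g i k q * inverse (g l k q)" for i q
  define g' where "g' i j q = g i j q - a i q * g l j q" for i j q
  have a: "smooth_near p (a i)" if "i \<in> I" for i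
    unfolding a_def
    by (rule smooth_near_mult[OF insert.prems(1)[OF that insertI1] smooth_near_inverse[OF glk l(2)]])
  obtain W where W: "open W" "p \<in> W" "\<forall>q\<in>W. g l k q \<noteq> 0"
    by (rule smooth_near_nonzero[OF glk l(2)])
  have split: "(\<Sum>j\<in>J. g' i j q * w j) =
      (\<Sum>j\<in>insert k J. g i j q * w j) - a i q * (\<Sum>j\<in>insert k J. g l j q * w j)"
    if "g l k q \<noteq> 0" for i q and w :: "'j \<Rightarrow> real"
  proof -
    have "(\<Sum>j\<in>J. g' i j q * w j) = (\<Sum>j\<in>J. g i j q * w j) - a i q * (\<Sum>j\<in>J. g l j q * w j)"
      by (simp add: g'_def left_diff_distrib sum_subtractf sum_distrib_left mult.assoc)
    moreover have "a i q * g l k q = g i k q" using that by (simp add: a_def)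
    ultimately show ?thesis using insert.hyps
      by (simp add: distrib_left mult.assoc[symmetric])
  qed
  have "\<forall>j\<in>J. smooth_near p (c j)"
  proof (rule insert.IH[of g'])
    fix i assume i: "i \<in> I"
    show "smooth_near p (g' i j)" if "j \<in> J" for j
      unfolding g'_def
      by (rule smooth_near_diff[OF insert.prems(1)[OF i insertI2[OF that]]
            smooth_near_mult[OF a[OF i] insert.prems(1)[OF l(1) insertI2[OF that]]]])
    have "smooth_near p (\<lambda>q. (\<Sum>j\<in>insert k J. g i j q * c j q) - a i q * (\<Sum>j\<in>insert k J. g l j q * c j q))"
      by (rule smooth_near_diff[OF insert.prems(2)[OF i] smooth_near_mult[OF a[OF i] insert.prems(2)[OF l(1)]]])
    then show "smooth_near p (\<lambda>q. \<Sum>j\<in>J. g' i j q * c j q)"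
      by (rule smooth_near_cong[OF _ W(1,2)]) (simp only: split[OF W(3)[rule_format]])
  next
    fix v j assume v: "\<And>i. i \<in> I \<Longrightarrow> (\<Sum>j\<in>J. g' i j p * v j) = 0" and j: "j \<in> J"
    define w where "w = v(k := - (\<Sum>j\<in>J. g l j p * v j) / g l k p)"
    have wJ: "w j = v j" if "j \<in> J" for j using that insert.hyps by (auto simp: w_def)
    have "(\<Sum>j\<in>insert k J. g l j p * w j) = g l k p * w k + (\<Sum>j\<in>J. g l j p * v j)"
      using insert.hyps wJ by simp
    then have zl: "(\<Sum>j\<in>insert k J. g l j p * w j) = 0" using l(2) by (simp add: w_def)
    have "(\<Sum>j\<in>insert k J. g i j p * w j) = 0" if "i \<in> I" for i
      using split[OF l(2), of i w] v[OF that] zl wJ by simp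
    then have "w j = 0" using insert.prems(3)[of w j] j by blast
    then show "v j = 0" using wJ[OF j] by simp
  qed
  moreover have "smooth_near p (c k)"
  proof -
    have "smooth_near p (\<lambda>q. inverse (g l k q) *
        ((\<Sum>j\<in>insert k J. g l j q * c j q) - (\<Sum>j\<in>J. g l j q * c j q)))"
      by (rule smooth_near_mult[OF smooth_near_inverse[OF glk l(2)]
            smooth_near_diff[OF insert.prems(2)[OF l(1)] smooth_near_sum]], rule smooth_near_mult)
        (use insert.prems(1) l(1) calculation in blast)+
    then show ?thesis
      by (rule smooth_near_cong[OF _ W(1,2)]) (use insert.hyps W(3) in simp)
  qed
  ultimately show ?case by blast
qed simp

end

section \<open>Vector bundles and their sections\<close>

lemma linear_on_zero: "linear_on S f \<Longrightarrow> u \<in> S \<Longrightarrow> f 0 = 0"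
  unfolding linear_on_def by (metis scaleR_zero_left)

context
  fixes E :: "('m::{t2_space,second_countable_topology}, 'c::real_inner, 'v::real_vector,
                'f::real_inner, 'z) vbundle_scheme"
  assumes VB: "vector_bundle E"
begin

lemma bundle_manifold: "smooth_manifold (atlas E)"
  and fibre_subspace: "subspace (fibre E p)"
  and typical_fibre_fin_dim: "fin_dim TYPE('f)"
  using VB unfolding vector_bundle_def by blast+

lemma trivialisation:
  assumes "(U, \<tau>) \<in> trivs E"
  shows "open U" "p \<in> U \<Longrightarrow> linear_on (fibre E p) (\<tau> p)" "p \<in> U \<Longrightarrow> bij_betw (\<tau> p) (fibre E p) UNIV"
  using VB assms unfolding vector_bundle_def by blast+

lemma trivialisation_inverse:
  assumes "(U, \<tau>) \<in> trivs E" "p \<in> U"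
  shows "inv_into (fibre E p) (\<tau> p) w \<in> fibre E p"
    "\<tau> p (inv_into (fibre E p) (\<tau> p) w) = w"
    "v \<in> fibre E p \<Longrightarrow> inv_into (fibre E p) (\<tau> p) (\<tau> p v) = v"
proof -
  note bij = trivialisation(3)[OF assms]
  have "w \<in> \<tau> p ` fibre E p" using bij by (simp add: bij_betw_def)
  then show "inv_into (fibre E p) (\<tau> p) w \<in> fibre E p" "\<tau> p (inv_into (fibre E p) (\<tau> p) w) = w"
    by (rule inv_into_into, rule f_inv_into_f)
  show "v \<in> fibre E p \<Longrightarrow> inv_into (fibre E p) (\<tau> p) (\<tau> p v) = v"
    using bij by (simp add: bij_betw_def)
qed

lemma trivialisation_inverse_linear:
  assumes "(U, \<tau>) \<in> trivs E" "p \<in> U"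
  shows "linear (inv_into (fibre E p) (\<tau> p))" (is "linear ?g")
proof (rule linearI)
  note lin = trivialisation(2)[OF assms, unfolded linear_on_def]
  note inv = trivialisation_inverse[OF assms]
  fix w w' :: 'f and r :: real
  have "\<tau> p (?g w + ?g w') = w + w'" "\<tau> p (r *\<^sub>R ?g w) = r *\<^sub>R w"
    using lin inv by simp_all
  moreover have "?g w + ?g w' \<in> fibre E p" "r *\<^sub>R ?g w \<in> fibre E p"
    using fibre_subspace inv(1) by (simp_all add: subspace_add subspace_scale)
  ultimately show "?g (w + w') = ?g w + ?g w'" "?g (r *\<^sub>R w) = r *\<^sub>R ?g w"
    using inv(3)[of "?g w + ?g w'"] inv(3)[of "r *\<^sub>R ?g w"] by auto
qed

lemma fibre_fin_dim: "\<exists>B. finite B \<and> fibre E p \<subseteq> span B"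
proof -
  obtain U \<tau> where U: "(U, \<tau>) \<in> trivs E" "p \<in> U" using VB unfolding vector_bundle_def by blast
  obtain B0 :: "'f set" where B0: "finite B0" "span B0 = UNIV"
    using typical_fibre_fin_dim unfolding fin_dim_def by blast
  let ?g = "inv_into (fibre E p) (\<tau> p)"
  have "fibre E p \<subseteq> ?g ` UNIV"
  proof
    fix v assume "v \<in> fibre E p"
    from trivialisation_inverse(3)[OF U this] show "v \<in> ?g ` UNIV" by (rule image_eqI[OF sym]) simp
  qed
  then have "fibre E p \<subseteq> span (?g ` B0)"
    using linear_span_image[OF trivialisation_inverse_linear[OF U], of B0] B0(2) by simp
  then show ?thesis using B0(1) by blast
qed

lemma sections_fibre: "x \<in> sections E \<Longrightarrow> x p \<in> fibre E p"
  unfolding sections_def by blast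

lemma sections_smooth:
  "x \<in> sections E \<Longrightarrow> (U, \<tau>) \<in> trivs E \<Longrightarrow> smooth_fun_on (atlas E) U (\<lambda>p. \<tau> p (x p))"
  unfolding sections_def by blast

lemma sectionsI:
  assumes "\<And>p. x p \<in> fibre E p"
    "\<And>U \<tau>. (U, \<tau>) \<in> trivs E \<Longrightarrow> smooth_fun_on (atlas E) U (\<lambda>p. \<tau> p (x p))"
  shows "x \<in> sections E"
  using assms unfolding sections_def by blast

lemma sections_add:
  assumes x: "x \<in> sections E" and y: "y \<in> sections E"
  shows "(\<lambda>p. x p + y p) \<in> sections E"
proof (rule sectionsI)
  show "x p + y p \<in> fibre E p" for p
    by (rule subspace_add[OF fibre_subspace sections_fibre[OF x] sections_fibre[OF y]])
  fix U \<tau> assume U: "(U, \<tau>) \<in> trivs E"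
  show "smooth_fun_on (atlas E) U (\<lambda>p. \<tau> p (x p + y p))"
  proof (rule smooth_fun_on_cong[OF bundle_manifold
        smooth_fun_on_add[OF sections_smooth[OF x U] sections_smooth[OF y U]] trivialisation(1)[OF U]])
    fix p assume "p \<in> U"
    from trivialisation(2)[OF U this] show "\<tau> p (x p) + \<tau> p (y p) = \<tau> p (x p + y p)"
      using sections_fibre[OF x] sections_fibre[OF y] by (simp add: linear_on_def)
  qed
qed

lemma sections_mult:
  assumes x: "x \<in> sections E" and f: "f \<in> smooth_functions (atlas E)"
  shows "(\<lambda>p. f p *\<^sub>R x p) \<in> sections E"
proof (rule sectionsI)
  show "f p *\<^sub>R x p \<in> fibre E p" for p
    by (rule subspace_scale[OF fibre_subspace sections_fibre[OF x]])
  fix U \<tau> assume U: "(U, \<tau>) \<in> trivs E"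
  have "smooth_fun_on (atlas E) U f"
    using f smooth_fun_on_mono[of "atlas E" UNIV f U] by (simp add: smooth_functions_def)
  then show "smooth_fun_on (atlas E) U (\<lambda>p. \<tau> p (f p *\<^sub>R x p))"
  proof (rule smooth_fun_on_cong[OF bundle_manifold
        smooth_fun_on_scaleR[OF _ sections_smooth[OF x U]] trivialisation(1)[OF U]])
    fix p assume "p \<in> U"
    from trivialisation(2)[OF U this] show "f p *\<^sub>R \<tau> p (x p) = \<tau> p (f p *\<^sub>R x p)"
      using sections_fibre[OF x] by (simp add: linear_on_def)
  qed
qed

lemma sections_scaleR: "x \<in> sections E \<Longrightarrow> (\<lambda>p. c *\<^sub>R x p) \<in> sections E"
  using sections_mult[of x "\<lambda>p. c"] smooth_fun_on_const[of "atlas E" UNIV c]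
  by (simp add: smooth_functions_def)

lemma sections_minus: "x \<in> sections E \<Longrightarrow> (\<lambda>p. - x p) \<in> sections E"
  using sections_scaleR[of x "-1"] by simp

lemma sections_diff: "x \<in> sections E \<Longrightarrow> y \<in> sections E \<Longrightarrow> (\<lambda>p. x p - y p) \<in> sections E"
  using sections_add[of x "\<lambda>p. - y p"] sections_minus[of y] by simp

text \<open>
  Multiplied by a single bump function, all local sections that are constant in the trivialisation become
  global smooth sections; those of a basis form a frame near \<open>p\<close>.
\<close>

lemma local_frame_extension:
  assumes U: "(U, \<tau>) \<in> trivs E" and p: "p \<in> U"
  obtains \<beta> where "\<beta> \<in> smooth_functions (atlas E)" "\<beta> p \<noteq> 0"
    "\<forall>w. (\<lambda>q. if q \<in> U then \<beta> q *\<^sub>R inv_into (fibre E q) (\<tau> q) w else 0) \<in> sections E"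
proof -
  obtain \<beta> :: "'m \<Rightarrow> real" and C where \<beta>: "\<beta> \<in> smooth_functions (atlas E)" "\<beta> p \<noteq> 0" "closed C" "C \<subseteq> U"
    "\<forall>q. q \<notin> C \<longrightarrow> \<beta> q = 0"
    by (rule smooth_bump[OF bundle_manifold p trivialisation(1)[OF U]])
  have "(\<lambda>q. if q \<in> U then \<beta> q *\<^sub>R inv_into (fibre E q) (\<tau> q) w else 0) \<in> sections E"
    (is "?s \<in> _") for w
  proof (rule sectionsI)
    show "?s q \<in> fibre E q" for q
      using subspace_scale[OF fibre_subspace trivialisation_inverse(1)[OF U]] subspace_0[OF fibre_subspace]
      by simp
    fix V \<sigma> assume V: "(V, \<sigma>) \<in> trivs E"
    note openV = trivialisation(1)[OF V] and openU = trivialisation(1)[OF U]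
    have in_U: "smooth_fun_on (atlas E) (U \<inter> V) (\<lambda>q. \<sigma> q (?s q))"
    proof (rule smooth_fun_on_cong[OF bundle_manifold _ open_Int[OF openU openV]])
      show "smooth_fun_on (atlas E) (U \<inter> V) (\<lambda>q. \<beta> q *\<^sub>R \<sigma> q (inv_into (fibre E q) (\<tau> q) w))"
      proof (rule smooth_fun_on_scaleR)
        show "smooth_fun_on (atlas E) (U \<inter> V) \<beta>"
          using \<beta>(1) smooth_fun_on_mono[of "atlas E" UNIV \<beta>] by (simp add: smooth_functions_def)
        show "smooth_fun_on (atlas E) (U \<inter> V) (\<lambda>q. \<sigma> q (inv_into (fibre E q) (\<tau> q) w))"
          using VB U V unfolding vector_bundle_def by blast
      qed
      fix q assume "q \<in> U \<inter> V"
      then show "\<beta> q *\<^sub>R \<sigma> q (inv_into (fibre E q) (\<tau> q) w) = \<sigma> q (?s q)"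
        using trivialisation(2)[OF V, of q] trivialisation_inverse(1)[OF U, of q w]
        by (simp add: linear_on_def)
    qed
    have outside_C: "smooth_fun_on (atlas E) (V - C) (\<lambda>q. \<sigma> q (?s q))"
    proof (rule smooth_fun_on_cong[OF bundle_manifold smooth_fun_on_const open_Diff[OF openV \<beta>(3)]])
      fix q assume q: "q \<in> V - C"
      then have "?s q = 0" using \<beta>(5) by simp
      then show "0 = \<sigma> q (?s q)"
        using linear_on_zero[OF trivialisation(2)[OF V] subspace_0[OF fibre_subspace]] q by simp
    qed
    show "smooth_fun_on (atlas E) V (\<lambda>q. \<sigma> q (?s q))"
    proof (rule smooth_fun_on_local[OF bundle_manifold])
      fix q assume q: "q \<in> V"
      show "\<exists>W. open W \<and> q \<in> W \<and> smooth_fun_on (atlas E) W (\<lambda>q. \<sigma> q (?s q))"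
      proof (cases "q \<in> U")
        case True
        then show ?thesis using in_U open_Int[OF openU openV] q by blast
      next
        case False
        then have "q \<in> V - C" using q \<beta>(4) by blast
        then show ?thesis using outside_C open_Diff[OF openV \<beta>(3)] by blast
      qed
    qed
  qed
  then show thesis by (intro that[OF \<beta>(1,2)] allI)
qed

lemma section_through:
  assumes v: "v \<in> fibre E p"
  obtains x where "x \<in> sections E" "x p = v"
proof -
  obtain U \<tau> where U: "(U, \<tau>) \<in> trivs E" "p \<in> U" using VB unfolding vector_bundle_def by blast
  obtain \<beta> where \<beta>: "\<beta> \<in> smooth_functions (atlas E)" "\<beta> p \<noteq> 0"
    "\<forall>w. (\<lambda>q. if q \<in> U then \<beta> q *\<^sub>R inv_into (fibre E q) (\<tau> q) w else 0) \<in> sections E"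
    by (rule local_frame_extension[OF U])
  show thesis
    by (rule that[OF sections_scaleR[OF \<beta>(3)[rule_format, of "\<tau> p v"], of "inverse (\<beta> p)"]])
      (use U(2) \<beta>(2) trivialisation_inverse(3)[OF U v] in simp)
qed

end

context
  fixes E :: "('m::{t2_space,second_countable_topology}, 'c::real_inner, 'v::real_vector,
                'f::real_inner, 'z) courant_scheme"
  assumes VB: "vector_bundle E" and BP: "bundle_pairing E"
begin

lemma pairing_commute: "u \<in> fibre E p \<Longrightarrow> v \<in> fibre E p \<Longrightarrow> pairing E p u v = pairing E p v u"
  using BP unfolding bundle_pairing_def by blast

lemma pairing_add_scale:
  assumes "u \<in> fibre E p" "v \<in> fibre E p"
  shows "w \<in> fibre E p \<Longrightarrow> pairing E p u (v + w) = pairing E p u v + pairing E p u w"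
    "w \<in> fibre E p \<Longrightarrow> pairing E p (u + v) w = pairing E p u w + pairing E p v w"
    "pairing E p u (c *\<^sub>R v) = c * pairing E p u v"
    "pairing E p (c *\<^sub>R u) v = c * pairing E p u v"
proof -
  note sp = fibre_subspace[OF VB, of p]
  have lin: "linear_on (fibre E p) (pairing E p x)" if "x \<in> fibre E p" for x
    using BP that unfolding bundle_pairing_def by blast
  show "w \<in> fibre E p \<Longrightarrow> pairing E p u (v + w) = pairing E p u v + pairing E p u w"
    "pairing E p u (c *\<^sub>R v) = c * pairing E p u v"
    using lin[OF assms(1)] assms by (simp_all add: linear_on_def)
  show "pairing E p (c *\<^sub>R u) v = c * pairing E p u v"
    using lin[OF assms(2)] assms pairing_commute[of _ p v] sp by (simp add: linear_on_def subspace_scale)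
  show "pairing E p (u + v) w = pairing E p u w + pairing E p v w" if w: "w \<in> fibre E p"
    using lin[OF w] assms w pairing_commute[of _ p w] sp by (simp add: linear_on_def subspace_add)
qed

lemma pairing_minus_diff:
  assumes "u \<in> fibre E p" "v \<in> fibre E p"
  shows "pairing E p u (- v) = - pairing E p u v"
    "pairing E p (- u) v = - pairing E p u v"
    "w \<in> fibre E p \<Longrightarrow> pairing E p u (v - w) = pairing E p u v - pairing E p u w"
    "w \<in> fibre E p \<Longrightarrow> pairing E p (u - v) w = pairing E p u w - pairing E p v w"
proof -
  note neg = subspace_neg[OF fibre_subspace[OF VB, of p]]
  have minus: "pairing E p x (- y) = - pairing E p x y" "pairing E p (- x) y = - pairing E p x y"
    if "x \<in> fibre E p" "y \<in> fibre E p" for x y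
    using pairing_add_scale(3,4)[OF that, of "-1"] by simp_all
  show "pairing E p u (- v) = - pairing E p u v" "pairing E p (- u) v = - pairing E p u v"
    by (rule minus[OF assms])+
  show "w \<in> fibre E p \<Longrightarrow> pairing E p u (v - w) = pairing E p u v - pairing E p u w"
    using pairing_add_scale(1)[OF assms neg] minus(1)[OF assms(1)] by fastforce
  show "w \<in> fibre E p \<Longrightarrow> pairing E p (u - v) w = pairing E p u w - pairing E p v w"
    using pairing_add_scale(2)[OF assms(1) neg[OF assms(2)]] minus(2)[OF assms(2)] by fastforce
qed

lemmas pairing_linear = pairing_add_scale pairing_minus_diff

lemma pairing_nondegenerate:
  "u \<in> fibre E p \<Longrightarrow> (\<And>v. v \<in> fibre E p \<Longrightarrow> pairing E p u v = 0) \<Longrightarrow> u = 0"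
  using BP unfolding bundle_pairing_def by blast

lemma pairing_eqI:
  assumes "u \<in> fibre E p" "v \<in> fibre E p" "\<And>w. w \<in> fibre E p \<Longrightarrow> pairing E p u w = pairing E p v w"
  shows "u = v"
proof -
  have "u - v = 0"
    using assms subspace_diff[OF fibre_subspace[OF VB] assms(1,2)]
    by (intro pairing_nondegenerate[of "u - v" p]) (simp_all add: pairing_linear)
  then show ?thesis by simp
qed

lemma pairing_sum:
  assumes "u \<in> fibre E p" "\<And>i. i \<in> I \<Longrightarrow> f i \<in> fibre E p"
  shows "pairing E p u (\<Sum>i\<in>I. f i) = (\<Sum>i\<in>I. pairing E p u (f i))"
  using assms(2)
proof (induction I rule: infinite_finite_induct)
  case (insert i I)
  have "sum f I \<in> fibre E p" by (rule subspace_sum[OF fibre_subspace[OF VB] insert.prems[OF insertI2]])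
  then show ?case
    using pairing_linear(1)[OF assms(1) insert.prems[OF insertI1], of "sum f I"] insert by simp
qed (use pairing_linear(3)[OF assms(1,1), of 0] in simp_all)

lemma pairing_dual_basis:
  obtains B e where "finite B" "B \<subseteq> fibre E p" "e ` B \<subseteq> fibre E p"
    "\<forall>y\<in>fibre E p. y = (\<Sum>x\<in>B. pairing E p (e x) y *\<^sub>R x)"
proof -
  obtain B0 where B0: "finite B0" "fibre E p \<subseteq> span B0" using fibre_fin_dim[OF VB] by blast
  have lin: "linear_on (fibre E p) (pairing E p u)" if "u \<in> fibre E p" for u
    using BP that unfolding bundle_pairing_def by blast
  have nondeg: "u = 0" if "u \<in> fibre E p" "\<forall>v\<in>fibre E p. pairing E p u v = 0" for u
    using pairing_nondegenerate that by blast
  show thesis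
    by (rule dual_basis[OF fibre_subspace[OF VB] B0 lin pairing_commute nondeg])
      (assumption+, rule that)
qed

lemma pairing_represents_functional:
  assumes lin: "linear_on (fibre E p) \<phi>"
  obtains u where "u \<in> fibre E p" "\<And>v. v \<in> fibre E p \<Longrightarrow> pairing E p u v = \<phi> v"
proof -
  obtain B e where B: "finite B" "B \<subseteq> fibre E p" "e ` B \<subseteq> fibre E p"
    "\<forall>y\<in>fibre E p. y = (\<Sum>x\<in>B. pairing E p (e x) y *\<^sub>R x)"
    by (rule pairing_dual_basis)
  note sp = fibre_subspace[OF VB, of p]
  define u where "u = (\<Sum>x\<in>B. \<phi> x *\<^sub>R e x)"
  have \<phi>_sum: "\<phi> (\<Sum>x\<in>T. f x *\<^sub>R x) = (\<Sum>x\<in>T. f x * \<phi> x)" if "finite T" "T \<subseteq> fibre E p" for T f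
    using that
  proof (induction T rule: finite_induct)
    case empty
    show ?case using linear_on_zero[OF lin subspace_0[OF sp]] by simp
  next
    case (insert x T)
    then have "f x *\<^sub>R x \<in> fibre E p" "(\<Sum>x\<in>T. f x *\<^sub>R x) \<in> fibre E p"
      by (auto intro!: subspace_scale[OF sp] subspace_sum[OF sp])
    then show ?case using insert lin by (simp add: linear_on_def)
  qed
  have ue: "\<phi> x *\<^sub>R e x \<in> fibre E p" if "x \<in> B" for x
    using that B(3) by (intro subspace_scale[OF sp]) blast
  have u: "u \<in> fibre E p" unfolding u_def using ue by (rule subspace_sum[OF sp])
  have "pairing E p u v = \<phi> v" if v: "v \<in> fibre E p" for v
  proof -
    have "pairing E p u v = (\<Sum>x\<in>B. pairing E p v (\<phi> x *\<^sub>R e x))"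
      using pairing_sum[OF v ue] pairing_commute[OF u v] by (simp add: u_def)
    also have "\<dots> = (\<Sum>x\<in>B. pairing E p (e x) v * \<phi> x)"
    proof (rule sum.cong[OF refl])
      fix x assume "x \<in> B"
      then have "e x \<in> fibre E p" using B(3) by blast
      then show "pairing E p v (\<phi> x *\<^sub>R e x) = pairing E p (e x) v * \<phi> x"
        using v pairing_commute[OF v] by (simp add: pairing_linear)
    qed
    also have "\<dots> = \<phi> v" using \<phi>_sum[OF B(1,2), of "\<lambda>x. pairing E p (e x) v"] B(4)[rule_format, OF v, symmetric]
      by simp
    finally show ?thesis .
  qed
  then show thesis by (rule that[OF u])
qed

lemma pairing_smooth:
  "x \<in> sections E \<Longrightarrow> y \<in> sections E \<Longrightarrow> (\<lambda>p. pairing E p (x p) (y p)) \<in> smooth_functions (atlas E)"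
  using BP unfolding bundle_pairing_def pairing_fun_def by blast

lemma section_eqI:
  assumes "u \<in> fibre E p" "v \<in> fibre E p"
    "\<And>z. z \<in> sections E \<Longrightarrow> pairing E p u (z p) = pairing E p v (z p)"
  shows "u = v"
  using assms(3) section_through[OF VB] by (intro pairing_eqI[OF assms(1,2)]) metis

text \<open>
  Near \<open>p\<close> expand \<open>y\<close> in a global family \<open>s\<close> of sections that is a frame near \<open>p\<close>.  The coefficients solve the linear
  system whose matrix is the Gram matrix of \<open>s\<close> and whose right-hand side consists of the pairings of \<open>y\<close>
  with \<open>s\<close>; nondegeneracy of the pairing makes the Gram matrix injective at \<open>p\<close>.
\<close>

lemma section_if_pairings_smooth:
  assumes fib: "\<And>p. y p \<in> fibre E p"
    and smooth: "\<And>z. z \<in> sections E \<Longrightarrow> (\<lambda>p. pairing E p (y p) (z p)) \<in> smooth_functions (atlas E)"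
  shows "y \<in> sections E"
proof (rule sectionsI[OF VB fib])
  fix U \<tau> assume U: "(U, \<tau>) \<in> trivs E"
  note M = bundle_manifold[OF VB]
  note openU = trivialisation(1)[OF VB U]
  obtain B and e :: "'f \<Rightarrow> 'f" where B: "finite B"
    and dual: "\<forall>y. y = (\<Sum>x\<in>B. (e x \<bullet> y) *\<^sub>R x)"
    and delta: "\<forall>x\<in>B. \<forall>y\<in>B. e x \<bullet> y = (if x = y then 1 else 0)"
    by (rule inner_dual_basis[OF typical_fibre_fin_dim[OF VB]])
  show "smooth_fun_on (atlas E) U (\<lambda>q. \<tau> q (y q))"
  proof (rule smooth_fun_on_local[OF M])
    fix p assume p: "p \<in> U"
    obtain \<beta> where \<beta>: "\<beta> \<in> smooth_functions (atlas E)" "\<beta> p \<noteq> 0"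
      "\<forall>w. (\<lambda>q. if q \<in> U then \<beta> q *\<^sub>R inv_into (fibre E q) (\<tau> q) w else 0) \<in> sections E"
      by (rule local_frame_extension[OF VB U p])
    define s where "s w = (\<lambda>q. if q \<in> U then \<beta> q *\<^sub>R inv_into (fibre E q) (\<tau> q) w else 0)" for w
    have s: "s w \<in> sections E" for w unfolding s_def by (rule \<beta>(3)[rule_format])
    note sf = sections_fibre[OF VB s]
    \<comment> \<open>The factor compensates for the bump function in \<open>s\<close>.\<close>
    define c where "c w q = inverse (\<beta> q) * (e w \<bullet> \<tau> q (y q))" for w q
    have near: "smooth_near (atlas E) p f" if "f \<in> smooth_functions (atlas E)" for f :: "'m \<Rightarrow> real"
      using smooth_near_if_smooth[OF M that] .
    obtain W where W: "open W" "p \<in> W" "\<forall>q\<in>W. \<beta> q \<noteq> 0"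
      by (rule smooth_near_nonzero[OF M near[OF \<beta>(1)] \<beta>(2)])
    have expand: "y q = (\<Sum>w\<in>B. c w q *\<^sub>R s w q)" and \<tau>_expand: "\<tau> q (y q) = (\<Sum>w\<in>B. (\<beta> q * c w q) *\<^sub>R w)"
      if q: "q \<in> W \<inter> U" for q
    proof -
      have qU: "q \<in> U" and nz: "\<beta> q \<noteq> 0" using q W(3) by blast+
      let ?g = "inv_into (fibre E q) (\<tau> q)"
      have lin: "linear ?g" by (rule trivialisation_inverse_linear[OF VB U qU])
      have "y q = ?g (\<tau> q (y q))" using trivialisation_inverse(3)[OF VB U qU fib] by simp
      also have "\<dots> = ?g (\<Sum>w\<in>B. (e w \<bullet> \<tau> q (y q)) *\<^sub>R w)" using dual[rule_format, of "\<tau> q (y q)"] by (rule arg_cong)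
      also have "\<dots> = (\<Sum>w\<in>B. (e w \<bullet> \<tau> q (y q)) *\<^sub>R ?g w)"
        by (simp add: linear_sum[OF lin] linear_scale[OF lin])
      also have "\<dots> = (\<Sum>w\<in>B. c w q *\<^sub>R s w q)"
        using nz qU by (intro sum.cong refl) (simp add: c_def s_def field_simps)
      finally show "y q = (\<Sum>w\<in>B. c w q *\<^sub>R s w q)" .
      have "(\<Sum>w\<in>B. (e w \<bullet> \<tau> q (y q)) *\<^sub>R w) = (\<Sum>w\<in>B. (\<beta> q * c w q) *\<^sub>R w)"
        using nz by (simp add: c_def mult.assoc[symmetric])
      with dual[rule_format, of "\<tau> q (y q)"] show "\<tau> q (y q) = (\<Sum>w\<in>B. (\<beta> q * c w q) *\<^sub>R w)" by (rule trans)
    qed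
    have "\<forall>w\<in>B. smooth_near (atlas E) p (c w)"
    proof (rule smooth_near_linear_system[OF M B, where I = B and g = "\<lambda>i j q. pairing E q (s i q) (s j q)"])
      show "smooth_near (atlas E) p (\<lambda>q. pairing E q (s i q) (s j q))" for i j
        by (rule near[OF pairing_smooth[OF s s]])
      fix i assume "i \<in> B"
      show "smooth_near (atlas E) p (\<lambda>q. \<Sum>j\<in>B. pairing E q (s i q) (s j q) * c j q)"
      proof (rule smooth_near_cong[OF M near[OF smooth[OF s[of i]]] open_Int[OF W(1) openU]])
        show "p \<in> W \<inter> U" using W(2) p by blast
        fix q assume q: "q \<in> W \<inter> U"
        have "pairing E q (y q) (s i q) = pairing E q (s i q) (\<Sum>j\<in>B. c j q *\<^sub>R s j q)"
          using pairing_commute[OF fib sf, of q i] unfolding expand[OF q, symmetric] .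
        also have "\<dots> = (\<Sum>j\<in>B. pairing E q (s i q) (s j q) * c j q)"
          using pairing_sum[OF sf, of B "\<lambda>j. c j q *\<^sub>R s j q"] sf subspace_scale[OF fibre_subspace[OF VB]]
          by (simp add: pairing_linear(3)[OF sf sf] mult.commute)
        finally show "pairing E q (y q) (s i q) = (\<Sum>j\<in>B. pairing E q (s i q) (s j q) * c j q)" .
      qed
    next
      fix v j assume v: "\<And>i. i \<in> B \<Longrightarrow> (\<Sum>j\<in>B. pairing E p (s i p) (s j p) * v j) = 0" and j: "j \<in> B"
      let ?g = "inv_into (fibre E p) (\<tau> p)"
      have lin: "linear ?g" by (rule trivialisation_inverse_linear[OF VB U p])
      define z where "z = (\<Sum>j\<in>B. v j *\<^sub>R s j p)"
      have vs: "v j *\<^sub>R s j p \<in> fibre E p" for j by (rule subspace_scale[OF fibre_subspace[OF VB] sf])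
      have zf: "z \<in> fibre E p" unfolding z_def by (rule subspace_sum[OF fibre_subspace[OF VB] vs])
      have zs: "pairing E p z (s i p) = 0" if "i \<in> B" for i
        using v[OF that] pairing_sum[OF sf[of i p], of B "\<lambda>j. v j *\<^sub>R s j p", OF vs] pairing_commute[OF zf sf[of i p]]
        by (simp add: z_def pairing_linear(3)[OF sf sf] mult.commute)
      have "z = 0"
      proof (rule pairing_nondegenerate[OF zf])
        fix u assume u: "u \<in> fibre E p"
        have "u = ?g (\<Sum>w\<in>B. (e w \<bullet> \<tau> p u) *\<^sub>R w)"
          using trivialisation_inverse(3)[OF VB U p u] dual[rule_format, of "\<tau> p u"] by simp
        also have "\<dots> = (\<Sum>w\<in>B. (inverse (\<beta> p) * (e w \<bullet> \<tau> p u)) *\<^sub>R s w p)"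
          using \<beta>(2) p unfolding linear_sum[OF lin] linear_scale[OF lin]
          by (intro sum.cong refl) (simp add: s_def field_simps)
        finally have "u = (\<Sum>w\<in>B. (inverse (\<beta> p) * (e w \<bullet> \<tau> p u)) *\<^sub>R s w p)" (is "u = ?r") .
        moreover have "pairing E p z ?r = 0"
          using pairing_sum[OF zf, of B "\<lambda>w. (inverse (\<beta> p) * (e w \<bullet> \<tau> p u)) *\<^sub>R s w p"] zs
            subspace_scale[OF fibre_subspace[OF VB] sf]
          by (simp add: pairing_linear(3)[OF zf sf])
        ultimately show "pairing E p z u = 0" by metis
      qed
      moreover have "z = ?g (\<Sum>w\<in>B. (v w * \<beta> p) *\<^sub>R w)"
        using p by (simp add: z_def s_def linear_sum[OF lin] linear_scale[OF lin])
      ultimately have "(\<Sum>w\<in>B. (v w * \<beta> p) *\<^sub>R w) = \<tau> p 0"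
        using trivialisation_inverse(2)[OF VB U p] by metis
      then have "(\<Sum>w\<in>B. (v w * \<beta> p) *\<^sub>R w) = 0"
        using linear_on_zero[OF trivialisation(2)[OF VB U p] zf] by simp
      then have "0 = e j \<bullet> (\<Sum>w\<in>B. (v w * \<beta> p) *\<^sub>R w)" by simp
      also have "\<dots> = (\<Sum>w\<in>B. (v w * \<beta> p) * (if j = w then 1 else 0))"
        using delta j by (simp add: inner_sum_right)
      also have "\<dots> = v j * \<beta> p" using B j by (simp add: if_distrib cong: if_cong)
      finally show "v j = 0" using \<beta>(2) by simp
    qed
    then have "smooth_near (atlas E) p (\<lambda>q. \<Sum>w\<in>B. (\<beta> q * c w q) *\<^sub>R w)"
      by (intro smooth_near_sum[OF M] smooth_near_scaleR[OF M smooth_near_mult[OF M near[OF \<beta>(1)]]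
            smooth_near_const[OF M]]) blast
    then have "smooth_near (atlas E) p (\<lambda>q. \<tau> q (y q))"
      by (rule smooth_near_cong[OF M _ open_Int[OF W(1) openU]])
        (use W(2) p \<tau>_expand in simp_all)
    then show "\<exists>W. open W \<and> p \<in> W \<and> smooth_fun_on (atlas E) W (\<lambda>q. \<tau> q (y q))"
      unfolding smooth_near_def[OF M] .
  qed
qed

end

section \<open>Nijenhuis concomitants of a quaternionic triple\<close>

definition quaternionic ::
  "('m, 'c::real_inner, 'v::real_vector, 'f::real_inner, 'z) vbundle_scheme \<Rightarrow>
     ('m \<Rightarrow> 'v \<Rightarrow> 'v) \<Rightarrow> ('m \<Rightarrow> 'v \<Rightarrow> 'v) \<Rightarrow> ('m \<Rightarrow> 'v \<Rightarrow> 'v) \<Rightarrow> bool" where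
  "quaternionic E I J K \<longleftrightarrow>
     bundle_endomorphism E I \<and> bundle_endomorphism E J \<and> bundle_endomorphism E K \<and>
     (\<forall>p. \<forall>u\<in>fibre E p.
        I p (I p u) = - u \<and> J p (J p u) = - u \<and> K p (K p u) = - u \<and>
        I p (J p u) = K p u \<and> J p (K p u) = I p u \<and> K p (I p u) = J p u \<and>
        J p (I p u) = - K p u \<and> K p (J p u) = - I p u \<and> I p (K p u) = - J p u)"

lemma quaternionic_rotate: "quaternionic E I J K \<Longrightarrow> quaternionic E J K I"
  unfolding quaternionic_def by blast

lemma nijenhuis_commute: "nijenhuis E F G U V = nijenhuis E G F U V"
  by (rule ext) (simp add: nijenhuis_def algebra_simps)

lemma nijenhuis_vanishes_commute: "nijenhuis_vanishes E F G \<longleftrightarrow> nijenhuis_vanishes E G F"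
  by (simp add: nijenhuis_vanishes_def nijenhuis_commute[of E F G])

lemma nijenhuis_at:
  "nijenhuis E F G U V p =
     dorfman E (act F U) (act G V) p - F p (dorfman E U (act G V) p)
     - G p (dorfman E (act F U) V p) + F p (G p (dorfman E U V p))
     + dorfman E (act G U) (act F V) p - G p (dorfman E U (act F V) p)
     - F p (dorfman E (act G U) V p) + G p (F p (dorfman E U V p))"
  by (simp add: nijenhuis_def act_def)

definition holomorphic_sharp ::
  "('m \<Rightarrow> 'v \<Rightarrow> 'v) \<Rightarrow> ('m \<Rightarrow> 'v \<Rightarrow> 'v) \<Rightarrow> 'm \<Rightarrow> 'v::real_vector \<times> 'v \<Rightarrow> 'v \<times> 'v" where
  "holomorphic_sharp I K p U = cscale (1 / 2) (cext (I p) U + cscale \<i> (cext (K p) U))"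

lemma holomorphic_sharp_Pair:
  "holomorphic_sharp I K p (u, v) = ((1/2) *\<^sub>R (I p u - K p v), (1/2) *\<^sub>R (I p v + K p u))"
  by (simp add: holomorphic_sharp_def cscale_def cext_def algebra_simps)

lemma smooth_Complex:
  assumes "f \<in> smooth_functions A" "g \<in> smooth_functions A"
  shows "(\<lambda>p. Complex (f p) (g p)) \<in> smooth_functions A"
proof -
  have "smooth_fun_on A UNIV (\<lambda>p. complex_of_real (f p) + \<i> * complex_of_real (g p))"
    using assms unfolding smooth_functions_def mem_Collect_eq
    by (intro smooth_fun_on_add smooth_fun_on_mult smooth_fun_on_const
        smooth_fun_on_bounded_linear[OF bounded_linear_of_real])
  then show ?thesis by (simp add: smooth_functions_def Complex_eq)
qed

lemma smooth_Re_Im: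
  assumes "f \<in> smooth_functions A"
  shows "(\<lambda>p. Re (f p)) \<in> smooth_functions A" "(\<lambda>p. Im (f p)) \<in> smooth_functions A"
  using assms smooth_fun_on_bounded_linear[OF bounded_linear_Re] smooth_fun_on_bounded_linear[OF bounded_linear_Im]
  by (simp_all add: smooth_functions_def)

lemma smooth_functions_add:
  "f \<in> smooth_functions A \<Longrightarrow> g \<in> smooth_functions A \<Longrightarrow> (\<lambda>p. f p + g p) \<in> smooth_functions A"
  by (simp add: smooth_functions_def smooth_fun_on_add)

lemma smooth_functions_diff:
  "f \<in> smooth_functions A \<Longrightarrow> g \<in> smooth_functions A \<Longrightarrow> (\<lambda>p. f p - g p) \<in> smooth_functions A"
  by (simp add: smooth_functions_def smooth_fun_on_diff)

lemma smooth_functions_cmult: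
  fixes f :: "'m \<Rightarrow> real"
  shows "f \<in> smooth_functions A \<Longrightarrow> (\<lambda>p. c * f p) \<in> smooth_functions A"
  by (simp add: smooth_functions_def smooth_fun_on_mult smooth_fun_on_const)

lemma lie_algebroid_d_two:
  "lie_algebroid_d \<rho> br 2 \<omega> [a, b, c] p =
     \<rho> a (\<omega> [b, c]) p - \<rho> b (\<omega> [a, c]) p + \<rho> c (\<omega> [a, b]) p
     - \<omega> [br a b, c] p + \<omega> [br a c, b] p - \<omega> [br b c, a] p"
  by (simp add: lie_algebroid_d_def numeral_2_eq_2 nths_Cons lessThan_Suc atMost_Suc)

definition Lbar_lift :: "('m \<Rightarrow> 'v \<Rightarrow> 'v) \<Rightarrow> ('m \<Rightarrow> 'v) \<Rightarrow> 'm \<Rightarrow> 'v \<times> 'v" where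
  "Lbar_lift J x p = (x p, J p (x p))"

definition skew_for_pairing ::
  "('m, 'c, 'v, 'f, 'z) courant_scheme \<Rightarrow> ('m \<Rightarrow> 'v \<Rightarrow> 'v) \<Rightarrow> bool" where
  "skew_for_pairing E F \<longleftrightarrow>
     (\<forall>p. \<forall>u\<in>fibre E p. \<forall>v\<in>fibre E p. pairing E p (F p u) v = - pairing E p u (F p v))"

context
  fixes E :: "('m::{t2_space,second_countable_topology}, 'c::real_inner, 'v::real_vector,
                'f::real_inner, 'z) courant_scheme"
  assumes CA: "courant_algebroid E"
begin

lemma courant_vector_bundle: "vector_bundle E"
  and courant_pairing: "bundle_pairing E"
  and courant_anchor: "bundle_anchor E"
  using CA unfolding courant_algebroid_def by blast+

lemma dorfman_sections: "x \<in> sections E \<Longrightarrow> y \<in> sections E \<Longrightarrow> dorfman E x y \<in> sections E"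
  using CA[unfolded courant_algebroid_def, THEN conjunct2, THEN conjunct2, THEN conjunct2, THEN conjunct1]
  by blast

lemma dorfman_fibre: "x \<in> sections E \<Longrightarrow> y \<in> sections E \<Longrightarrow> dorfman E x y p \<in> fibre E p"
  using sections_fibre[OF courant_vector_bundle dorfman_sections] .

lemma dorfman_linear:
  assumes "x \<in> sections E" "y \<in> sections E" "z \<in> sections E"
  shows "dorfman E x (\<lambda>p. a *\<^sub>R y p + b *\<^sub>R z p) = (\<lambda>p. a *\<^sub>R dorfman E x y p + b *\<^sub>R dorfman E x z p)"
    "dorfman E (\<lambda>p. a *\<^sub>R y p + b *\<^sub>R z p) x = (\<lambda>p. a *\<^sub>R dorfman E y x p + b *\<^sub>R dorfman E z x p)"
  using CA[unfolded courant_algebroid_def, THEN conjunct2, THEN conjunct2, THEN conjunct2,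
      THEN conjunct2, THEN conjunct1, rule_format, OF assms]
  by blast+

lemma dorfman_minus:
  assumes "x \<in> sections E" "y \<in> sections E"
  shows "dorfman E x (\<lambda>p. - y p) = (\<lambda>p. - dorfman E x y p)"
    "dorfman E (\<lambda>p. - x p) y = (\<lambda>p. - dorfman E x y p)"
  using dorfman_linear(1)[OF assms(1,2,2), of "-1" 0] dorfman_linear(2)[OF assms(2,1,1), of "-1" 0]
  by simp_all

lemma endomorphism_rules:
  assumes F: "bundle_endomorphism E F"
  shows "x \<in> sections E \<Longrightarrow> act F x \<in> sections E"
    "u \<in> fibre E p \<Longrightarrow> F p u \<in> fibre E p"
    "u \<in> fibre E p \<Longrightarrow> v \<in> fibre E p \<Longrightarrow> F p (u + v) = F p u + F p v"
    "u \<in> fibre E p \<Longrightarrow> v \<in> fibre E p \<Longrightarrow> F p (u - v) = F p u - F p v"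
    "u \<in> fibre E p \<Longrightarrow> F p (- u) = - F p u"
    "u \<in> fibre E p \<Longrightarrow> F p (c *\<^sub>R u) = c *\<^sub>R F p u"
proof -
  note sp = fibre_subspace[OF courant_vector_bundle]
  have lin: "linear_on (fibre E p) (F p)" for p using F unfolding bundle_endomorphism_def by blast
  show "x \<in> sections E \<Longrightarrow> act F x \<in> sections E" "u \<in> fibre E p \<Longrightarrow> F p u \<in> fibre E p"
    using F unfolding bundle_endomorphism_def act_def by blast+
  show add: "F p (u + v) = F p u + F p v" if "u \<in> fibre E p" "v \<in> fibre E p" for u v
    using lin that by (simp add: linear_on_def)
  show scale: "F p (c *\<^sub>R u) = c *\<^sub>R F p u" if "u \<in> fibre E p" for u c
    using lin that by (simp add: linear_on_def)
  show neg: "F p (- u) = - F p u" if "u \<in> fibre E p" for u using scale[OF that, of "-1"] by simp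
  show "F p (u - v) = F p u - F p v" if "u \<in> fibre E p" "v \<in> fibre E p"
    using add[OF that(1) subspace_neg[OF sp that(2)]] neg[OF that(2)] by simp
qed

lemma fibre_closed:
  "u \<in> fibre E p \<Longrightarrow> v \<in> fibre E p \<Longrightarrow> u + v \<in> fibre E p"
  "u \<in> fibre E p \<Longrightarrow> v \<in> fibre E p \<Longrightarrow> u - v \<in> fibre E p"
  "u \<in> fibre E p \<Longrightarrow> - u \<in> fibre E p"
  "u \<in> fibre E p \<Longrightarrow> c *\<^sub>R u \<in> fibre E p"
  using fibre_subspace[OF courant_vector_bundle, of p]
  by (simp_all add: subspace_add subspace_diff subspace_neg subspace_scale)

context
  fixes I J K
  assumes Q: "quaternionic E I J K"
begin

lemma quaternionic_endomorphisms:
  "bundle_endomorphism E I" "bundle_endomorphism E J" "bundle_endomorphism E K"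
  using Q unfolding quaternionic_def by blast+

lemmas I_rules = endomorphism_rules[OF quaternionic_endomorphisms(1)]
lemmas J_rules = endomorphism_rules[OF quaternionic_endomorphisms(2)]
lemmas K_rules = endomorphism_rules[OF quaternionic_endomorphisms(3)]

lemma quaternion_products:
  assumes "u \<in> fibre E p"
  shows "I p (I p u) = - u" "J p (J p u) = - u" "K p (K p u) = - u"
    "I p (J p u) = K p u" "J p (K p u) = I p u" "K p (I p u) = J p u"
    "J p (I p u) = - K p u" "K p (J p u) = - I p u" "I p (K p u) = - J p u"
  using Q assms unfolding quaternionic_def by blast+

lemma quaternion_products_act:
  assumes "x \<in> sections E"
  shows "act I (act I x) = (\<lambda>p. - x p)" "act J (act J x) = (\<lambda>p. - x p)" "act K (act K x) = (\<lambda>p. - x p)"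
    "act I (act J x) = act K x" "act J (act K x) = act I x" "act K (act I x) = act J x"
    "act J (act I x) = (\<lambda>p. - act K x p)" "act K (act J x) = (\<lambda>p. - act I x p)"
    "act I (act K x) = (\<lambda>p. - act J x p)"
  using quaternion_products[OF sections_fibre[OF courant_vector_bundle assms]]
  by (simp_all add: act_def)

lemmas quaternion_simps = I_rules J_rules K_rules quaternion_products quaternion_products_act
  dorfman_minus dorfman_fibre fibre_closed sections_minus[OF courant_vector_bundle]

text \<open>
  A formal identity: only the bilinearity of the bracket and the quaternion relations enter.  Modulo
  \<open>N(J, J)\<close> it determines \<open>N(J, K)\<close> by \<open>N(J, I)\<close>, where \<open>K = I J\<close>.
\<close>

lemma nijenhuis_JK_JI:
  assumes x: "x \<in> sections E" and y: "y \<in> sections E"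
  shows "2 *\<^sub>R (nijenhuis E J K x (act J y) p + nijenhuis E J I x y p) =
    nijenhuis E J J (act K x) y p - K p (nijenhuis E J J x y p)"
  using x y by (simp add: nijenhuis_at quaternion_simps scaleR_2)

text \<open>
  Another formal identity; it expresses \<open>N(J, J)\<close> by \<open>N(I, J)\<close> alone, as \<open>I\<close> and \<open>J\<close> anticommute.
\<close>

lemma nijenhuis_JJ_IJ:
  assumes x: "x \<in> sections E" and y: "y \<in> sections E"
  shows "nijenhuis E J J x y p =
    J p (nijenhuis E I J x (act I y) p) - J p (nijenhuis E I J (act J x) (act K y) p)
    - nijenhuis E I J x (act K y) p - nijenhuis E I J (act J x) (act I y) p"
  using x y by (simp add: nijenhuis_at quaternion_simps)

lemma nijenhuis_JK_if_JI:
  assumes JJ: "nijenhuis_vanishes E J J" and JI: "nijenhuis_vanishes E J I"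
  shows "nijenhuis_vanishes E J K"
  unfolding nijenhuis_vanishes_def
proof (intro ballI ext)
  fix x y p assume x: "x \<in> sections E" and y: "y \<in> sections E"
  have vanish: "nijenhuis E J F z w p = 0"
    if "nijenhuis_vanishes E J F" "z \<in> sections E" "w \<in> sections E" for F z w
    using that unfolding nijenhuis_vanishes_def by metis
  have zero: "K p 0 = 0"
    using K_rules(6)[of 0 p 0] fibre_closed(4)[OF sections_fibre[OF courant_vector_bundle x], of 0] by simp
  \<comment> \<open>The second argument \<open>- J y\<close> is chosen so that the identity speaks of \<open>N(J, K)(x, y)\<close>.\<close>
  have my: "(\<lambda>p. - act J y p) \<in> sections E"
    using sections_minus[OF courant_vector_bundle J_rules(1)[OF y]] .
  have "act J (\<lambda>p. - act J y p) = y"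
    using quaternion_products_act(2)[OF y] J_rules(5) sections_fibre[OF courant_vector_bundle J_rules(1)[OF y]]
    by (auto simp: act_def fun_eq_iff)
  then have "2 *\<^sub>R nijenhuis E J K x y p = 0"
    using nijenhuis_JK_JI[OF x my, of p] vanish[OF JJ K_rules(1)[OF x] my] vanish[OF JJ x my]
      vanish[OF JI x my] zero
    by simp
  then show "nijenhuis E J K x y p = 0" by simp
qed

lemma nijenhuis_JJ_if_IJ:
  assumes IJ: "nijenhuis_vanishes E I J"
  shows "nijenhuis_vanishes E J J"
  unfolding nijenhuis_vanishes_def
proof (intro ballI ext)
  fix x y p assume x: "x \<in> sections E" and y: "y \<in> sections E"
  have vanish: "nijenhuis E I J z w p = 0" if "z \<in> sections E" "w \<in> sections E" for z w
    using that IJ unfolding nijenhuis_vanishes_def by metis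
  have zero: "J p 0 = 0"
    using J_rules(6)[of 0 p 0] fibre_closed(4)[OF sections_fibre[OF courant_vector_bundle x], of 0] by simp
  show "nijenhuis E J J x y p = 0"
    using nijenhuis_JJ_IJ[OF x y, of p] x y by (simp add: vanish zero I_rules(1) J_rules(1) K_rules(1))
qed

text \<open>
  For \<open>a = x + \<i> J x\<close> and \<open>b = y + \<i> J y\<close> the section \<open>a \<circ> \<omega>b + \<omega>a \<circ> b - \<omega>(a \<circ> b)\<close>, where \<open>\<omega> = (I + \<i> K) / 2\<close>, is
  \<open>R + \<i> M\<close>; here \<open>\<omega>b = I y + \<i> K y\<close> and \<open>a \<circ> b = S + \<i> T\<close>.  It belongs to the conjugate bundle iff \<open>J R = M\<close>, so
  \<open>J R - M\<close> measures the failure of closedness.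
\<close>

lemma closedness_defect:
  fixes p :: 'm
  assumes x: "x \<in> sections E" and y: "y \<in> sections E"
  defines "S \<equiv> dorfman E x y p - dorfman E (act J x) (act J y) p"
    and "T \<equiv> dorfman E x (act J y) p + dorfman E (act J x) y p"
  defines "R \<equiv> dorfman E x (act I y) p - dorfman E (act J x) (act K y) p + dorfman E (act I x) y p
      - dorfman E (act K x) (act J y) p - (1/2) *\<^sub>R (I p S - K p T)"
    and "M \<equiv> dorfman E x (act K y) p + dorfman E (act J x) (act I y) p + dorfman E (act K x) y p
      + dorfman E (act I x) (act J y) p - (1/2) *\<^sub>R (K p S + I p T)"
  shows "2 *\<^sub>R (J p R - M) =
    nijenhuis E J J x (act K y) p + 2 *\<^sub>R nijenhuis E J K x (act J y) p - 2 *\<^sub>R nijenhuis E J I x y p"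
  using x y by (simp add: R_def M_def S_def T_def nijenhuis_at quaternion_simps scaleR_2
      scaleR_add_right scaleR_diff_right)

end

text \<open>
  The implications \<open>nijenhuis_JK_if_JI\<close> and \<open>nijenhuis_JJ_if_IJ\<close> are applied in turn to the cyclic rotations:
  \<open>N(J, I)\<close> gives \<open>N(J, K)\<close>, which gives \<open>N(K, K)\<close>, then \<open>N(K, I)\<close>, then \<open>N(I, I)\<close>.
\<close>

lemma nijenhuis_vanishes_all:
  assumes Q: "quaternionic E I J K"
    and JJ: "nijenhuis_vanishes E J J" and JI: "nijenhuis_vanishes E J I"
  shows "nijenhuis_vanishes E I I \<and> nijenhuis_vanishes E I J \<and> nijenhuis_vanishes E I K \<and>
    nijenhuis_vanishes E J K \<and> nijenhuis_vanishes E K K"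
proof -
  note Q' = quaternionic_rotate[OF Q]
  note Q'' = quaternionic_rotate[OF Q']
  have JK: "nijenhuis_vanishes E J K" by (rule nijenhuis_JK_if_JI[OF Q JJ JI])
  then have KJ: "nijenhuis_vanishes E K J" by (simp only: nijenhuis_vanishes_commute[of E K J])
  have KK: "nijenhuis_vanishes E K K" by (rule nijenhuis_JJ_if_IJ[OF Q' JK])
  have KI: "nijenhuis_vanishes E K I" by (rule nijenhuis_JK_if_JI[OF Q' KK KJ])
  have II: "nijenhuis_vanishes E I I" by (rule nijenhuis_JJ_if_IJ[OF Q'' KI])
  show ?thesis
    using II JI KI JK KK nijenhuis_vanishes_commute[of E I J] nijenhuis_vanishes_commute[of E I K] by blast
qed

section \<open>The differential of a form on the complexified Courant algebroid\<close>

lemmas in_fibre = sections_fibre[OF courant_vector_bundle]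
lemmas pairing_rules = pairing_linear[OF courant_vector_bundle courant_pairing]
lemmas pairing_sym = pairing_commute[OF courant_vector_bundle courant_pairing]

lemma anchor_function_linear:
  assumes u: "u \<in> fibre E p" and f: "f \<in> smooth_functions (atlas E)" and g: "g \<in> smooth_functions (atlas E)"
  shows "anchor E p u (\<lambda>q. f q + g q) = anchor E p u f + anchor E p u g"
    "anchor E p u (\<lambda>q. f q - g q) = anchor E p u f - anchor E p u g"
proof -
  have "anchor E p u \<in> tangent_space (atlas E) p"
    using courant_anchor u unfolding bundle_anchor_def by blast
  then have lin: "anchor E p u (\<lambda>q. f q + g q) = anchor E p u f + anchor E p u g"
    "anchor E p u (\<lambda>q. c * f q) = c * anchor E p u f"
    if "f \<in> smooth_functions (atlas E)" "g \<in> smooth_functions (atlas E)" for f g c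
    using that unfolding tangent_space_def by blast+
  show "anchor E p u (\<lambda>q. f q + g q) = anchor E p u f + anchor E p u g" by (rule lin(1)[OF f g])
  show "anchor E p u (\<lambda>q. f q - g q) = anchor E p u f - anchor E p u g"
    using lin(1)[OF f smooth_functions_cmult[OF g], of "-1"] lin(2)[OF g g, of "-1"] by simp
qed

lemma courant_D_pairing:
  assumes f: "f \<in> smooth_functions (atlas E)"
  shows "courant_D E f p \<in> fibre E p"
    "v \<in> fibre E p \<Longrightarrow> pairing E p (courant_D E f p) v = 1 / 2 * anchor E p v f"
proof -
  have "linear_on (fibre E p) (\<lambda>v. anchor E p v f)"
    using courant_anchor f unfolding bundle_anchor_def by blast
  then have lin: "linear_on (fibre E p) (\<lambda>v. 1 / 2 * anchor E p v f)"
    by (simp add: linear_on_def)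
  obtain e where e: "e \<in> fibre E p" "\<And>v. v \<in> fibre E p \<Longrightarrow> pairing E p e v = 1 / 2 * anchor E p v f"
    by (rule pairing_represents_functional[OF courant_vector_bundle courant_pairing lin]) blast
  let ?P = "\<lambda>e. e \<in> fibre E p \<and> (\<forall>v\<in>fibre E p. pairing E p e v = 1 / 2 * anchor E p v f)"
  have "?P (THE e. ?P e)"
  proof (rule theI)
    show "?P e" using e by blast
    show "d = e" if "?P d" for d
    proof (rule pairing_eqI[OF courant_vector_bundle courant_pairing])
      show "d \<in> fibre E p" "e \<in> fibre E p" using that e(1) by blast+
      show "pairing E p d w = pairing E p e w" if w: "w \<in> fibre E p" for w
        using \<open>?P d\<close> w unfolding e(2)[OF w] by blast
    qed
  qed
  then show "courant_D E f p \<in> fibre E p"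
    "v \<in> fibre E p \<Longrightarrow> pairing E p (courant_D E f p) v = 1 / 2 * anchor E p v f"
    unfolding courant_D_def by blast+
qed

lemma dorfman_symmetric_part:
  assumes x: "x \<in> sections E" and y: "y \<in> sections E" and v: "v \<in> fibre E p"
  shows "pairing E p (dorfman E x y p + dorfman E y x p) v = anchor E p v (\<lambda>q. pairing E q (x q) (y q))"
proof -
  have "(\<lambda>p. dorfman E x y p + dorfman E y x p) = (\<lambda>p. 2 *\<^sub>R courant_D E (pairing_fun E x y) p)"
    using CA[unfolded courant_algebroid_def, THEN conjunct2, THEN conjunct2, THEN conjunct2, THEN conjunct2,
        THEN conjunct2, THEN conjunct2, THEN conjunct2, THEN conjunct2, THEN conjunct1] x y
    by blast
  then have "dorfman E x y p + dorfman E y x p = 2 *\<^sub>R courant_D E (pairing_fun E x y) p" by metis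
  moreover have "pairing_fun E x y \<in> smooth_functions (atlas E)"
    using courant_pairing x y unfolding bundle_pairing_def by blast
  note D = courant_D_pairing[OF this]
  have "pairing E p (2 *\<^sub>R courant_D E (pairing_fun E x y) p) v = anchor E p v (pairing_fun E x y)"
    using pairing_rules(4)[OF D(1) v, of 2] D(2)[OF v] by simp
  ultimately show ?thesis by (simp add: pairing_fun_def)
qed

lemma dorfman_metric:
  assumes x: "x \<in> sections E" and y: "y \<in> sections E" and z: "z \<in> sections E"
  shows "anchor E p (x p) (\<lambda>q. pairing E q (y q) (z q)) =
    pairing E p (dorfman E x y p) (z p) + pairing E p (y p) (dorfman E x z p)"
proof -
  have "anchor_fun E x (pairing_fun E y z) =
      (\<lambda>p. pairing_fun E (dorfman E x y) z p + pairing_fun E y (dorfman E x z) p)"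
    using CA[unfolded courant_algebroid_def, THEN conjunct2, THEN conjunct2, THEN conjunct2, THEN conjunct2,
        THEN conjunct2, THEN conjunct2, THEN conjunct2, THEN conjunct2, THEN conjunct2, THEN conjunct2] x y z
    by blast
  from fun_cong[OF this, of p] show ?thesis by (simp add: anchor_fun_def pairing_fun_def)
qed

lemma cfibre_iff: "U \<in> cfibre E p \<longleftrightarrow> fst U \<in> fibre E p \<and> snd U \<in> fibre E p"
  by (simp add: cfibre_def mem_Times_iff)

lemma csections_fibre: "U \<in> csections E \<Longrightarrow> fst (U p) \<in> fibre E p" "U \<in> csections E \<Longrightarrow> snd (U p) \<in> fibre E p"
  "U \<in> csections E \<Longrightarrow> U p \<in> cfibre E p"
  using in_fibre unfolding csections_def cfibre_iff by blast+

lemma cdorfman_csections: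
  assumes "U \<in> csections E" "V \<in> csections E"
  shows "cdorfman E U V \<in> csections E"
  using assms unfolding csections_def cdorfman_def
  by (simp add: sections_add[OF courant_vector_bundle] sections_diff[OF courant_vector_bundle] dorfman_sections)

lemma cpairing_rules:
  assumes "U \<in> cfibre E p" "V \<in> cfibre E p" "W \<in> cfibre E p"
  shows "cpairing E p (U + V) W = cpairing E p U W + cpairing E p V W"
    "cpairing E p (U - V) W = cpairing E p U W - cpairing E p V W"
    "cpairing E p (cscale z U) V = z * cpairing E p U V"
    "cpairing E p U V = cpairing E p V U"
  using assms
  by (auto simp: cfibre_iff cpairing_def complex_eq_iff pairing_rules fibre_closed pairing_sym cscale_def algebra_simps)

lemma cpairing_smooth:
  assumes "U \<in> csections E" "V \<in> csections E"
  shows "(\<lambda>p. cpairing E p (U p) (V p)) \<in> smooth_functions (atlas E)"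
  using assms unfolding csections_def cpairing_def
  by (intro smooth_Complex smooth_functions_add smooth_functions_diff) (simp_all add: pairing_smooth[OF courant_vector_bundle courant_pairing])

lemma canchor_cpairing:
  assumes "U \<in> csections E" "V \<in> csections E" and W: "W \<in> csections E"
  shows "canchor_fun E W (\<lambda>q. cpairing E q (U q) (V q)) p = Complex
    (anchor E p (fst (W p)) (\<lambda>q. pairing E q (fst (U q)) (fst (V q)))
      - anchor E p (fst (W p)) (\<lambda>q. pairing E q (snd (U q)) (snd (V q)))
      - anchor E p (snd (W p)) (\<lambda>q. pairing E q (fst (U q)) (snd (V q)))
      - anchor E p (snd (W p)) (\<lambda>q. pairing E q (snd (U q)) (fst (V q))))
    (anchor E p (fst (W p)) (\<lambda>q. pairing E q (fst (U q)) (snd (V q)))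
      + anchor E p (fst (W p)) (\<lambda>q. pairing E q (snd (U q)) (fst (V q)))
      + anchor E p (snd (W p)) (\<lambda>q. pairing E q (fst (U q)) (fst (V q)))
      - anchor E p (snd (W p)) (\<lambda>q. pairing E q (snd (U q)) (snd (V q))))"
proof -
  have smooth: "(\<lambda>q. pairing E q (f (U q)) (g (V q))) \<in> smooth_functions (atlas E)"
    if "f = fst \<or> f = snd" "g = fst \<or> g = snd" for f g :: "'v \<times> 'v \<Rightarrow> 'v"
    using assms that unfolding csections_def by (auto intro!: pairing_smooth[OF courant_vector_bundle courant_pairing])
  show ?thesis
    using csections_fibre(1,2)[OF W, of p] smooth
    by (simp add: canchor_fun_def cpairing_def anchor_function_linear)
qed

lemma cdorfman_metric:
  assumes U: "U \<in> csections E" and V: "V \<in> csections E" and W: "W \<in> csections E"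
  shows "canchor_fun E U (\<lambda>q. cpairing E q (V q) (W q)) p =
    cpairing E p (cdorfman E U V p) (W p) + cpairing E p (V p) (cdorfman E U W p)"
proof -
  have s: "(\<lambda>p. fst (U p)) \<in> sections E" "(\<lambda>p. snd (U p)) \<in> sections E"
    "(\<lambda>p. fst (V p)) \<in> sections E" "(\<lambda>p. snd (V p)) \<in> sections E"
    "(\<lambda>p. fst (W p)) \<in> sections E" "(\<lambda>p. snd (W p)) \<in> sections E"
    using U V W by (simp_all add: csections_def)
  note f = csections_fibre(1,2)[OF U, of p] csections_fibre(1,2)[OF V, of p] csections_fibre(1,2)[OF W, of p]
  show ?thesis
    using s f unfolding canchor_cpairing[OF V W U]
    by (simp add: dorfman_metric[OF s(1)] dorfman_metric[OF s(2)]
        cpairing_def cdorfman_def complex_eq_iff pairing_rules dorfman_fibre)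
qed

lemma cdorfman_symmetric_part:
  assumes U: "U \<in> csections E" and V: "V \<in> csections E" and W: "W \<in> csections E"
  shows "canchor_fun E W (\<lambda>q. cpairing E q (U q) (V q)) p =
    cpairing E p (cdorfman E U V p + cdorfman E V U p) (W p)"
proof -
  have s: "(\<lambda>p. fst (U p)) \<in> sections E" "(\<lambda>p. snd (U p)) \<in> sections E"
    "(\<lambda>p. fst (V p)) \<in> sections E" "(\<lambda>p. snd (V p)) \<in> sections E"
    using U V by (simp_all add: csections_def)
  note f = csections_fibre(1,2)[OF W, of p]
  show ?thesis
    using s f unfolding canchor_cpairing[OF U V W]
    by (simp add: dorfman_symmetric_part[symmetric]
        cpairing_def cdorfman_def complex_eq_iff pairing_rules dorfman_fibre fibre_closed)
qed

text \<open>
  By invariance of the pairing the anchor terms of \<open>a\<close> and \<open>b\<close> in \<open>d\<Omega>(a, b, c)\<close> split into two brackets each; by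
  skewness of \<open>\<omega>\<close>, one bracket of each cancels the terms \<open>\<Omega>(a \<circ> c, b)\<close> and \<open>\<Omega>(b \<circ> c, a)\<close>.  The anchor term of \<open>c\<close> is instead
  rewritten by the symmetric part of the bracket, so that \<open>c\<close> ends up outside all brackets.
\<close>

lemma lie_algebroid_d_of_skew_endomorphism:
  assumes \<Omega>: "\<And>p U V. U \<in> cfibre E p \<Longrightarrow> V \<in> cfibre E p \<Longrightarrow> \<Omega> p U V = cpairing E p (\<omega> p U) V"
    and \<omega>: "\<And>U. U \<in> csections E \<Longrightarrow> (\<lambda>p. \<omega> p (U p)) \<in> csections E"
    and fibre: "\<And>p U. U \<in> cfibre E p \<Longrightarrow> \<omega> p U \<in> cfibre E p"
    and skew: "\<And>p U V. U \<in> cfibre E p \<Longrightarrow> V \<in> cfibre E p \<Longrightarrow>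
      cpairing E p (\<omega> p U) V = - cpairing E p U (\<omega> p V)"
    and a: "a \<in> csections E" and b: "b \<in> csections E" and c: "c \<in> csections E"
  shows "lie_algebroid_d (canchor_fun E) (cdorfman E) 2 (form_on_sections \<Omega>) [a, b, c] p =
    cpairing E p (cdorfman E a (\<lambda>p. \<omega> p (b p)) p + cdorfman E (\<lambda>p. \<omega> p (a p)) b p
      - \<omega> p (cdorfman E a b p)) (c p)"
proof -
  have form: "form_on_sections \<Omega> [x, y] = (\<lambda>q. cpairing E q (\<omega> q (x q)) (y q))"
    if "x \<in> csections E" "y \<in> csections E" for x y
    using that \<Omega> csections_fibre(3) by (auto simp: form_on_sections_def)
  note cd = cdorfman_csections
  note f = csections_fibre(3)[of _ p]
  have 1: "canchor_fun E a (\<lambda>q. cpairing E q (\<omega> q (b q)) (c q)) p =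
      cpairing E p (cdorfman E a (\<lambda>p. \<omega> p (b p)) p) (c p) - cpairing E p (b p) (\<omega> p (cdorfman E a c p))"
    using cdorfman_metric[OF a \<omega>[OF b] c, of p] skew[OF f[OF b] f[OF cd[OF a c]]] by simp
  have 2: "canchor_fun E b (\<lambda>q. cpairing E q (\<omega> q (a q)) (c q)) p =
      cpairing E p (cdorfman E b (\<lambda>p. \<omega> p (a p)) p) (c p) - cpairing E p (a p) (\<omega> p (cdorfman E b c p))"
    using cdorfman_metric[OF b \<omega>[OF a] c, of p] skew[OF f[OF a] f[OF cd[OF b c]]] by simp
  have 3: "canchor_fun E c (\<lambda>q. cpairing E q (\<omega> q (a q)) (b q)) p =
      cpairing E p (cdorfman E (\<lambda>p. \<omega> p (a p)) b p) (c p) + cpairing E p (cdorfman E b (\<lambda>p. \<omega> p (a p)) p) (c p)"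
    using cdorfman_symmetric_part[OF \<omega>[OF a] b c, of p]
      cpairing_rules(1)[OF f[OF cd[OF \<omega>[OF a] b]] f[OF cd[OF b \<omega>[OF a]]] f[OF c]]
    by simp
  have 4: "cpairing E p (cdorfman E a (\<lambda>p. \<omega> p (b p)) p + cdorfman E (\<lambda>p. \<omega> p (a p)) b p
      - \<omega> p (cdorfman E a b p)) (c p) =
      cpairing E p (cdorfman E a (\<lambda>p. \<omega> p (b p)) p) (c p) + cpairing E p (cdorfman E (\<lambda>p. \<omega> p (a p)) b p) (c p)
      - cpairing E p (\<omega> p (cdorfman E a b p)) (c p)"
  proof -
    have "cdorfman E a (\<lambda>p. \<omega> p (b p)) p \<in> cfibre E p" "cdorfman E (\<lambda>p. \<omega> p (a p)) b p \<in> cfibre E p"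
      "\<omega> p (cdorfman E a b p) \<in> cfibre E p" "c p \<in> cfibre E p"
      by (rule f[OF cd[OF a \<omega>[OF b]]] f[OF cd[OF \<omega>[OF a] b]] fibre[OF f[OF cd[OF a b]]] f[OF c])+
    moreover from this have
      "cdorfman E a (\<lambda>p. \<omega> p (b p)) p + cdorfman E (\<lambda>p. \<omega> p (a p)) b p \<in> cfibre E p"
      by (simp add: cfibre_iff fibre_closed)
    ultimately show ?thesis by (simp add: cpairing_rules(1,2))
  qed
  have 5: "cpairing E p (\<omega> p (cdorfman E a c p)) (b p) = cpairing E p (b p) (\<omega> p (cdorfman E a c p))"
    "cpairing E p (\<omega> p (cdorfman E b c p)) (a p) = cpairing E p (a p) (\<omega> p (cdorfman E b c p))"
    by (rule cpairing_rules(4)[OF fibre[OF f[OF cd[OF a c]]] f[OF b] f[OF b]]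
        cpairing_rules(4)[OF fibre[OF f[OF cd[OF b c]]] f[OF a] f[OF a]])+
  show ?thesis
    using a b c unfolding lie_algebroid_d_two 4 by (simp add: form cd 1 2 3 5)
qed

section \<open>Two-forms as endomorphisms\<close>

text \<open>
  The definite description in \<open>sharp\<close> is meaningful: the real and the imaginary part of \<open>\<Omega> p U\<close>, restricted to
  real vectors, are represented by vectors of the fibre, and complex linearity does the rest.
\<close>

lemma two_form_represented:
  assumes \<Omega>: "two_form E \<Omega>" and U: "U \<in> cfibre E p"
  obtains W where "W \<in> cfibre E p" "\<forall>V\<in>cfibre E p. \<Omega> p U V = cpairing E p W V"
proof -
  have z: "0 \<in> fibre E p" using fibre_closed(2)[of "fst U" p "fst U"] U by (simp add: cfibre_iff)
  have skew: "\<Omega> p A B = - \<Omega> p B A" if "A \<in> cfibre E p" "B \<in> cfibre E p" for A B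
    using \<Omega> that unfolding two_form_def by blast
  have add: "\<Omega> p U (A + B) = \<Omega> p U A + \<Omega> p U B" if "A \<in> cfibre E p" "B \<in> cfibre E p" for A B
  proof -
    have "\<Omega> p (A + B) U = \<Omega> p A U + \<Omega> p B U" using \<Omega> U that unfolding two_form_def by blast
    moreover have "A + B \<in> cfibre E p" using that by (simp add: cfibre_iff fibre_closed)
    note skew[OF U this] skew[OF U that(1)] skew[OF U that(2)]
    ultimately show ?thesis by simp
  qed
  have scale: "\<Omega> p U (cscale c A) = c * \<Omega> p U A" if "A \<in> cfibre E p" for A c
  proof -
    have "\<Omega> p (cscale c A) U = c * \<Omega> p A U" using \<Omega> U that unfolding two_form_def by blast
    moreover have "cscale c A \<in> cfibre E p" using that by (simp add: cfibre_iff cscale_def fibre_closed)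
    note skew[OF U this] skew[OF U that]
    ultimately show ?thesis by simp
  qed
  have real: "(v, 0) \<in> cfibre E p" if "v \<in> fibre E p" for v using that z by (simp add: cfibre_iff)
  have rscale: "\<Omega> p U (c *\<^sub>R v, 0) = c * \<Omega> p U (v, 0)" if "v \<in> fibre E p" for v c
    using scale[OF real[OF that], of "complex_of_real c"] by (simp add: cscale_def)
  have radd: "\<Omega> p U (v + w, 0) = \<Omega> p U (v, 0) + \<Omega> p U (w, 0)" if "v \<in> fibre E p" "w \<in> fibre E p" for v w
    using add[OF real[OF that(1)] real[OF that(2)]] by simp
  have lin: "linear_on (fibre E p) (\<lambda>v. Re (\<Omega> p U (v, 0)))" "linear_on (fibre E p) (\<lambda>v. Im (\<Omega> p U (v, 0)))"
    unfolding linear_on_def by (simp_all add: rscale radd)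
  obtain r where r: "r \<in> fibre E p" "\<And>v. v \<in> fibre E p \<Longrightarrow> pairing E p r v = Re (\<Omega> p U (v, 0))"
    by (rule pairing_represents_functional[OF courant_vector_bundle courant_pairing lin(1)]) blast
  obtain s where s: "s \<in> fibre E p" "\<And>v. v \<in> fibre E p \<Longrightarrow> pairing E p s v = Im (\<Omega> p U (v, 0))"
    by (rule pairing_represents_functional[OF courant_vector_bundle courant_pairing lin(2)]) blast
  have "\<Omega> p U V = cpairing E p (r, s) V" if V: "V \<in> cfibre E p" for V
  proof -
    obtain v w where vw: "V = (v, w)" "v \<in> fibre E p" "w \<in> fibre E p" using V by (cases V) (simp add: cfibre_iff)
    have "V = (v, 0) + cscale \<i> (w, 0)" using vw by (simp add: cscale_def)
    moreover have "cscale \<i> (w, 0) \<in> cfibre E p" using vw z by (simp add: cfibre_iff cscale_def fibre_closed)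
    ultimately have "\<Omega> p U V = \<Omega> p U (v, 0) + \<i> * \<Omega> p U (w, 0)"
      using add[OF real[OF vw(2)], of "cscale \<i> (w, 0)"] scale[OF real[OF vw(3)], of \<i>] by simp
    then show ?thesis using vw r s by (simp add: cpairing_def complex_eq_iff)
  qed
  then show thesis using that[of "(r, s)"] r(1) s(1) by (simp add: cfibre_iff)
qed

lemma sharp_eqI:
  assumes W: "W \<in> cfibre E p" and eq: "\<forall>V\<in>cfibre E p. \<Omega> p U V = cpairing E p W V"
  shows "sharp E \<Omega> p U = W"
  unfolding sharp_def
proof (rule the_equality)
  show "W \<in> cfibre E p \<and> (\<forall>V\<in>cfibre E p. \<Omega> p U V = cpairing E p W V)" using assms by blast
  fix X assume X: "X \<in> cfibre E p \<and> (\<forall>V\<in>cfibre E p. \<Omega> p U V = cpairing E p X V)"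
  have z: "0 \<in> fibre E p" using fibre_closed(2)[of "fst W" p "fst W"] W by (simp add: cfibre_iff)
  have "pairing E p (fst X) v = pairing E p (fst W) v \<and> pairing E p (snd X) v = pairing E p (snd W) v"
    if v: "v \<in> fibre E p" for v
  proof -
    have "(v, 0) \<in> cfibre E p" using v z by (simp add: cfibre_iff)
    then have "cpairing E p X (v, 0) = cpairing E p W (v, 0)" using X eq by metis
    moreover have "pairing E p u 0 = 0" if "u \<in> fibre E p" for u using pairing_rules(3)[OF that z, of 0] by simp
    ultimately show ?thesis using X W by (simp add: cpairing_def cfibre_iff)
  qed
  note eq = this
  have "fst X = fst W" "snd X = snd W"
    by (rule pairing_eqI[OF courant_vector_bundle courant_pairing, of _ p]; use X W eq in \<open>simp add: cfibre_iff\<close>)+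
  then show "X = W" by (rule prod_eqI)
qed

lemma sharp_two_form:
  assumes "two_form E \<Omega>" "U \<in> cfibre E p"
  shows "sharp E \<Omega> p U \<in> cfibre E p" "V \<in> cfibre E p \<Longrightarrow> \<Omega> p U V = cpairing E p (sharp E \<Omega> p U) V"
proof -
  obtain W where W: "W \<in> cfibre E p" "\<forall>V\<in>cfibre E p. \<Omega> p U V = cpairing E p W V"
    by (rule two_form_represented[OF assms])
  have eq: "sharp E \<Omega> p U = W" by (rule sharp_eqI) (rule W)+
  show "sharp E \<Omega> p U \<in> cfibre E p" "V \<in> cfibre E p \<Longrightarrow> \<Omega> p U V = cpairing E p (sharp E \<Omega> p U) V"
    using W unfolding eq by blast+
qed

lemma sharp_conj_form:
  assumes \<Omega>: "two_form E \<Omega>" and U: "U \<in> cfibre E p"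
  shows "sharp E (conj_form \<Omega>) p U = cconj (sharp E \<Omega> p (cconj U))"
proof (rule sharp_eqI)
  have cU: "cconj A \<in> cfibre E p" if "A \<in> cfibre E p" for A
    using that by (simp add: cfibre_iff cconj_def fibre_closed)
  note s = sharp_two_form[OF \<Omega> cU[OF U]]
  show "cconj (sharp E \<Omega> p (cconj U)) \<in> cfibre E p" by (rule cU[OF s(1)])
  show "\<forall>V\<in>cfibre E p. conj_form \<Omega> p U V = cpairing E p (cconj (sharp E \<Omega> p (cconj U))) V"
  proof
    fix V assume V: "V \<in> cfibre E p"
    then show "conj_form \<Omega> p U V = cpairing E p (cconj (sharp E \<Omega> p (cconj U))) V"
      using s(1) unfolding conj_form_def s(2)[OF cU[OF V]]
      by (simp add: cpairing_def cconj_def complex_eq_iff cfibre_iff pairing_rules)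
  qed
qed

section \<open>Closedness and the Nijenhuis concomitant\<close>

lemma zero_in_fibre: "0 \<in> fibre E p"
  by (rule subspace_0[OF fibre_subspace[OF courant_vector_bundle]])

lemma pairing_zero:
  "u \<in> fibre E p \<Longrightarrow> pairing E p u 0 = 0" "u \<in> fibre E p \<Longrightarrow> pairing E p 0 u = 0"
  using pairing_rules(3,4)[OF _ zero_in_fibre, of u p 0] pairing_rules(4)[OF zero_in_fibre, of u p 0] by simp_all

lemma endo_zero: "bundle_endomorphism E F \<Longrightarrow> F p 0 = 0"
  using endomorphism_rules(6)[of F 0 p 0] zero_in_fibre by simp

lemma skew_if_almost_complex:
  assumes "almost_complex_structure E J"
  shows "skew_for_pairing E J"
  unfolding skew_for_pairing_def
proof (intro allI ballI)
  fix p u v assume u: "u \<in> fibre E p" and v: "v \<in> fibre E p"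
  have J: "J p w \<in> fibre E p" "J p (J p w) = - w" if "w \<in> fibre E p" for w
    using assms that endomorphism_rules(2) unfolding almost_complex_structure_def by blast+
  have "pairing E p (J p (J p u)) (J p v) = pairing E p (J p u) v"
    using assms J(1) u v unfolding almost_complex_structure_def by blast
  then show "pairing E p (J p u) v = - pairing E p u (J p v)"
    using J u v by (simp add: pairing_rules)
qed

lemma almost_complex_if_skew:
  assumes "bundle_endomorphism E J" "skew_for_pairing E J" "\<And>p u. u \<in> fibre E p \<Longrightarrow> J p (J p u) = - u"
  shows "almost_complex_structure E J"
  using assms endomorphism_rules(2)[OF assms(1)] unfolding almost_complex_structure_def skew_for_pairing_def
  by (simp add: pairing_rules)

lemma quaternionic_if_hypercomplex:
  assumes H: "hypercomplex_structure E I J K"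
  shows "quaternionic E I J K"
proof -
  have endomorphisms: "bundle_endomorphism E I" "bundle_endomorphism E J" "bundle_endomorphism E K"
    using H unfolding hypercomplex_structure_def almost_complex_structure_def by blast+
  note rules = endomorphism_rules[OF endomorphisms(1)] endomorphism_rules[OF endomorphisms(2)] endomorphism_rules[OF endomorphisms(3)]
  have sq: "I p (I p u) = - u" "J p (J p u) = - u" "K p (K p u) = - u" and IJK: "I p (J p (K p u)) = - u"
    if "u \<in> fibre E p" for p u
    using H that unfolding hypercomplex_structure_def almost_complex_structure_def by blast+
  have JK: "J p (K p u) = I p u" if u: "u \<in> fibre E p" for p u
    using sq(1)[of "J p (K p u)" p] IJK[OF u] u by (simp add: rules)
  have IJ: "I p (J p u) = K p u" if u: "u \<in> fibre E p" for p u
    using IJK[of "K p u" p] sq(3)[OF u] u by (simp add: rules)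
  have KJ: "K p (J p u) = - I p u" if u: "u \<in> fibre E p" for p u
    using IJ[of "J p u" p] sq(2)[OF u] u by (simp add: rules)
  have JI: "J p (I p u) = - K p u" if u: "u \<in> fibre E p" for p u
    using sq(2)[of "K p u" p] JK[OF u] u by (simp add: rules)
  have IK: "I p (K p u) = - J p u" if u: "u \<in> fibre E p" for p u
    using sq(1)[of "J p u" p] IJ[OF u] u by (simp add: rules)
  have KI: "K p (I p u) = J p u" if u: "u \<in> fibre E p" for p u
    using KJ[of "K p u" p] JK[OF u] IK[OF u] u by (simp add: rules)
  show ?thesis
    unfolding quaternionic_def using endomorphisms sq JK IJ KJ JI IK KI by blast
qed

lemma holomorphic_sharp_fibre:
  assumes I: "bundle_endomorphism E I" and K: "bundle_endomorphism E K" and U: "U \<in> cfibre E p"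
  shows "holomorphic_sharp I K p U \<in> cfibre E p"
  using U by (cases U) (simp add: cfibre_iff holomorphic_sharp_Pair endomorphism_rules[OF I] endomorphism_rules[OF K] fibre_closed)

lemma holomorphic_sharp_csections:
  assumes I: "bundle_endomorphism E I" and K: "bundle_endomorphism E K" and U: "U \<in> csections E"
  shows "(\<lambda>p. holomorphic_sharp I K p (U p)) \<in> csections E"
proof -
  let ?x = "\<lambda>p. fst (U p)" and ?y = "\<lambda>p. snd (U p)"
  have xy: "?x \<in> sections E" "?y \<in> sections E" using U by (simp_all add: csections_def)
  have eq: "holomorphic_sharp I K p (U p) =
      ((1/2) *\<^sub>R (act I ?x p - act K ?y p), (1/2) *\<^sub>R (act I ?y p + act K ?x p))" for p
    using holomorphic_sharp_Pair[of I K p "fst (U p)" "snd (U p)"] by (simp add: act_def)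
  show ?thesis
    unfolding eq csections_def mem_Collect_eq fst_conv snd_conv
    by (intro conjI sections_scaleR[OF courant_vector_bundle] sections_diff[OF courant_vector_bundle] sections_add[OF courant_vector_bundle] endomorphism_rules(1) I K xy)
qed

lemma holomorphic_sharp_skew:
  assumes I: "bundle_endomorphism E I" and K: "bundle_endomorphism E K"
    and skew: "skew_for_pairing E I" "skew_for_pairing E K"
    and U: "U \<in> cfibre E p" and V: "V \<in> cfibre E p"
  shows "cpairing E p (holomorphic_sharp I K p U) V = - cpairing E p U (holomorphic_sharp I K p V)"
proof -
  obtain u u' v v' where UV: "U = (u, u')" "V = (v, v')" "u \<in> fibre E p" "u' \<in> fibre E p"
    "v \<in> fibre E p" "v' \<in> fibre E p"
    using U V by (cases U, cases V) (auto simp: cfibre_iff)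
  have s: "pairing E p (I p x) y = - pairing E p x (I p y)" "pairing E p (K p x) y = - pairing E p x (K p y)"
    if "x \<in> fibre E p" "y \<in> fibre E p" for x y
    using skew that unfolding skew_for_pairing_def by blast+
  show ?thesis using UV(3-6)
    by (simp add: UV(1,2) holomorphic_sharp_Pair cpairing_def complex_eq_iff pairing_rules fibre_closed
        endomorphism_rules[OF I] endomorphism_rules[OF K] s algebra_simps)
qed

lemma Lbar_sections_iff:
  assumes J: "almost_complex_structure E J"
  shows "a \<in> Lbar_sections E J \<longleftrightarrow> (\<exists>x\<in>sections E. a = Lbar_lift J x)"
proof
  assume a: "a \<in> Lbar_sections E J"
  then have s: "(\<lambda>p. fst (a p)) \<in> sections E" by (simp add: Lbar_sections_def csections_def)
  have "J p (fst (a p)) = snd (a p)" for p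
    using a by (simp add: Lbar_sections_def Lbar_bundle_def cext_def cscale_def)
  then have "a = Lbar_lift J (\<lambda>p. fst (a p))" by (simp add: fun_eq_iff Lbar_lift_def)
  then show "\<exists>x\<in>sections E. a = Lbar_lift J x" using s by blast
next
  assume "\<exists>x\<in>sections E. a = Lbar_lift J x"
  then obtain x where x: "x \<in> sections E" "a = Lbar_lift J x" by blast
  have Je: "bundle_endomorphism E J" using J unfolding almost_complex_structure_def by blast
  have "J p (J p (x p)) = - x p" for p
    using J in_fibre[OF x(1)] unfolding almost_complex_structure_def by blast
  then show "a \<in> Lbar_sections E J"
    using x(1) endomorphism_rules(1)[OF Je x(1)] endomorphism_rules(2)[OF Je] in_fibre[OF x(1)]
    by (simp add: x(2) Lbar_sections_def csections_def Lbar_lift_def Lbar_bundle_def cfibre_iff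
        cext_def cscale_def act_def)
qed

context
  fixes I J K \<Omega>
  assumes Q: "quaternionic E I J K"
    and skew: "skew_for_pairing E I" "skew_for_pairing E J" "skew_for_pairing E K"
    and \<Omega>: "\<And>p U V. U \<in> cfibre E p \<Longrightarrow> V \<in> cfibre E p \<Longrightarrow>
      \<Omega> p U V = cpairing E p (holomorphic_sharp I K p U) V"
begin

lemmas endomorphisms = quaternionic_endomorphisms[OF Q]
lemmas products = quaternion_products[OF Q]
lemmas IJK_rules = endomorphism_rules[OF endomorphisms(1)] endomorphism_rules[OF endomorphisms(2)] endomorphism_rules[OF endomorphisms(3)]

lemma J_almost_complex: "almost_complex_structure E J"
  by (rule almost_complex_if_skew[OF endomorphisms(2) skew(2) products(2)])

text \<open>
  For \<open>x\<close> and \<open>y\<close> as real parts of the first two arguments, \<open>N(J, J) = 0\<close> makes the two contributions of \<open>N(J, K)\<close>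
  and \<open>N(J, I)\<close> in \<open>closedness_defect\<close> equal, by \<open>nijenhuis_JK_JI\<close>.
\<close>

lemma d_on_Lbar:
  assumes JJ: "nijenhuis_vanishes E J J" and x: "x \<in> sections E" and y: "y \<in> sections E"
  obtains R M where "R \<in> fibre E p" "M \<in> fibre E p" "J p R - M = - 2 *\<^sub>R nijenhuis E J I x y p"
    "\<forall>z\<in>sections E. lie_algebroid_d (canchor_fun E) (cdorfman E) 2 (form_on_sections \<Omega>)
        [Lbar_lift J x, Lbar_lift J y, Lbar_lift J z] p = cpairing E p (R, M) (z p, J p (z p))"
proof -
  define S where "S = dorfman E x y p - dorfman E (act J x) (act J y) p"
  define T where "T = dorfman E x (act J y) p + dorfman E (act J x) y p"
  define R where "R = dorfman E x (act I y) p - dorfman E (act J x) (act K y) p + dorfman E (act I x) y p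
      - dorfman E (act K x) (act J y) p - (1/2) *\<^sub>R (I p S - K p T)"
  define M where "M = dorfman E x (act K y) p + dorfman E (act J x) (act I y) p + dorfman E (act K x) y p
      + dorfman E (act I x) (act J y) p - (1/2) *\<^sub>R (K p S + I p T)"
  note df = dorfman_fibre
  have RM: "R \<in> fibre E p" "M \<in> fibre E p"
    unfolding R_def M_def S_def T_def using x y by (simp_all add: fibre_closed df IJK_rules)
  have zero: "nijenhuis E J J z w p = 0" if "z \<in> sections E" "w \<in> sections E" for z w
    using JJ that unfolding nijenhuis_vanishes_def by metis
  have defect: "2 *\<^sub>R (J p R - M) =
      2 *\<^sub>R nijenhuis E J K x (act J y) p - 2 *\<^sub>R nijenhuis E J I x y p"
    using closedness_defect[OF Q x y, of p] zero[OF x IJK_rules(13)[OF y]]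
    unfolding R_def M_def S_def T_def by simp
  have "2 *\<^sub>R (nijenhuis E J K x (act J y) p + nijenhuis E J I x y p) = 0"
    using nijenhuis_JK_JI[OF Q x y, of p] zero[OF IJK_rules(13)[OF x] y] zero[OF x y] endo_zero[OF endomorphisms(3)]
    by simp
  then have JKJI: "nijenhuis E J K x (act J y) p = - nijenhuis E J I x y p"
    by (simp add: add_eq_0_iff2 add_eq_0_iff)
  have "J p R - M = - 2 *\<^sub>R nijenhuis E J I x y p"
    using defect unfolding JKJI
    by (simp flip: scaleR_minus_right scaleR_diff_right) (simp add: scaleR_2)
  moreover have "\<forall>z\<in>sections E. lie_algebroid_d (canchor_fun E) (cdorfman E) 2 (form_on_sections \<Omega>)
        [Lbar_lift J x, Lbar_lift J y, Lbar_lift J z] p = cpairing E p (R, M) (z p, J p (z p))"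
  proof
    fix z assume z: "z \<in> sections E"
    let ?\<omega> = "holomorphic_sharp I K"
    have lift: "Lbar_lift J w \<in> csections E" if "w \<in> sections E" for w
      using that IJK_rules(7)[OF that] by (simp add: csections_def Lbar_lift_def act_def)
    have omega_lift: "(\<lambda>q. ?\<omega> q (Lbar_lift J w q)) = (\<lambda>q. (act I w q, act K w q))" if "w \<in> sections E" for w
      using in_fibre[OF that] products
      by (simp add: fun_eq_iff Lbar_lift_def holomorphic_sharp_Pair act_def flip: scaleR_2)
    have "lie_algebroid_d (canchor_fun E) (cdorfman E) 2 (form_on_sections \<Omega>)
        [Lbar_lift J x, Lbar_lift J y, Lbar_lift J z] p =
      cpairing E p (cdorfman E (Lbar_lift J x) (\<lambda>q. ?\<omega> q (Lbar_lift J y q)) p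
        + cdorfman E (\<lambda>q. ?\<omega> q (Lbar_lift J x q)) (Lbar_lift J y) p
        - ?\<omega> p (cdorfman E (Lbar_lift J x) (Lbar_lift J y) p)) (Lbar_lift J z p)"
      by (rule lie_algebroid_d_of_skew_endomorphism[OF \<Omega> holomorphic_sharp_csections[OF endomorphisms(1,3)]
            holomorphic_sharp_fibre[OF endomorphisms(1,3)] holomorphic_sharp_skew[OF endomorphisms(1,3) skew(1,3)]
            lift[OF x] lift[OF y] lift[OF z]])
    moreover have "cdorfman E (Lbar_lift J x) (\<lambda>q. ?\<omega> q (Lbar_lift J y q)) p
        + cdorfman E (\<lambda>q. ?\<omega> q (Lbar_lift J x q)) (Lbar_lift J y) p
        - ?\<omega> p (cdorfman E (Lbar_lift J x) (Lbar_lift J y) p) = (R, M)"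
      unfolding omega_lift[OF x] omega_lift[OF y] cdorfman_def R_def M_def S_def T_def
      by (simp add: Lbar_lift_def holomorphic_sharp_Pair flip: act_def)
    ultimately show "lie_algebroid_d (canchor_fun E) (cdorfman E) 2 (form_on_sections \<Omega>)
        [Lbar_lift J x, Lbar_lift J y, Lbar_lift J z] p = cpairing E p (R, M) (z p, J p (z p))"
      by (simp add: Lbar_lift_def)
  qed
  ultimately show thesis by (rule that[OF RM])
qed

text \<open>
  On sections of the conjugate bundle \<open>d\<Omega>(a, b, c)\<close> is the pairing of some \<open>R + \<i> M\<close> with \<open>c\<close>, where \<open>J R - M\<close> is a
  multiple of \<open>N(J, I)\<close>.  If \<open>M = J R\<close>, the pairing vanishes because the conjugate bundle is isotropic; the
  converse holds because there are enough sections \<open>c = z + \<i> J z\<close> to detect \<open>J R - M\<close>.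
\<close>

lemma closed_iff_nijenhuis_JI:
  assumes JJ: "nijenhuis_vanishes E J J"
  shows "d_Lstar_closed E J \<Omega> \<longleftrightarrow> nijenhuis_vanishes E J I"
proof -
  have Jskew: "pairing E p (J p u) v = - pairing E p u (J p v)" if "u \<in> fibre E p" "v \<in> fibre E p" for p u v
    using skew(2) that unfolding skew_for_pairing_def by blast
  show ?thesis
  proof
    assume closed: "d_Lstar_closed E J \<Omega>"
    show "nijenhuis_vanishes E J I"
      unfolding nijenhuis_vanishes_def
    proof (intro ballI ext)
      fix x y p assume x: "x \<in> sections E" and y: "y \<in> sections E"
      obtain R M where RM: "R \<in> fibre E p" "M \<in> fibre E p" "J p R - M = - 2 *\<^sub>R nijenhuis E J I x y p"
        and d: "\<forall>z\<in>sections E. lie_algebroid_d (canchor_fun E) (cdorfman E) 2 (form_on_sections \<Omega>)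
          [Lbar_lift J x, Lbar_lift J y, Lbar_lift J z] p = cpairing E p (R, M) (z p, J p (z p))"
        by (rule d_on_Lbar[OF JJ x y])
      have "J p R = M"
      proof (rule section_eqI[OF courant_vector_bundle courant_pairing IJK_rules(8)[OF RM(1)] RM(2)])
        fix z assume z: "z \<in> sections E"
        have Lbar: "Lbar_lift J w \<in> Lbar_sections E J" if "w \<in> sections E" for w
          using Lbar_sections_iff[OF J_almost_complex] that by blast
        have Jz: "act J z \<in> sections E" by (rule IJK_rules(7)[OF z])
        have "lie_algebroid_d (canchor_fun E) (cdorfman E) 2 (form_on_sections \<Omega>)
            [Lbar_lift J x, Lbar_lift J y, Lbar_lift J (act J z)] = (\<lambda>p. 0)"
          using closed Lbar[OF x] Lbar[OF y] Lbar[OF Jz] unfolding d_Lstar_closed_def by blast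
        then have "cpairing E p (R, M) (act J z p, J p (act J z p)) = 0"
          using d[rule_format, OF Jz] by metis
        then have "pairing E p R (J p (z p)) + pairing E p M (z p) = 0"
          using RM in_fibre[OF z] by (simp add: cpairing_def complex_eq_iff act_def products pairing_rules)
        then show "pairing E p (J p R) (z p) = pairing E p M (z p)"
          using Jskew[OF RM(1) in_fibre[OF z]] by simp
      qed
      then show "nijenhuis E J I x y p = 0" using RM(3) by simp
    qed
  next
    assume JI: "nijenhuis_vanishes E J I"
    show "d_Lstar_closed E J \<Omega>"
      unfolding d_Lstar_closed_def
    proof (intro ballI ext)
      fix a b c p assume "a \<in> Lbar_sections E J" "b \<in> Lbar_sections E J" "c \<in> Lbar_sections E J"
      then obtain x y z where x: "x \<in> sections E" "a = Lbar_lift J x" and y: "y \<in> sections E" "b = Lbar_lift J y"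
        and z: "z \<in> sections E" "c = Lbar_lift J z"
        using Lbar_sections_iff[OF J_almost_complex] by blast
      obtain R M where RM: "R \<in> fibre E p" "M \<in> fibre E p" "J p R - M = - 2 *\<^sub>R nijenhuis E J I x y p"
        and d: "\<forall>z\<in>sections E. lie_algebroid_d (canchor_fun E) (cdorfman E) 2 (form_on_sections \<Omega>)
          [Lbar_lift J x, Lbar_lift J y, Lbar_lift J z] p = cpairing E p (R, M) (z p, J p (z p))"
        by (rule d_on_Lbar[OF JJ x(1) y(1)])
      have "nijenhuis E J I x y p = 0" using JI x(1) y(1) unfolding nijenhuis_vanishes_def by metis
      then have "M = J p R" using RM(3) by simp
      then have "cpairing E p (R, M) (z p, J p (z p)) = 0"
        using RM in_fibre[OF z(1)]
        by (simp add: cpairing_def complex_eq_iff Jskew IJK_rules products pairing_rules)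
      then show "lie_algebroid_d (canchor_fun E) (cdorfman E) 2 (form_on_sections \<Omega>) [a, b, c] p = 0"
        using d z(1) unfolding x(2) y(2) z(2) by simp
    qed
  qed
qed

end

section \<open>From hypercomplex structures to holomorphic symplectic forms\<close>

lemma two_form_holomorphic_sharp:
  assumes I: "bundle_endomorphism E I" and K: "bundle_endomorphism E K"
    and skew: "skew_for_pairing E I" "skew_for_pairing E K"
  shows "two_form E (\<lambda>p U V. cpairing E p (holomorphic_sharp I K p U) V)"
proof -
  note h = holomorphic_sharp_fibre[OF I K]
  have add: "holomorphic_sharp I K p (U + V) = holomorphic_sharp I K p U + holomorphic_sharp I K p V"
    and scale: "holomorphic_sharp I K p (cscale z U) = cscale z (holomorphic_sharp I K p U)"
    if "U \<in> cfibre E p" "V \<in> cfibre E p" for p U V z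
    using that by (cases U; cases V;
        simp add: cfibre_iff holomorphic_sharp_Pair cscale_def endomorphism_rules[OF I] endomorphism_rules[OF K] fibre_closed algebra_simps)+
  have swap: "cpairing E p (holomorphic_sharp I K p U) V = - cpairing E p (holomorphic_sharp I K p V) U"
    if "U \<in> cfibre E p" "V \<in> cfibre E p" for p U V
    using holomorphic_sharp_skew[OF I K skew that] cpairing_rules(4)[OF that(1) h[OF that(2)] that(1)]
    by simp
  show ?thesis
    unfolding two_form_def
  proof (intro conjI allI ballI)
    fix p U V W z assume U: "U \<in> cfibre E p" and V: "V \<in> cfibre E p" and W: "W \<in> cfibre E p"
    show "cpairing E p (holomorphic_sharp I K p (U + V)) W =
        cpairing E p (holomorphic_sharp I K p U) W + cpairing E p (holomorphic_sharp I K p V) W"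
      by (simp add: add[OF U V] cpairing_rules(1)[OF h[OF U] h[OF V] W])
    show "cpairing E p (holomorphic_sharp I K p (cscale z U)) W = z * cpairing E p (holomorphic_sharp I K p U) W"
      by (simp add: scale[OF U V] cpairing_rules(3)[OF h[OF U] W W])
    show "cpairing E p (holomorphic_sharp I K p U) V = - cpairing E p (holomorphic_sharp I K p V) U"
      by (rule swap[OF U V])
  next
    fix U V assume "U \<in> csections E" "V \<in> csections E"
    then show "(\<lambda>p. cpairing E p (holomorphic_sharp I K p (U p)) (V p)) \<in> smooth_functions (atlas E)"
      by (intro cpairing_smooth holomorphic_sharp_csections[OF I K])
  qed
qed

lemma cpairing_dual_basis:
  assumes B: "finite B" "B \<subseteq> fibre E p" "e ` B \<subseteq> fibre E p"
    and dual: "\<forall>y\<in>fibre E p. y = (\<Sum>x\<in>B. pairing E p (e x) y *\<^sub>R x)"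
    and W: "W \<in> cfibre E p" and Z: "Z \<in> cfibre E p"
  shows "(\<Sum>x\<in>B. cpairing E p (e x, 0) W * cpairing E p (x, 0) Z) = cpairing E p W Z"
proof -
  have real: "(\<Sum>x\<in>B. pairing E p (e x) w * pairing E p x z) = pairing E p w z"
    if w: "w \<in> fibre E p" and z: "z \<in> fibre E p" for w z
  proof -
    have sc: "pairing E p (e x) w *\<^sub>R x \<in> fibre E p" if "x \<in> B" for x using B(2) that by (intro fibre_closed(4)) blast
    have "pairing E p z w = pairing E p z (\<Sum>x\<in>B. pairing E p (e x) w *\<^sub>R x)"
      by (rule arg_cong[OF dual[rule_format, OF w]])
    also have "\<dots> = (\<Sum>x\<in>B. pairing E p z (pairing E p (e x) w *\<^sub>R x))"
      by (rule pairing_sum[OF courant_vector_bundle courant_pairing z sc])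
    also have "\<dots> = (\<Sum>x\<in>B. pairing E p (e x) w * pairing E p x z)"
    proof (rule sum.cong[OF refl])
      fix x assume "x \<in> B"
      then have x: "x \<in> fibre E p" using B(2) by blast
      show "pairing E p z (pairing E p (e x) w *\<^sub>R x) = pairing E p (e x) w * pairing E p x z"
        using pairing_rules(3)[OF z x] pairing_sym[OF z x] by simp
    qed
    finally show ?thesis using pairing_sym[OF w z] by simp
  qed
  have f: "fst W \<in> fibre E p" "snd W \<in> fibre E p" "fst Z \<in> fibre E p" "snd Z \<in> fibre E p"
    using W Z by (simp_all add: cfibre_iff)
  have c: "cpairing E p (u, 0) A = Complex (pairing E p u (fst A)) (pairing E p u (snd A))"
    if "fst A \<in> fibre E p" "snd A \<in> fibre E p" for u A
    using that by (simp add: cpairing_def pairing_zero)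
  show ?thesis
    unfolding c[OF f(1,2)] c[OF f(3,4)]
    by (simp add: complex_eq_iff sum_subtractf sum.distrib real f cpairing_def)
qed

text \<open>
  Up to the factor \<open>- 1 / 2\<close>, the form of a skew endomorphism is the sum of the bivectors built from the images
  of a dual basis and the basis itself.
  Since \<open>J \<omega> = \<i> \<omega>\<close>, the images lie in \<open>L\<^sub>J\<close>, and the basis vectors may be replaced by their projections to
  \<open>L\<^sub>J\<close>: the parts in the conjugate bundle contribute nothing, as \<open>\<Omega>\<close> vanishes when one argument is in \<open>L\<^sub>J\<close>.
\<close>

lemma section_wedge2_L_if_quaternionic:
  assumes Q: "quaternionic E I J K"
    and skew: "skew_for_pairing E I" "skew_for_pairing E J" "skew_for_pairing E K"
    and tf: "two_form E \<Omega>"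
    and \<Omega>: "\<And>p U V. U \<in> cfibre E p \<Longrightarrow> V \<in> cfibre E p \<Longrightarrow>
      \<Omega> p U V = cpairing E p (holomorphic_sharp I K p U) V"
  shows "section_wedge2_L E J \<Omega>"
  unfolding section_wedge2_L_def
proof (intro conjI allI tf)
  fix p
  let ?\<omega> = "holomorphic_sharp I K p"
  note endomorphisms = quaternionic_endomorphisms[OF Q]
  note rules = endomorphism_rules[OF endomorphisms(1)] endomorphism_rules[OF endomorphisms(2)] endomorphism_rules[OF endomorphisms(3)] endo_zero[OF endomorphisms(1)]
    endo_zero[OF endomorphisms(2)] endo_zero[OF endomorphisms(3)]
  note products = quaternion_products[OF Q]
  note h = holomorphic_sharp_fibre[OF endomorphisms(1,3)]
  obtain B e where B: "finite B" "B \<subseteq> fibre E p" "e ` B \<subseteq> fibre E p"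
    "\<forall>y\<in>fibre E p. y = (\<Sum>x\<in>B. pairing E p (e x) y *\<^sub>R x)"
    by (rule pairing_dual_basis[OF courant_vector_bundle courant_pairing])
  define a where "a x = cscale (- 1/2) (?\<omega> (e x, 0))" for x
  \<comment> \<open>This is \<open>(1 - \<i> J) x / 2\<close>, the projection to \<open>L\<^sub>J\<close>; its transpose \<open>P\<close> projects to the conjugate bundle.\<close>
  define b where "b x = ((1/2) *\<^sub>R x, - (1/2) *\<^sub>R J p x)" for x
  define P where "P V = ((1/2) *\<^sub>R (fst V - J p (snd V)), (1/2) *\<^sub>R (snd V + J p (fst V)))" for V
  have Jskew: "pairing E p u (J p v) = - pairing E p (J p u) v" if "u \<in> fibre E p" "v \<in> fibre E p" for u v
    using skew(2) that unfolding skew_for_pairing_def by fastforce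
  have P: "P V \<in> cfibre E p" if "V \<in> cfibre E p" for V
    using that by (simp add: P_def cfibre_iff rules fibre_closed)
  have in_L: "a x \<in> L_bundle E J p" "b x \<in> L_bundle E J p" if "x \<in> B" for x
  proof -
    have "e x \<in> fibre E p" "x \<in> fibre E p" using that B(2,3) by blast+
    then show "a x \<in> L_bundle E J p" "b x \<in> L_bundle E J p"
      by (simp_all add: a_def b_def L_bundle_def cfibre_iff cext_def cscale_def holomorphic_sharp_Pair
          rules fibre_closed products zero_in_fibre)
  qed
  have a_pair: "cpairing E p (a x) U = 1 / 2 * cpairing E p (e x, 0) (?\<omega> U)"
    if x: "x \<in> B" and U: "U \<in> cfibre E p" for x U
  proof -
    have ex: "(e x, 0) \<in> cfibre E p" using x B(3) zero_in_fibre by (auto simp: cfibre_iff)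
    show ?thesis
      unfolding a_def cpairing_rules(3)[OF h[OF ex] U U]
        holomorphic_sharp_skew[OF endomorphisms(1,3) skew(1,3) ex U]
      by simp
  qed
  have b_pair: "cpairing E p (b x) V = cpairing E p (x, 0) (P V)" if x: "x \<in> B" and V: "V \<in> cfibre E p" for x V
  proof -
    have "x \<in> fibre E p" using x B(2) by blast
    then show ?thesis
      using V by (simp add: b_def P_def cpairing_def cfibre_iff complex_eq_iff rules fibre_closed pairing_rules Jskew
          pairing_zero algebra_simps)
  qed
  have project: "cpairing E p (?\<omega> U) (P V) = cpairing E p (?\<omega> U) V"
    if "U \<in> cfibre E p" "V \<in> cfibre E p" for U V
    using that by (cases U; cases V; simp add: holomorphic_sharp_Pair P_def cpairing_def cfibre_iff
        complex_eq_iff rules fibre_closed pairing_rules Jskew products; auto simp: field_simps)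
  have sum: "\<Omega> p U V = (\<Sum>x\<in>B. wedge_form E p (a x) (b x) U V)"
    if U: "U \<in> cfibre E p" and V: "V \<in> cfibre E p" for U V
  proof -
    have "(\<Sum>x\<in>B. wedge_form E p (a x) (b x) U V) =
        1/2 * (\<Sum>x\<in>B. cpairing E p (e x, 0) (?\<omega> U) * cpairing E p (x, 0) (P V))
        - 1/2 * (\<Sum>x\<in>B. cpairing E p (e x, 0) (?\<omega> V) * cpairing E p (x, 0) (P U))"
      unfolding sum_distrib_left sum_subtractf[symmetric]
      by (rule sum.cong[OF refl]) (simp add: wedge_form_def a_pair b_pair U V)
    also have "\<dots> = 1/2 * cpairing E p (?\<omega> U) V - 1/2 * cpairing E p (?\<omega> V) U"
      by (simp only: cpairing_dual_basis[OF B h[OF U] P[OF V]] cpairing_dual_basis[OF B h[OF V] P[OF U]]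
          project[OF U V] project[OF V U])
    also have "cpairing E p (?\<omega> V) U = - cpairing E p (?\<omega> U) V"
      using tf U V \<Omega> unfolding two_form_def by metis
    finally show ?thesis by (simp add: \<Omega>[OF U V])
  qed
  obtain f where f: "bij_betw f {0..<card B} B" using ex_bij_betw_nat_finite[OF B(1)] by blast
  have fB: "f i \<in> B" if "i < card B" for i using f that by (auto simp: bij_betw_def)
  have "\<Omega> p U V = (\<Sum>i<card B. wedge_form E p (a (f i)) (b (f i)) U V)"
    if "U \<in> cfibre E p" "V \<in> cfibre E p" for U V
    using sum[OF that] sum.reindex_bij_betw[OF f, of "\<lambda>x. wedge_form E p (a x) (b x) U V"]
    by (simp add: lessThan_atLeast0)
  then have "\<forall>U\<in>cfibre E p. \<forall>V\<in>cfibre E p.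
      \<Omega> p U V = (\<Sum>i<card B. wedge_form E p (a (f i)) (b (f i)) U V)" by blast
  moreover have "\<forall>i<card B. a (f i) \<in> L_bundle E J p \<and> b (f i) \<in> L_bundle E J p"
    using in_L fB by blast
  ultimately have "(\<forall>i<card B. a (f i) \<in> L_bundle E J p \<and> b (f i) \<in> L_bundle E J p) \<and>
      (\<forall>U\<in>cfibre E p. \<forall>V\<in>cfibre E p.
        \<Omega> p U V = (\<Sum>i<card B. wedge_form E p (a (f i)) (b (f i)) U V))" by (rule conjI[rotated])
  then show "\<exists>(n::nat) A B. (\<forall>i<n. A i \<in> L_bundle E J p \<and> B i \<in> L_bundle E J p) \<and>
      (\<forall>U\<in>cfibre E p. \<forall>V\<in>cfibre E p. \<Omega> p U V = (\<Sum>i<n. wedge_form E p (A i) (B i) U V))"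
    by (rule exI[of _ "card B", OF exI[of _ "\<lambda>i. a (f i)", OF exI[of _ "\<lambda>i. b (f i)"]]])
qed

lemma hypercomplex_imp_holomorphic_symplectic:
  assumes H: "hypercomplex_structure E I J K" and tf: "two_form E \<Omega>"
    and sharp: "\<And>p U. U \<in> cfibre E p \<Longrightarrow> sharp E \<Omega> p U = holomorphic_sharp I K p U"
  shows "holomorphic_symplectic E J \<Omega>"
proof -
  note Q = quaternionic_if_hypercomplex[OF H]
  note endomorphisms = quaternionic_endomorphisms[OF Q]
  note rules = endomorphism_rules[OF endomorphisms(1)] endomorphism_rules[OF endomorphisms(3)]
  note products = quaternion_products[OF Q]
  have skew: "skew_for_pairing E I" "skew_for_pairing E J" "skew_for_pairing E K"
    using H skew_if_almost_complex unfolding hypercomplex_structure_def by blast+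
  have \<Omega>: "\<Omega> p U V = cpairing E p (holomorphic_sharp I K p U) V"
    if "U \<in> cfibre E p" "V \<in> cfibre E p" for p U V
    using sharp_two_form(2)[OF tf that] sharp[OF that(1)] by simp
  have "nijenhuis_vanishes E J J" "nijenhuis_vanishes E J I"
    using H nijenhuis_vanishes_commute[of E I J] unfolding hypercomplex_structure_def by blast+
  then have "d_Lstar_closed E J \<Omega>"
    using closed_iff_nijenhuis_JI[OF Q skew \<Omega>] by blast
  moreover have "section_wedge2_L E J \<Omega>"
    by (rule section_wedge2_L_if_quaternionic[OF Q skew tf \<Omega>])
  moreover have "sharp E \<Omega> p (sharp E (conj_form \<Omega>) p U) + sharp E (conj_form \<Omega>) p (sharp E \<Omega> p U) = - U"
    if U: "U \<in> cfibre E p" for p U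
  proof -
    obtain u v where uv: "U = (u, v)" "u \<in> fibre E p" "v \<in> fibre E p"
      using U by (cases U) (simp add: cfibre_iff)
    have conj: "sharp E (conj_form \<Omega>) p (x, y) = ((1/2) *\<^sub>R (I p x + K p y), (1/2) *\<^sub>R (I p y - K p x))"
      if "x \<in> fibre E p" "y \<in> fibre E p" for x y
    proof -
      have "(x, y) \<in> cfibre E p" "(x, - y) \<in> cfibre E p" using that by (simp_all add: cfibre_iff fibre_closed)
      then show ?thesis
        using that sharp_conj_form[OF tf, of "(x, y)" p] sharp[of "(x, - y)" p]
        by (simp add: cconj_def holomorphic_sharp_Pair rules algebra_simps)
    qed
    have plain: "sharp E \<Omega> p (x, y) = ((1/2) *\<^sub>R (I p x - K p y), (1/2) *\<^sub>R (I p y + K p x))"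
      if "x \<in> fibre E p" "y \<in> fibre E p" for x y
      using that sharp[of "(x, y)" p] by (simp add: cfibre_iff holomorphic_sharp_Pair)
    show ?thesis
      using uv(2,3)
      by (simp add: uv(1) plain conj rules fibre_closed products scaleR_add_right scaleR_diff_right)
        (simp flip: scaleR_add_left scaleR_diff_left scaleR_minus_left)
  qed
  ultimately show ?thesis unfolding holomorphic_symplectic_def by blast
qed

section \<open>From holomorphic symplectic forms to hypercomplex structures\<close>

context
  fixes J \<Omega>
  assumes J: "complex_structure E J" and HS: "holomorphic_symplectic E J \<Omega>"
begin

lemma symplectic_two_form: "two_form E \<Omega>"
  using HS unfolding holomorphic_symplectic_def section_wedge2_L_def by blast

lemma J_endo: "bundle_endomorphism E J"
  and J_square: "u \<in> fibre E p \<Longrightarrow> J p (J p u) = - u"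
  and J_skew: "skew_for_pairing E J"
  using J skew_if_almost_complex unfolding complex_structure_def almost_complex_structure_def by blast+

text \<open>
  All factors of the bivector lie in \<open>L\<^sub>J\<close>, and \<open>J\<close> is skew, so moving \<open>J\<close> to a factor produces \<open>- \<i>\<close>.
\<close>

lemma form_J:
  assumes U: "U \<in> cfibre E p" and V: "V \<in> cfibre E p"
  shows "\<Omega> p U (cext (J p) V) = - \<i> * \<Omega> p U V"
proof -
  obtain n A B where AB: "\<forall>i<n. A i \<in> L_bundle E J p \<and> B i \<in> L_bundle E J p"
    and sum: "\<forall>U\<in>cfibre E p. \<forall>V\<in>cfibre E p. \<Omega> p U V = (\<Sum>i<(n::nat). wedge_form E p (A i) (B i) U V)"
    using HS unfolding holomorphic_symplectic_def section_wedge2_L_def by blast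
  have JV: "cext (J p) V \<in> cfibre E p" using V by (simp add: cfibre_iff cext_def endomorphism_rules[OF J_endo])
  have L: "cpairing E p C (cext (J p) V) = - \<i> * cpairing E p C V" if C: "C \<in> L_bundle E J p" for C
  proof -
    have Cf: "C \<in> cfibre E p" and iC: "cext (J p) C = cscale \<i> C" using C by (simp_all add: L_bundle_def)
    have s: "pairing E p u (J p v) = - pairing E p (J p u) v" if "u \<in> fibre E p" "v \<in> fibre E p" for u v
      using J_skew that unfolding skew_for_pairing_def by fastforce
    have "cpairing E p C (cext (J p) V) = - cpairing E p (cext (J p) C) V"
      using Cf V by (simp add: cpairing_def cext_def cfibre_iff s complex_eq_iff)
    then show ?thesis unfolding iC cpairing_rules(3)[OF Cf V V] by simp
  qed
  have "wedge_form E p (A i) (B i) U (cext (J p) V) = - \<i> * wedge_form E p (A i) (B i) U V" if "i < n" for i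
    using AB that L unfolding wedge_form_def by (simp add: algebra_simps)
  then show ?thesis
    using sum U V JV by (simp add: sum_distrib_left)
qed

lemma sharp_real:
  assumes u: "u \<in> fibre E p"
  obtains r s where "r \<in> fibre E p" "s \<in> fibre E p" "sharp E \<Omega> p (u, 0) = (r, s)"
    "sharp E (conj_form \<Omega>) p (u, 0) = (r, - s)"
    "\<forall>v\<in>fibre E p. \<Omega> p (u, 0) (v, 0) = Complex (pairing E p r v) (pairing E p s v)"
proof -
  have U: "(v, 0) \<in> cfibre E p" if "v \<in> fibre E p" for v using that zero_in_fibre by (simp add: cfibre_iff)
  note sh = sharp_two_form[OF symplectic_two_form U[OF u]]
  obtain r s where rs: "sharp E \<Omega> p (u, 0) = (r, s)" by (cases "sharp E \<Omega> p (u, 0)")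
  then have f: "r \<in> fibre E p" "s \<in> fibre E p" using sh(1) by (simp_all add: cfibre_iff)
  show thesis
  proof (rule that[OF f rs])
    show "sharp E (conj_form \<Omega>) p (u, 0) = (r, - s)"
      using sharp_conj_form[OF symplectic_two_form U[OF u]] rs by (simp add: cconj_def)
    show "\<forall>v\<in>fibre E p. \<Omega> p (u, 0) (v, 0) = Complex (pairing E p r v) (pairing E p s v)"
      using sh(2)[OF U] rs f by (simp add: cpairing_def pairing_zero)
  qed
qed

lemma sharp_complex_linear:
  assumes u: "u \<in> fibre E p" and v: "v \<in> fibre E p"
  shows "sharp E \<Omega> p (u, v) = sharp E \<Omega> p (u, 0) + cscale \<i> (sharp E \<Omega> p (v, 0))"
proof (rule sharp_eqI)
  have U: "(w, 0) \<in> cfibre E p" if "w \<in> fibre E p" for w using that zero_in_fibre by (simp add: cfibre_iff)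
  have c: "cscale z W \<in> cfibre E p" if "W \<in> cfibre E p" for z W
    using that by (simp add: cfibre_iff cscale_def fibre_closed)
  note sh = sharp_two_form[OF symplectic_two_form]
  note su = sh(1)[OF U[OF u]] and sv = sh(1)[OF U[OF v]]
  show "sharp E \<Omega> p (u, 0) + cscale \<i> (sharp E \<Omega> p (v, 0)) \<in> cfibre E p"
    using su c[OF sv] by (simp add: cfibre_iff fibre_closed)
  show "\<forall>W\<in>cfibre E p. \<Omega> p (u, v) W = cpairing E p (sharp E \<Omega> p (u, 0) + cscale \<i> (sharp E \<Omega> p (v, 0))) W"
  proof
    fix W assume W: "W \<in> cfibre E p"
    have tf: "\<Omega> p (A + B) W = \<Omega> p A W + \<Omega> p B W" "\<Omega> p (cscale z A) W = z * \<Omega> p A W"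
      if "A \<in> cfibre E p" "B \<in> cfibre E p" for A B z
      using symplectic_two_form that W unfolding two_form_def by blast+
    have "(u, v) = (u, 0) + cscale \<i> (v, 0)" by (simp add: cscale_def)
    then have "\<Omega> p (u, v) W = \<Omega> p (u, 0) W + \<i> * \<Omega> p (v, 0) W"
      using tf(1)[OF U[OF u] c[OF U[OF v]], of \<i>] tf(2)[OF U[OF v] U[OF v], of \<i>] by simp
    then show "\<Omega> p (u, v) W = cpairing E p (sharp E \<Omega> p (u, 0) + cscale \<i> (sharp E \<Omega> p (v, 0))) W"
      by (simp add: cpairing_rules(1)[OF su c[OF sv] W] cpairing_rules(3)[OF sv W W]
          sh(2)[OF U[OF u] W] sh(2)[OF U[OF v] W])
  qed
qed

text \<open>
  On real vectors \<open>I\<close> and \<open>K\<close> are twice the real and twice the imaginary part of \<open>\<Omega>\<^sup>\<sharp>\<close>.  Complex linearity carries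
  this over to the whole fibre, where the right-hand sides commute with conjugation.
\<close>

lemma real_structures_exist:
  "\<exists>I K. \<forall>p. \<forall>U\<in>cfibre E p.
     cext (I p) U = sharp E \<Omega> p U + sharp E (conj_form \<Omega>) p U \<and>
     cext (K p) U = cscale (- \<i>) (sharp E \<Omega> p U - sharp E (conj_form \<Omega>) p U)"
proof (intro exI allI ballI)
  fix p U assume U: "U \<in> cfibre E p"
  let ?I = "\<lambda>p u. 2 *\<^sub>R fst (sharp E \<Omega> p (u, 0))" and ?K = "\<lambda>p u. 2 *\<^sub>R snd (sharp E \<Omega> p (u, 0))"
  obtain u v where uv: "U = (u, v)" "u \<in> fibre E p" "v \<in> fibre E p"
    using U by (cases U) (simp add: cfibre_iff)
  obtain r s where rs: "sharp E \<Omega> p (u, 0) = (r, s)" by (cases "sharp E \<Omega> p (u, 0)")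
  obtain r' s' where rs': "sharp E \<Omega> p (v, 0) = (r', s')" "r' \<in> fibre E p" "s' \<in> fibre E p"
    by (rule sharp_real[OF uv(3)])
  have U0: "(w, 0) \<in> cfibre E p" if "w \<in> fibre E p" for w using that zero_in_fibre by (simp add: cfibre_iff)
  have neg: "sharp E \<Omega> p (- v, 0) = (- r', - s')"
  proof (rule sharp_eqI)
    show "(- r', - s') \<in> cfibre E p" using rs' by (simp add: cfibre_iff fibre_closed)
    show "\<forall>W\<in>cfibre E p. \<Omega> p (- v, 0) W = cpairing E p (- r', - s') W"
    proof
      fix W assume W: "W \<in> cfibre E p"
      have "\<Omega> p (cscale (-1) (v, 0)) W = - 1 * \<Omega> p (v, 0) W"
        using symplectic_two_form U0[OF uv(3)] W unfolding two_form_def by blast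
      moreover have "cpairing E p (cscale (-1) (r', s')) W = - 1 * cpairing E p (r', s') W"
        using rs' W by (intro cpairing_rules(3)[OF _ W W]) (simp add: cfibre_iff)
      ultimately show "\<Omega> p (- v, 0) W = cpairing E p (- r', - s') W"
        using sharp_two_form(2)[OF symplectic_two_form U0[OF uv(3)] W] rs' by (simp add: cscale_def)
    qed
  qed
  have "sharp E \<Omega> p U = (r - s', s + r')"
    using sharp_complex_linear[OF uv(2,3)] by (simp add: uv(1) rs rs' cscale_def)
  moreover have "sharp E (conj_form \<Omega>) p U = (r + s', r' - s)"
    using sharp_conj_form[OF symplectic_two_form U] sharp_complex_linear[OF uv(2) fibre_closed(3)[OF uv(3)]]
    by (simp add: uv(1) cconj_def rs neg cscale_def)
  ultimately show "cext (?I p) U = sharp E \<Omega> p U + sharp E (conj_form \<Omega>) p U \<and>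
      cext (?K p) U = cscale (- \<i>) (sharp E \<Omega> p U - sharp E (conj_form \<Omega>) p U)"
    by (simp add: uv(1) cext_def cscale_def rs rs' scaleR_2)
qed

context
  fixes I K
  assumes IK: "\<And>p U. U \<in> cfibre E p \<Longrightarrow>
     cext (I p) U = sharp E \<Omega> p U + sharp E (conj_form \<Omega>) p U \<and>
     cext (K p) U = cscale (- \<i>) (sharp E \<Omega> p U - sharp E (conj_form \<Omega>) p U)"
begin

lemma sharp_IK: "U \<in> cfibre E p \<Longrightarrow> sharp E \<Omega> p U = holomorphic_sharp I K p U"
proof -
  assume U: "U \<in> cfibre E p"
  obtain a b c d where "sharp E \<Omega> p U = (a, b)" "sharp E (conj_form \<Omega>) p U = (c, d)"
    by (cases "sharp E \<Omega> p U", cases "sharp E (conj_form \<Omega>) p U")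
  then show ?thesis
    using IK[OF U] by (simp add: holomorphic_sharp_def cscale_def flip: scaleR_2)
qed

lemma IK_pairing:
  assumes u: "u \<in> fibre E p"
  shows "I p u \<in> fibre E p" "K p u \<in> fibre E p"
    "v \<in> fibre E p \<Longrightarrow> pairing E p (I p u) v = 2 * Re (\<Omega> p (u, 0) (v, 0))"
    "v \<in> fibre E p \<Longrightarrow> pairing E p (K p u) v = 2 * Im (\<Omega> p (u, 0) (v, 0))"
proof -
  obtain r s where rs: "r \<in> fibre E p" "s \<in> fibre E p" "sharp E \<Omega> p (u, 0) = (r, s)"
    "sharp E (conj_form \<Omega>) p (u, 0) = (r, - s)"
    "\<forall>v\<in>fibre E p. \<Omega> p (u, 0) (v, 0) = Complex (pairing E p r v) (pairing E p s v)"
    by (rule sharp_real[OF u])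
  have "(u, 0) \<in> cfibre E p" using u zero_in_fibre by (simp add: cfibre_iff)
  then have "I p u = 2 *\<^sub>R r" "K p u = 2 *\<^sub>R s"
    using IK[of "(u, 0)" p] rs(3,4) by (simp_all add: cext_def cscale_def scaleR_2)
  then show "I p u \<in> fibre E p" "K p u \<in> fibre E p"
    "v \<in> fibre E p \<Longrightarrow> pairing E p (I p u) v = 2 * Re (\<Omega> p (u, 0) (v, 0))"
    "v \<in> fibre E p \<Longrightarrow> pairing E p (K p u) v = 2 * Im (\<Omega> p (u, 0) (v, 0))"
    using rs(1,2,5) by (simp_all add: fibre_closed pairing_rules)
qed

text \<open>
  Both \<open>I\<close> and \<open>K\<close> are given by their pairings, which are the real and the imaginary part of \<open>2 \<Omega>\<close> on real
  vectors; linearity, skewness and smoothness are inherited from \<open>\<Omega>\<close>.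
\<close>

lemma IK_endomorphism_skew:
  "bundle_endomorphism E I" "skew_for_pairing E I" "bundle_endomorphism E K" "skew_for_pairing E K"
proof -
  have key: "bundle_endomorphism E F \<and> skew_for_pairing E F"
    if F: "\<And>p u. u \<in> fibre E p \<Longrightarrow> F p u \<in> fibre E p"
      and pair: "\<And>p u v. u \<in> fibre E p \<Longrightarrow> v \<in> fibre E p \<Longrightarrow> pairing E p (F p u) v = 2 * h (\<Omega> p (u, 0) (v, 0))"
      and h: "h = Re \<or> h = Im" for F h
  proof -
    have c: "(u, 0) \<in> cfibre E p" if "u \<in> fibre E p" for u p using that zero_in_fibre by (simp add: cfibre_iff)
    have add: "\<Omega> p (u + v, 0) (w, 0) = \<Omega> p (u, 0) (w, 0) + \<Omega> p (v, 0) (w, 0)"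
      if "u \<in> fibre E p" "v \<in> fibre E p" "w \<in> fibre E p" for p u v w
    proof -
      have "\<Omega> p ((u, 0) + (v, 0)) (w, 0) = \<Omega> p (u, 0) (w, 0) + \<Omega> p (v, 0) (w, 0)"
        using symplectic_two_form c[OF that(1)] c[OF that(2)] c[OF that(3)] unfolding two_form_def by blast
      then show ?thesis by simp
    qed
    have scale: "\<Omega> p (r *\<^sub>R u, 0) (w, 0) = r * \<Omega> p (u, 0) (w, 0)"
      if "u \<in> fibre E p" "w \<in> fibre E p" for p u w and r :: real
    proof -
      have "\<Omega> p (cscale (complex_of_real r) (u, 0)) (w, 0) = r * \<Omega> p (u, 0) (w, 0)"
        using symplectic_two_form c[OF that(1)] c[OF that(2)] unfolding two_form_def by blast
      then show ?thesis by (simp add: cscale_def)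
    qed
    have swap: "\<Omega> p (u, 0) (v, 0) = - \<Omega> p (v, 0) (u, 0)"
      if "u \<in> fibre E p" "v \<in> fibre E p" for p u v
      using symplectic_two_form c[OF that(1)] c[OF that(2)] unfolding two_form_def by blast
    have lin: "linear_on (fibre E p) (F p)" for p
      unfolding linear_on_def
    proof (intro conjI ballI allI)
      fix u v assume u: "u \<in> fibre E p" and v: "v \<in> fibre E p"
      show "F p (u + v) = F p u + F p v"
        by (rule pairing_eqI[OF courant_vector_bundle courant_pairing, of _ p])
          (use u v h in \<open>auto simp: F fibre_closed pairing_rules pair add scale\<close>)
    next
      fix r u assume u: "u \<in> fibre E p"
      show "F p (r *\<^sub>R u) = r *\<^sub>R F p u"
        by (rule pairing_eqI[OF courant_vector_bundle courant_pairing, of _ p])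
          (use u h in \<open>auto simp: F fibre_closed pairing_rules pair add scale\<close>)
    qed
    have sec: "(\<lambda>p. F p (x p)) \<in> sections E" if x: "x \<in> sections E" for x
    proof (rule section_if_pairings_smooth[OF courant_vector_bundle courant_pairing])
      show "F p (x p) \<in> fibre E p" for p by (rule F[OF in_fibre[OF x]])
      fix z assume z: "z \<in> sections E"
      have cs: "(\<lambda>p. (y p, 0)) \<in> csections E" if "y \<in> sections E" for y
        using that sections_scaleR[OF courant_vector_bundle that, of 0] by (simp add: csections_def)
      have "(\<lambda>p. \<Omega> p (x p, 0) (z p, 0)) \<in> smooth_functions (atlas E)"
        using symplectic_two_form[unfolded two_form_def, THEN conjunct2, rule_format, OF cs[OF x] cs[OF z]] .
      then have "(\<lambda>p. 2 * h (\<Omega> p (x p, 0) (z p, 0))) \<in> smooth_functions (atlas E)"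
        using h smooth_Re_Im by (auto intro!: smooth_functions_cmult)
      then show "(\<lambda>p. pairing E p (F p (x p)) (z p)) \<in> smooth_functions (atlas E)"
        using pair[OF in_fibre[OF x] in_fibre[OF z]] by simp
    qed
    have "pairing E p (F p u) v = - pairing E p u (F p v)" if u: "u \<in> fibre E p" and v: "v \<in> fibre E p" for p u v
      using pair[OF u v] pair[OF v u] pairing_sym[OF u F[OF v]] swap[OF u v] h by auto
    then show ?thesis using lin sec F unfolding bundle_endomorphism_def skew_for_pairing_def by blast
  qed
  show "bundle_endomorphism E I" "skew_for_pairing E I" "bundle_endomorphism E K" "skew_for_pairing E K"
    using key[OF IK_pairing(1) IK_pairing(3)] key[OF IK_pairing(2) IK_pairing(4)] by blast+
qed

text \<open>
  The relation \<open>\<Omega>(u, J v) = - \<i> \<Omega>(u, v)\<close> splits into \<open>J I = - K\<close> and \<open>J K = I\<close>.  Transposition yields \<open>I J = K\<close> and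
  \<open>K J = - I\<close>, hence \<open>K K = I J K = I I\<close>; the normalisation of \<open>\<Omega>\<close> says \<open>I I + K K = - 2\<close>, so both squares are \<open>- 1\<close>.
\<close>

lemma IJK_quaternionic: "quaternionic E I J K"
proof -
  note rules = endomorphism_rules[OF IK_endomorphism_skew(1)] endomorphism_rules[OF J_endo] endomorphism_rules[OF IK_endomorphism_skew(3)]
  have skew: "pairing E p (I p u) v = - pairing E p u (I p v)" "pairing E p (J p u) v = - pairing E p u (J p v)"
    "pairing E p (K p u) v = - pairing E p u (K p v)" if "u \<in> fibre E p" "v \<in> fibre E p" for p u v
    using IK_endomorphism_skew(2,4) J_skew that unfolding skew_for_pairing_def by blast+
  have form: "\<Omega> p (u, 0) (J p v, 0) = - \<i> * \<Omega> p (u, 0) (v, 0)" if "u \<in> fibre E p" "v \<in> fibre E p" for p u v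
    using form_J[of "(u, 0)" p "(v, 0)"] that zero_in_fibre endo_zero[OF J_endo]
    by (simp add: cfibre_iff cext_def)
  have pJ: "pairing E p (I p u) (J p v) = pairing E p (K p u) v" "pairing E p (K p u) (J p v) = - pairing E p (I p u) v"
    if u: "u \<in> fibre E p" and v: "v \<in> fibre E p" for p u v
    using IK_pairing(3,4)[OF u rules(8)[OF v]] IK_pairing(3,4)[OF u v] form[OF u v] by simp_all
  have JI: "J p (I p u) = - K p u" if u: "u \<in> fibre E p" for p u
    by (rule pairing_eqI[OF courant_vector_bundle courant_pairing, of _ p]) (use u in \<open>simp_all add: rules fibre_closed pairing_rules skew(2) pJ\<close>)
  have JK: "J p (K p u) = I p u" if u: "u \<in> fibre E p" for p u
    by (rule pairing_eqI[OF courant_vector_bundle courant_pairing, of _ p]) (use u in \<open>simp_all add: rules fibre_closed pairing_rules skew(2) pJ\<close>)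
  have IJ: "I p (J p u) = K p u" if u: "u \<in> fibre E p" for p u
    by (rule pairing_eqI[OF courant_vector_bundle courant_pairing, of _ p])
      (use u in \<open>simp_all add: rules fibre_closed pairing_rules skew(1,2) JI skew(3)\<close>)
  have KJ: "K p (J p u) = - I p u" if u: "u \<in> fibre E p" for p u
    by (rule pairing_eqI[OF courant_vector_bundle courant_pairing, of _ p])
      (use u in \<open>simp_all add: rules fibre_closed pairing_rules skew(2,3) JK skew(1)\<close>)
  have KK: "K p (K p u) = I p (I p u)" if u: "u \<in> fibre E p" for p u
    using IJ[of "K p u" p] JK[OF u] u by (simp add: rules)
  have II: "I p (I p u) = - u" if u: "u \<in> fibre E p" for p u
  proof -
    have plain: "sharp E \<Omega> p (x, y) = ((1/2) *\<^sub>R (I p x - K p y), (1/2) *\<^sub>R (I p y + K p x))"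
      if "x \<in> fibre E p" "y \<in> fibre E p" for x y
      using that sharp_IK[of "(x, y)" p] by (simp add: cfibre_iff holomorphic_sharp_Pair)
    have conj: "sharp E (conj_form \<Omega>) p (x, y) = ((1/2) *\<^sub>R (I p x + K p y), (1/2) *\<^sub>R (I p y - K p x))"
      if "x \<in> fibre E p" "y \<in> fibre E p" for x y
      using that sharp_conj_form[OF symplectic_two_form, of "(x, y)" p] plain[OF that(1) fibre_closed(3)[OF that(2)]]
      by (simp add: cfibre_iff cconj_def rules algebra_simps)
    have "sharp E \<Omega> p (sharp E (conj_form \<Omega>) p (u, 0)) + sharp E (conj_form \<Omega>) p (sharp E \<Omega> p (u, 0)) = - (u, 0)"
      using HS u zero_in_fibre unfolding holomorphic_symplectic_def by (simp add: cfibre_iff)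
    then have "(1/2) *\<^sub>R (I p ((1/2) *\<^sub>R I p u) + K p ((1/2) *\<^sub>R K p u))
        + (1/2) *\<^sub>R (I p ((1/2) *\<^sub>R I p u) + K p ((1/2) *\<^sub>R K p u)) = - u"
      using u by (simp add: plain conj rules zero_in_fibre fibre_closed endo_zero[OF IK_endomorphism_skew(1)]
          endo_zero[OF IK_endomorphism_skew(3)])
    then have "(1/2) *\<^sub>R I p (I p u) + (1/2) *\<^sub>R I p (I p u) = - u"
      using u by (simp add: rules fibre_closed KK flip: scaleR_2)
    then show ?thesis by (simp flip: scaleR_add_left)
  qed
  have IK': "I p (K p u) = - J p u" if u: "u \<in> fibre E p" for p u
    using IJ[OF u] II[OF rules(8)[OF u]] by metis
  have KI: "K p (I p u) = J p u" if u: "u \<in> fibre E p" for p u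
    using KJ[of "K p u" p] JK[OF u] IK'[OF u] u by (simp add: rules)
  show ?thesis
    unfolding quaternionic_def using IK_endomorphism_skew(1,3) J_endo II J_square KK JI JK IJ KJ IK' KI by simp
qed

lemma holomorphic_symplectic_imp_hypercomplex: "hypercomplex_structure E I J K"
proof -
  note Q = IJK_quaternionic
  note skew = IK_endomorphism_skew(2) J_skew IK_endomorphism_skew(4)
  note products = quaternion_products[OF Q]
  have ac: "almost_complex_structure E I" "almost_complex_structure E J" "almost_complex_structure E K"
    using almost_complex_if_skew IK_endomorphism_skew J_endo J_skew products(1-3) by blast+
  have \<Omega>: "\<Omega> p U V = cpairing E p (holomorphic_sharp I K p U) V"
    if "U \<in> cfibre E p" "V \<in> cfibre E p" for p U V
    using sharp_two_form(2)[OF symplectic_two_form that] sharp_IK[OF that(1)] by simp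
  have JJ: "nijenhuis_vanishes E J J" using J unfolding complex_structure_def by blast
  have "d_Lstar_closed E J \<Omega>" using HS unfolding holomorphic_symplectic_def by blast
  then have JI: "nijenhuis_vanishes E J I" using closed_iff_nijenhuis_JI[OF Q skew \<Omega> JJ] by blast
  have "\<forall>p. \<forall>u\<in>fibre E p. I p (J p (K p u)) = - u" using products(1,5) by simp
  then show ?thesis
    unfolding hypercomplex_structure_def using ac nijenhuis_vanishes_all[OF Q JJ JI] JJ by blast
qed

end

end

end

theorem theorem4p6:
  fixes E :: "('m::{t2_space,second_countable_topology}, 'c::real_inner, 'v::real_vector,
                'f::real_inner) courant"
  assumes "courant_algebroid E"
  shows
    "(\<forall>I J K. hypercomplex_structure E I J K \<longrightarrow>
        complex_structure E J \<and>
        (\<exists>\<Omega>. two_form E \<Omega> \<and>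
           (\<forall>p. \<forall>U\<in>cfibre E p.
              sharp E \<Omega> p U = cscale (1 / 2) (cext (I p) U + cscale \<i> (cext (K p) U)))) \<and>
        (\<forall>\<Omega>. two_form E \<Omega> \<and>
           (\<forall>p. \<forall>U\<in>cfibre E p.
              sharp E \<Omega> p U = cscale (1 / 2) (cext (I p) U + cscale \<i> (cext (K p) U)))
           \<longrightarrow> holomorphic_symplectic E J \<Omega>)) \<and>
     (\<forall>J \<Omega>. complex_structure E J \<and> holomorphic_symplectic E J \<Omega> \<longrightarrow>
        (\<exists>I K. \<forall>p. \<forall>U\<in>cfibre E p.
           cext (I p) U = sharp E \<Omega> p U + sharp E (conj_form \<Omega>) p U \<and>
           cext (K p) U = cscale (- \<i>) (sharp E \<Omega> p U - sharp E (conj_form \<Omega>) p U)) \<and>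
        (\<forall>I K. (\<forall>p. \<forall>U\<in>cfibre E p.
           cext (I p) U = sharp E \<Omega> p U + sharp E (conj_form \<Omega>) p U \<and>
           cext (K p) U = cscale (- \<i>) (sharp E \<Omega> p U - sharp E (conj_form \<Omega>) p U))
           \<longrightarrow> hypercomplex_structure E I J K))"
proof (intro conjI allI impI)
  fix I J K assume H: "hypercomplex_structure E I J K"
  show "complex_structure E J"
    using H unfolding hypercomplex_structure_def complex_structure_def by blast
  have endomorphisms: "bundle_endomorphism E I" "bundle_endomorphism E K"
    and skew: "skew_for_pairing E I" "skew_for_pairing E K"
    using H skew_if_almost_complex[OF assms]
    unfolding hypercomplex_structure_def almost_complex_structure_def by blast+
  have "sharp E (\<lambda>p U V. cpairing E p (holomorphic_sharp I K p U) V) p U = holomorphic_sharp I K p U"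
    if "U \<in> cfibre E p" for p U
    using that by (intro sharp_eqI[OF assms] holomorphic_sharp_fibre[OF assms endomorphisms]) blast+
  then show "\<exists>\<Omega>. two_form E \<Omega> \<and> (\<forall>p. \<forall>U\<in>cfibre E p.
      sharp E \<Omega> p U = cscale (1 / 2) (cext (I p) U + cscale \<i> (cext (K p) U)))"
    using two_form_holomorphic_sharp[OF assms endomorphisms skew] unfolding holomorphic_sharp_def by blast
  fix \<Omega> assume "two_form E \<Omega> \<and> (\<forall>p. \<forall>U\<in>cfibre E p.
      sharp E \<Omega> p U = cscale (1 / 2) (cext (I p) U + cscale \<i> (cext (K p) U)))"
  then show "holomorphic_symplectic E J \<Omega>"
    by (intro hypercomplex_imp_holomorphic_symplectic[OF assms H]) (simp_all add: holomorphic_sharp_def)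
next
  fix J \<Omega> assume "complex_structure E J \<and> holomorphic_symplectic E J \<Omega>"
  then have J: "complex_structure E J" "holomorphic_symplectic E J \<Omega>" by blast+
  show "\<exists>I K. \<forall>p. \<forall>U\<in>cfibre E p.
      cext (I p) U = sharp E \<Omega> p U + sharp E (conj_form \<Omega>) p U \<and>
      cext (K p) U = cscale (- \<i>) (sharp E \<Omega> p U - sharp E (conj_form \<Omega>) p U)"
    by (rule real_structures_exist[OF assms J])
  fix I K assume "\<forall>p. \<forall>U\<in>cfibre E p.
      cext (I p) U = sharp E \<Omega> p U + sharp E (conj_form \<Omega>) p U \<and>
      cext (K p) U = cscale (- \<i>) (sharp E \<Omega> p U - sharp E (conj_form \<Omega>) p U)"
  then show "hypercomplex_structure E I J K"
    by (intro holomorphic_symplectic_imp_hypercomplex[OF assms J]) blast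
qed

end
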